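(* Let $\mathbb{K}$ be an algebraically closed field of characteristic zero. Let $X$ be a trinomial variety of Type 1, or a factorial trinomial variety of Type 2, over $\mathbb{K}$, with data $r$, $m$, $n_i$, $l_{ij}$ as in the context. Then $X$ is not rigid if and only if at least one of the following holds: 1) $m\neq 0$; 2) $X$ is of Type 1 and there is $b\in\{1,\ldots,r\}$ such that for each $i\in\{1,\ldots,r\}\setminus\{b\}$ there is $j(i)\in\{1,\ldots,n_i\}$ with $l_{ij(i)}=1$; 3) $X$ is of Type 2 and there are $b$ and $c$ in $\{0,\ldots,r\}$ such that for each $i\in\{0,\ldots,r\}\setminus\{b,c\}$ there is $j(i)\in\{1,\ldots,n_i\}$ with $l_{ij(i)}=1$.
   Context: Trinomial varieties. Fix integers $r,n>0$, $m\ge 0$, and $q\in\{0,1\}$, and a partition $n=n_q+\ldots+n_r$ with all $n_i>0$ integers. For each $i=q,\ldots,r$ fix a tuple $l_i=(l_{i1},\ldots,l_{in_i})$ of positive integers and put $T_i^{l_i}=T_{i1}^{l_{i1}}\cdots T_{in_i}^{l_{in_i}}$ in the polynomial ring $\mathbb{K}[T_{ij},S_k]=\mathbb{K}[T_{ij},S_k\mid q\le i\le r,\ 1\le j\le n_i,\ 1\le k\le m]$. Type 1: $q=1$, $A=(a_1,\ldots,a_r)$ with pairwise distinct $a_j\in\mathbb{K}$, $I=\{1,\ldots,r-1\}$, and for $i\in I$ $$g_i=T_i^{l_i}-T_{i+1}^{l_{i+1}}-(a_{i+1}-a_i).$$ Type 2: $q=0$, $A=\begin{pmatrix}a_{10}&a_{11}&\ldots&a_{1r}\\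 a_{20}&a_{21}&\ldots&a_{2r}\end{pmatrix}$ is a $2\times(r+1)$-matrix over $\mathbb{K}$ with pairwise linearly independent columns, $I=\{0,\ldots,r-2\}$ (empty if $r=1$), and for $i\in I$ $$g_i=\det\begin{pmatrix}T_i^{l_i}&T_{i+1}^{l_{i+1}}&T_{i+2}^{l_{i+2}}\\ a_{1,i}&a_{1,i+1}&a_{1,i+2}\\ a_{2,i}&a_{2,i+1}&a_{2,i+2}\end{pmatrix}.$$ In both cases put $R(A)=\mathbb{K}[T_{ij},S_k]/(g_i\mid i\in I)$. The variety $X=\mathrm{Spec}(R(A))$ is called a trinomial variety (of Type 1 or Type 2 respectively); it is known to be irreducible and normal. It is factorial if $R(A)$ is a unique factorization domain. A derivation $\partial$ of a commutative $\mathbb{K}$-algebra $B$ is locally nilpotent (an LND) if for every $b\in B$ there is a positive integer $n$ with $\partial^n(b)=0$. An affine variety $X$ is rigid if $\mathbb{K}[X]$ admits no nonzero LND. *)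

theory Defs
  imports
    "HOL-Library.Poly_Mapping"
    "HOL-Analysis.Determinants"
    "HOL-Algebra.QuotRing"
    "HOL-Algebra.Ring_Divisibility"
    "HOL-Algebra.Algebraic_Closure_Type"
begin

subsection \<open>Polynomial rings in a given set of variables\<close>

type_synonym ('v, 'k) mpoly = "('v \<Rightarrow>\<^sub>0 nat) \<Rightarrow>\<^sub>0 'k"

definition mvar :: "'v \<Rightarrow> ('v, 'k::comm_ring_1) mpoly" where
  "mvar v = Poly_Mapping.single (Poly_Mapping.single v 1) 1"

definition mconst :: "'k \<Rightarrow> ('v, 'k::comm_ring_1) mpoly" where
  "mconst c = Poly_Mapping.single 0 c"

definition mpoly_vars :: "('v, 'k::comm_ring_1) mpoly \<Rightarrow> 'v set" where
  "mpoly_vars p = (\<Union>e\<in>Poly_Mapping.keys p. Poly_Mapping.keys e)"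

definition mpoly_ring :: "'v set \<Rightarrow> ('v, 'k::comm_ring_1) mpoly ring" where
  "mpoly_ring V = ring_of_type_algebra\<lparr>carrier := {p. mpoly_vars p \<subseteq> V}\<rparr>"


subsection \<open>Locally nilpotent derivations and rigidity\<close>

text \<open>A \<open>\<bbbK>\<close>-algebra is given by a ring \<open>B\<close> together with its structure map \<open>\<iota>\<close> from \<open>\<bbbK>\<close> to \<open>B\<close>.
  Only the values of a derivation on \<open>carrier B\<close> are meaningful.\<close>

definition alg_derivation ::
    "('b, 'c) ring_scheme \<Rightarrow> ('k \<Rightarrow> 'b) \<Rightarrow> ('b \<Rightarrow> 'b) \<Rightarrow> bool" where
  "alg_derivation B \<iota> D \<longleftrightarrow>
     D \<in> carrier B \<rightarrow> carrier B \<and>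
     (\<forall>x\<in>carrier B. \<forall>y\<in>carrier B. D (x \<oplus>\<^bsub>B\<^esub> y) = D x \<oplus>\<^bsub>B\<^esub> D y) \<and>
     (\<forall>c. \<forall>x\<in>carrier B. D (\<iota> c \<otimes>\<^bsub>B\<^esub> x) = \<iota> c \<otimes>\<^bsub>B\<^esub> D x) \<and>
     (\<forall>x\<in>carrier B. \<forall>y\<in>carrier B.
        D (x \<otimes>\<^bsub>B\<^esub> y) = (D x \<otimes>\<^bsub>B\<^esub> y) \<oplus>\<^bsub>B\<^esub> (x \<otimes>\<^bsub>B\<^esub> D y))"

definition locally_nilpotent_derivation ::
    "('b, 'c) ring_scheme \<Rightarrow> ('k \<Rightarrow> 'b) \<Rightarrow> ('b \<Rightarrow> 'b) \<Rightarrow> bool" where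
  "locally_nilpotent_derivation B \<iota> D \<longleftrightarrow>
     alg_derivation B \<iota> D \<and> (\<forall>x\<in>carrier B. \<exists>k>0. (D ^^ k) x = \<zero>\<^bsub>B\<^esub>)"

definition rigid_algebra :: "('b, 'c) ring_scheme \<Rightarrow> ('k \<Rightarrow> 'b) \<Rightarrow> bool" where
  "rigid_algebra B \<iota> \<longleftrightarrow>
     \<not> (\<exists>D. locally_nilpotent_derivation B \<iota> D \<and> (\<exists>x\<in>carrier B. D x \<noteq> \<zero>\<^bsub>B\<^esub>))"


subsection \<open>Trinomial varieties\<close>

text \<open>\<open>TVar i j\<close> and \<open>SVar k\<close> stand for the variables \<open>T\<^sub>i\<^sub>j\<close> and \<open>S\<^sub>k\<close>.\<close>

datatype trinomial_var = TVar nat nat | SVar nat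

text \<open>The coefficient data \<open>A\<close>: \<open>a\<^sub>1, \<dots>, a\<^sub>r\<close> for Type 1, and the columns with indices
  \<open>0, \<dots>, r\<close> of the \<open>2 \<times> (r + 1)\<close> matrix for Type 2. Entries at other indices are never used.\<close>

datatype 'k trinomial_coeffs = is_Type1: Type1 "nat \<Rightarrow> 'k" | is_Type2: Type2 "nat \<Rightarrow> 'k ^ 2"

fun trinomial_q :: "'k trinomial_coeffs \<Rightarrow> nat" where
  "trinomial_q (Type1 _) = 1"
| "trinomial_q (Type2 _) = 0"

text \<open>In Type 2 the condition \<open>A i \<noteq> A j\<close> is needed because \<open>vec.independent\<close> is a property of the
  set \<open>{A i, A j}\<close>, which would be a singleton for equal columns.\<close>

fun trinomial_coeffs_ok :: "nat \<Rightarrow> 'k::field trinomial_coeffs \<Rightarrow> bool" where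
  "trinomial_coeffs_ok r (Type1 a) \<longleftrightarrow>
     (\<forall>i\<in>{1..r}. \<forall>j\<in>{1..r}. i \<noteq> j \<longrightarrow> a i \<noteq> a j)"
| "trinomial_coeffs_ok r (Type2 A) \<longleftrightarrow>
     (\<forall>i\<in>{0..r}. \<forall>j\<in>{0..r}. i \<noteq> j \<longrightarrow> A i \<noteq> A j \<and> vec.independent {A i, A j})"

definition trinomial_data ::
    "nat \<Rightarrow> (nat \<Rightarrow> nat) \<Rightarrow> (nat \<Rightarrow> nat \<Rightarrow> nat) \<Rightarrow> 'k::field trinomial_coeffs \<Rightarrow> bool" where
  "trinomial_data r n l A \<longleftrightarrow>
     r > 0 \<and>
     (\<forall>i\<in>{trinomial_q A..r}. n i > 0 \<and> (\<forall>j\<in>{1..n i}. l i j > 0)) \<and>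
     trinomial_coeffs_ok r A"

definition trinomial_vars ::
    "nat \<Rightarrow> nat \<Rightarrow> (nat \<Rightarrow> nat) \<Rightarrow> 'k trinomial_coeffs \<Rightarrow> trinomial_var set" where
  "trinomial_vars r m n A =
     {TVar i j | i j. i \<in> {trinomial_q A..r} \<and> j \<in> {1..n i}} \<union> SVar ` {1..m}"

definition trinomial_monom ::
    "(nat \<Rightarrow> nat) \<Rightarrow> (nat \<Rightarrow> nat \<Rightarrow> nat) \<Rightarrow> nat \<Rightarrow> (trinomial_var, 'k::comm_ring_1) mpoly" where
  "trinomial_monom n l i = (\<Prod>j=1..n i. mvar (TVar i j) ^ l i j)"

text \<open>The index sets are \<open>{1, \<dots>, r - 1}\<close> for Type 1 and \<open>{0, \<dots>, r - 2}\<close> for Type 2; they are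
  written without subtraction, so that the latter is empty for \<open>r = 1\<close>.\<close>

fun trinomial_relations ::
    "nat \<Rightarrow> (nat \<Rightarrow> nat) \<Rightarrow> (nat \<Rightarrow> nat \<Rightarrow> nat) \<Rightarrow> 'k::field trinomial_coeffs
      \<Rightarrow> (trinomial_var, 'k) mpoly set" where
  "trinomial_relations r n l (Type1 a) =
     {trinomial_monom n l i - trinomial_monom n l (i + 1) - mconst (a (i + 1) - a i)
       | i. 1 \<le> i \<and> i + 1 \<le> r}"
| "trinomial_relations r n l (Type2 A) =
     {det (vector [
         vector [trinomial_monom n l i, trinomial_monom n l (i + 1), trinomial_monom n l (i + 2)],
         vector [mconst (A i $ 1), mconst (A (i + 1) $ 1), mconst (A (i + 2) $ 1)],
         vector [mconst (A i $ 2), mconst (A (i + 1) $ 2), mconst (A (i + 2) $ 2)]]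
         :: ((trinomial_var, 'k) mpoly) ^ 3 ^ 3)
       | i. i + 2 \<le> r}"

definition trinomial_ideal ::
    "nat \<Rightarrow> nat \<Rightarrow> (nat \<Rightarrow> nat) \<Rightarrow> (nat \<Rightarrow> nat \<Rightarrow> nat) \<Rightarrow> 'k::field trinomial_coeffs
      \<Rightarrow> (trinomial_var, 'k) mpoly set" where
  "trinomial_ideal r m n l A =
     genideal (mpoly_ring (trinomial_vars r m n A)) (trinomial_relations r n l A)"

definition trinomial_algebra ::
    "nat \<Rightarrow> nat \<Rightarrow> (nat \<Rightarrow> nat) \<Rightarrow> (nat \<Rightarrow> nat \<Rightarrow> nat) \<Rightarrow> 'k::field trinomial_coeffs
      \<Rightarrow> (trinomial_var, 'k) mpoly set ring" where
  "trinomial_algebra r m n l A =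
     mpoly_ring (trinomial_vars r m n A) Quot trinomial_ideal r m n l A"

definition trinomial_const ::
    "nat \<Rightarrow> nat \<Rightarrow> (nat \<Rightarrow> nat) \<Rightarrow> (nat \<Rightarrow> nat \<Rightarrow> nat) \<Rightarrow> 'k::field trinomial_coeffs
      \<Rightarrow> 'k \<Rightarrow> (trinomial_var, 'k) mpoly set" where
  "trinomial_const r m n l A c =
     trinomial_ideal r m n l A +>\<^bsub>mpoly_ring (trinomial_vars r m n A)\<^esub> mconst c"


subsection \<open>Well-formedness\<close>

lemma mpoly_vars_simps [simp]:
  "mpoly_vars (mconst c :: ('v, 'k::comm_ring_1) mpoly) = {}"
  "mpoly_vars (0 :: ('v, 'k) mpoly) = {}"
  "mpoly_vars (1 :: ('v, 'k) mpoly) = {}"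
  "mpoly_vars (mvar v :: ('v, 'k) mpoly) = {v}"
  by (auto simp: mpoly_vars_def mconst_def mvar_def)

lemma mpoly_vars_add: "mpoly_vars (p + q) \<subseteq> mpoly_vars p \<union> mpoly_vars q"
  using Poly_Mapping.keys_add[of p q] by (force simp: mpoly_vars_def)

lemma mpoly_vars_uminus [simp]: "mpoly_vars (- p) = mpoly_vars p"
proof -
  have "Poly_Mapping.keys (- p) = Poly_Mapping.keys p"
    by (auto simp: in_keys_iff)
  then show ?thesis
    by (simp add: mpoly_vars_def)
qed

lemma mpoly_vars_diff: "mpoly_vars (p - q) \<subseteq> mpoly_vars p \<union> mpoly_vars q"
  using mpoly_vars_add[of p "- q"] by simp

lemma mpoly_vars_mult: "mpoly_vars (p * q) \<subseteq> mpoly_vars p \<union> mpoly_vars q"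
proof
  fix v assume "v \<in> mpoly_vars (p * q)"
  then obtain e where e: "e \<in> Poly_Mapping.keys (p * q)" "v \<in> Poly_Mapping.keys e"
    by (auto simp: mpoly_vars_def)
  then obtain a b where "a \<in> Poly_Mapping.keys p" "b \<in> Poly_Mapping.keys q" "e = a + b"
    using Poly_Mapping.keys_mult[of p q] by blast
  then show "v \<in> mpoly_vars p \<union> mpoly_vars q"
    using e(2) Poly_Mapping.keys_add[of a b] by (auto simp: mpoly_vars_def)
qed

lemma mpoly_vars_power: "mpoly_vars (p ^ k) \<subseteq> mpoly_vars p"
  by (induction k) (use mpoly_vars_mult in force)+

lemma mpoly_vars_prod: "mpoly_vars (prod f I) \<subseteq> (\<Union>i\<in>I. mpoly_vars (f i))"
  by (induction I rule: infinite_finite_induct) (use mpoly_vars_mult in force)+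

lemma cring_mpoly_ring: "cring (mpoly_ring V :: ('v, 'k::comm_ring_1) mpoly ring)"
proof -
  have closed: "mpoly_vars (p + q) \<subseteq> V" "mpoly_vars (p * q) \<subseteq> V"
    if "mpoly_vars p \<subseteq> V" "mpoly_vars q \<subseteq> V" for p q :: "('v, 'k) mpoly"
    using that mpoly_vars_add[of p q] mpoly_vars_mult[of p q] by blast+
  show ?thesis
  proof (intro cringI abelian_groupI comm_monoidI)
    fix x assume x: "x \<in> carrier (mpoly_ring V :: ('v, 'k) mpoly ring)"
    show "\<exists>y\<in>carrier (mpoly_ring V). y \<oplus>\<^bsub>mpoly_ring V\<^esub> x = \<zero>\<^bsub>mpoly_ring V\<^esub>"
      by (rule bexI[of _ "- x"]) (use x in \<open>auto simp: mpoly_ring_def ring_of_type_algebra_def\<close>)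
  qed (simp_all add: mpoly_ring_def ring_of_type_algebra_def closed algebra_simps)
qed

lemma trinomial_relations_subset:
  "trinomial_relations r n l A \<subseteq> carrier (mpoly_ring (trinomial_vars r m n A))"
proof -
  let ?V = "trinomial_vars r m n A"
  have monom: "mpoly_vars (trinomial_monom n l i :: (trinomial_var, 'a) mpoly) \<subseteq> ?V"
    if "trinomial_q A \<le> i" "i \<le> r" for i
  proof -
    have "mpoly_vars (trinomial_monom n l i :: (trinomial_var, 'a) mpoly)
            \<subseteq> (\<Union>j\<in>{1..n i}. mpoly_vars (mvar (TVar i j) ^ l i j :: (trinomial_var, 'a) mpoly))"
      unfolding trinomial_monom_def by (rule mpoly_vars_prod)
    also have "\<dots> \<subseteq> TVar i ` {1..n i}"
    proof (rule UN_least)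
      fix j assume "j \<in> {1..n i}"
      then show "mpoly_vars (mvar (TVar i j) ^ l i j :: (trinomial_var, 'a) mpoly)
                   \<subseteq> TVar i ` {1..n i}"
        using mpoly_vars_power[of "mvar (TVar i j) :: (trinomial_var, 'a) mpoly" "l i j"] by auto
    qed
    also have "\<dots> \<subseteq> ?V"
      using that by (auto simp: trinomial_vars_def)
    finally show ?thesis .
  qed
  have add: "mpoly_vars (p + q) \<subseteq> ?V" and diff: "mpoly_vars (p - q) \<subseteq> ?V"
    and mult: "mpoly_vars (p * q) \<subseteq> ?V"
    if "mpoly_vars p \<subseteq> ?V" "mpoly_vars q \<subseteq> ?V" for p q :: "(trinomial_var, 'a) mpoly"
    using that mpoly_vars_add[of p q] mpoly_vars_diff[of p q] mpoly_vars_mult[of p q] by blast+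
  show ?thesis
  proof (cases A)
    case (Type1 a)
    show ?thesis
    proof
      fix g assume "g \<in> trinomial_relations r n l A"
      then obtain i where "1 \<le> i" "i + 1 \<le> r" and g:
        "g = trinomial_monom n l i - trinomial_monom n l (i + 1) - mconst (a (i + 1) - a i)"
        by (auto simp: Type1)
      then have "mpoly_vars g \<subseteq> ?V"
        unfolding g by (intro diff monom) (auto simp: Type1)
      then show "g \<in> carrier (mpoly_ring ?V)"
        by (simp add: mpoly_ring_def)
    qed
  next
    case (Type2 a)
    show ?thesis
    proof
      fix g assume "g \<in> trinomial_relations r n l A"
      then obtain i where i: "i + 2 \<le> r" and g: "g = det (vector [
         vector [trinomial_monom n l i, trinomial_monom n l (i + 1), trinomial_monom n l (i + 2)],
         vector [mconst (a i $ 1), mconst (a (i + 1) $ 1), mconst (a (i + 2) $ 1)],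
         vector [mconst (a i $ 2), mconst (a (i + 1) $ 2), mconst (a (i + 2) $ 2)]]
         :: ((trinomial_var, 'a) mpoly) ^ 3 ^ 3)"
        by (auto simp: Type2)
      have "mpoly_vars g \<subseteq> ?V"
        unfolding g det_3 vector_3 by (intro diff add mult monom) (use i in \<open>auto simp: Type2\<close>)
      then show "g \<in> carrier (mpoly_ring ?V)"
        by (simp add: mpoly_ring_def)
    qed
  qed
qed

lemma cring_trinomial_algebra: "cring (trinomial_algebra r m n l A)"
  unfolding trinomial_algebra_def trinomial_ideal_def
  by (intro ideal.quotient_is_cring cring_mpoly_ring ring.genideal_ideal
      trinomial_relations_subset cring.axioms(1))

end

theory Submission
  imports Defs
begin

text \<open>A triangular derivation shows that the listed varieties are not rigid. For the converse, let \<open>\<partial>\<close> be a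
  locally nilpotent derivation. Suppose that a linear form in the monomials \<open>F\<^sub>i = T\<^sub>i\<^sup>l\<^sup>i\<close> (in Type 1: the
  constant \<open>1\<close>) lies in the kernel. If no variable of \<open>F\<^sub>i\<close> and \<open>F\<^sub>k\<close> occurs with exponent \<open>1\<close>, then
  \<open>\<partial>F\<^sub>i\<close>, which is proportional to \<open>\<partial>F\<^sub>k\<close>, is divisible by the coprime elements
  \<open>\<Prod>T\<^sub>i\<^sub>j\<^sup>l\<^sup>-\<^sup>1\<close> and \<open>\<Prod>T\<^sub>k\<^sub>j\<^sup>l\<^sup>-\<^sup>1\<close>. Comparing degrees along the orbits (as in the Mason--Stothers theorem)
  gives \<open>\<partial>F\<^sub>i = 0\<close>, and the kernel is factorially closed.

  In Type 2, factoriality makes the variables of the relevant blocks prime and the exponent gcds of the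
  blocks pairwise coprime. Hence elements that are homogeneous for all torus gradings are products of
  variables and of linear forms in the \<open>F\<^sub>i\<close>. Replacing \<open>\<partial>\<close> by a homogeneous derivation, one finds
  a linear form in its kernel: otherwise the kernel would have degree \<open>0\<close> for a grading in which
  exactly one variable of every block has positive degree, and two of the \<open>F\<^sub>i\<close> would be proportional
  over the kernel. In Type 1 the argument is applied to the orbits of closed points; these suffice
  because reduced monomials restrict to independent characters on general fibres.\<close>

subsection \<open>Linear maps out of the polynomial ring\<close>

text \<open>The degree argument needs a prime ideal, so that degrees add up on products, and
  cofactors that are coprime modulo it. The two types get these from different sources. In Type 2
  the differences are not constant; primality of the variables replaces the Bezout identity, and
  this is where factoriality enters. The number of exceptional blocks, two against three, has a
  related reason: the constant \<open>1\<close> is proportional to no \<open>F i\<close>, whereas a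
  linear form in the kernel may be proportional to one of them, and two blocks must remain for the
  comparison. The bound \<open>l \<ge> 2\<close> enters as \<open>l \<le> 2 * (l - 1)\<close>: each
  cofactor carries at least half of the degree of its monomial, and both together carry more than a
  derivative can have.\<close>

abbreviation mmonom :: "('v \<Rightarrow>\<^sub>0 nat) \<Rightarrow> ('v, 'k::comm_ring_1) mpoly" where
  "mmonom e \<equiv> Poly_Mapping.single e 1"

text \<open>Evaluations and derivations are both built from this. For a ring map \<kappa> it is
  additive, so that only the behaviour on products has to be proved separately for the two
  uses.\<close>

definition mpoly_lin ::
    "('k \<Rightarrow> 'a) \<Rightarrow> (('v \<Rightarrow>\<^sub>0 nat) \<Rightarrow> 'a) \<Rightarrow> ('v, 'k::comm_ring_1) mpoly \<Rightarrow> 'a::comm_ring_1" where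
  "mpoly_lin \<kappa> \<phi> f = (\<Sum>e\<in>Poly_Mapping.keys f. \<kappa> (Poly_Mapping.lookup f e) * \<phi> e)"

locale ring_map =
  fixes \<kappa> :: "'k::comm_ring_1 \<Rightarrow> 'a::comm_ring_1"
  assumes map_add: "\<kappa> (x + y) = \<kappa> x + \<kappa> y"
    and map_mult: "\<kappa> (x * y) = \<kappa> x * \<kappa> y"
    and map_1 [simp]: "\<kappa> 1 = 1"
begin

lemma map_0 [simp]: "\<kappa> 0 = 0"
  using map_add[of 0 0] by simp

lemma map_sum: "\<kappa> (\<Sum>i\<in>I. f i) = (\<Sum>i\<in>I. \<kappa> (f i))"
  by (induction I rule: infinite_finite_induct) (auto simp: map_add)

lemma map_prod: "\<kappa> (\<Prod>i\<in>I. f i) = (\<Prod>i\<in>I. \<kappa> (f i))"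
  by (induction I rule: infinite_finite_induct) (auto simp: map_mult)

lemma map_power: "\<kappa> (x ^ j) = \<kappa> x ^ j"
  by (induction j) (auto simp: map_mult)

lemma map_minus: "\<kappa> (- x) = - \<kappa> x"
  using map_add[of x "- x"] by (simp add: eq_neg_iff_add_eq_0 add.commute)

lemma map_diff: "\<kappa> (x - y) = \<kappa> x - \<kappa> y"
  using map_add[of x "- y"] by (simp add: map_minus)

lemma map_of_nat: "\<kappa> (of_nat j) = of_nat j"
  by (induction j) (auto simp: map_add)

lemma mpoly_lin_superset:
  assumes "finite A" "Poly_Mapping.keys f \<subseteq> A"
  shows "mpoly_lin \<kappa> \<phi> f = (\<Sum>e\<in>A. \<kappa> (Poly_Mapping.lookup f e) * \<phi> e)"
  unfolding mpoly_lin_def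
  by (rule sum.mono_neutral_left) (use assms in \<open>auto simp: in_keys_iff\<close>)

lemma mpoly_lin_add: "mpoly_lin \<kappa> \<phi> (f + g) = mpoly_lin \<kappa> \<phi> f + mpoly_lin \<kappa> \<phi> g"
proof -
  let ?A = "Poly_Mapping.keys f \<union> Poly_Mapping.keys g"
  have "Poly_Mapping.keys (f + g) \<subseteq> ?A"
    by (rule Poly_Mapping.keys_add)
  then show ?thesis
    by (subst (1 2 3) mpoly_lin_superset[of ?A])
       (auto simp: lookup_add map_add algebra_simps sum.distrib)
qed

lemma mpoly_lin_0 [simp]: "mpoly_lin \<kappa> \<phi> 0 = 0"
  by (simp add: mpoly_lin_def)

lemma mpoly_lin_single [simp]: "mpoly_lin \<kappa> \<phi> (Poly_Mapping.single e c) = \<kappa> c * \<phi> e"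
  by (subst mpoly_lin_superset[of "{e}"]) auto

end

lemma mpoly_monom_expansion:
  fixes f :: "('v, 'k::comm_ring_1) mpoly"
  shows "f = (\<Sum>e\<in>Poly_Mapping.keys f. Poly_Mapping.single e (Poly_Mapping.lookup f e))"
  by (rule poly_mapping_eqI)
     (auto simp: lookup_sum lookup_single when_def in_keys_iff sum.delta')

lemma mpoly_induct_single [case_names zero add single]:
  fixes f :: "('v, 'k::comm_ring_1) mpoly"
  assumes "Q 0" "\<And>f g. Q f \<Longrightarrow> Q g \<Longrightarrow> Q (f + g)" "\<And>e c. Q (Poly_Mapping.single e c)"
  shows "Q f"
proof -
  have "Q (\<Sum>e\<in>A. Poly_Mapping.single e (Poly_Mapping.lookup f e))" for A
    by (induction A rule: infinite_finite_induct) (use assms in auto)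
  then show ?thesis
    by (subst mpoly_monom_expansion) auto
qed

lemma mconst_simps [simp]:
  "mconst 0 = 0" "mconst 1 = 1"
  by (auto simp: mconst_def)

lemma ring_map_mconst: "ring_map mconst"
  by unfold_locales (auto simp: mconst_def single_add mult_single)

interpretation mconst: ring_map mconst
  by (rule ring_map_mconst)

lemma single_eq_mconst_mult: "Poly_Mapping.single e c = mconst c * mmonom e"
  by (simp add: mconst_def mult_single)

lemma mmonom_add: "mmonom (e + e') = mmonom e * mmonom e'"
  by (simp add: mult_single)

lemma mvar_power: "mvar v ^ j = mmonom (Poly_Mapping.single v j)"
proof (induction j)
  case 0
  show ?case by simp
next
  case (Suc j)
  have "Poly_Mapping.single v (Suc j) = Poly_Mapping.single v 1 + Poly_Mapping.single v j"
    by (simp flip: single_add)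
  with Suc show ?case
    by (simp add: mvar_def mult_single)
qed

lemma monom_induct [case_names zero add]:
  fixes e :: "'v \<Rightarrow>\<^sub>0 nat"
  assumes "Q 0" "\<And>e v. Q e \<Longrightarrow> Q (e + Poly_Mapping.single v 1)"
  shows "Q e"
proof -
  have single: "Q (e + Poly_Mapping.single v j)" if "Q e" for e v j
  proof (induction j)
    case (Suc j)
    have "e + Poly_Mapping.single v (Suc j) = (e + Poly_Mapping.single v j) + Poly_Mapping.single v 1"
      by (simp add: add.assoc flip: single_add)
    with assms(2)[OF Suc] show ?case by simp
  qed (use that in simp)
  have "Q (\<Sum>v\<in>A. Poly_Mapping.single v (Poly_Mapping.lookup e v))" for A
  proof (induction A rule: infinite_finite_induct)
    case (insert x A)
    then show ?case
      using single[of "\<Sum>v\<in>A. Poly_Mapping.single v (Poly_Mapping.lookup e v)" x] by (simp add: add.commute)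
  qed (use assms in auto)
  moreover have "e = (\<Sum>v\<in>Poly_Mapping.keys e. Poly_Mapping.single v (Poly_Mapping.lookup e v))"
    by (rule poly_mapping_eqI)
       (auto simp: lookup_sum lookup_single when_def in_keys_iff sum.delta')
  ultimately show ?thesis by metis
qed

lemma mpoly_induct [case_names const var add mult]:
  fixes f :: "('v, 'k::comm_ring_1) mpoly"
  assumes "\<And>c. Q (mconst c)" "\<And>v. Q (mvar v)"
    "\<And>f g. Q f \<Longrightarrow> Q g \<Longrightarrow> Q (f + g)" "\<And>f g. Q f \<Longrightarrow> Q g \<Longrightarrow> Q (f * g)"
  shows "Q f"
proof (induction f rule: mpoly_induct_single)
  case zero
  show ?case using assms(1)[of 0] by simp
next
  case (single e c)
  have "Q (mmonom e)"
  proof (induction e rule: monom_induct)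
    case zero
    show ?case using assms(1)[of 1] by simp
  next
    case (add e v)
    with assms(4)[OF add assms(2)[of v]] show ?case
      by (simp add: mvar_def mult_single)
  qed
  then show ?case
    by (subst single_eq_mconst_mult) (intro assms)
qed (use assms in auto)

subsection \<open>Evaluation homomorphisms\<close>

definition monom_eval :: "('v \<Rightarrow> 'a::comm_ring_1) \<Rightarrow> ('v \<Rightarrow>\<^sub>0 nat) \<Rightarrow> 'a" where
  "monom_eval \<sigma> e = (\<Prod>v\<in>Poly_Mapping.keys e. \<sigma> v ^ Poly_Mapping.lookup e v)"

definition mpoly_eval :: "('k \<Rightarrow> 'a) \<Rightarrow> ('v \<Rightarrow> 'a) \<Rightarrow> ('v, 'k::comm_ring_1) mpoly \<Rightarrow> 'a::comm_ring_1" where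
  "mpoly_eval \<kappa> \<sigma> = mpoly_lin \<kappa> (monom_eval \<sigma>)"

lemma monom_eval_superset:
  assumes "finite A" "Poly_Mapping.keys e \<subseteq> A"
  shows "monom_eval \<sigma> e = (\<Prod>v\<in>A. \<sigma> v ^ Poly_Mapping.lookup e v)"
  unfolding monom_eval_def
  by (rule prod.mono_neutral_left) (use assms in \<open>auto simp: in_keys_iff\<close>)

lemma monom_eval_0 [simp]: "monom_eval \<sigma> 0 = 1"
  by (simp add: monom_eval_def)

lemma monom_eval_single [simp]: "monom_eval \<sigma> (Poly_Mapping.single v j) = \<sigma> v ^ j"
  by (subst monom_eval_superset[of "{v}"]) auto

lemma monom_eval_add: "monom_eval \<sigma> (e + e') = monom_eval \<sigma> e * monom_eval \<sigma> e'"
proof -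
  let ?A = "Poly_Mapping.keys e \<union> Poly_Mapping.keys e'"
  have "Poly_Mapping.keys (e + e') \<subseteq> ?A"
    by (rule Poly_Mapping.keys_add)
  then show ?thesis
    by (subst (1 2 3) monom_eval_superset[of ?A])
       (auto simp: lookup_add power_add prod.distrib)
qed

lemma (in ring_map) ring_map_mpoly_eval: "ring_map (mpoly_eval \<kappa> \<sigma>)"
proof
  fix f g
  show "mpoly_eval \<kappa> \<sigma> (f + g) = mpoly_eval \<kappa> \<sigma> f + mpoly_eval \<kappa> \<sigma> g"
    by (simp add: mpoly_eval_def mpoly_lin_add)
  show "mpoly_eval \<kappa> \<sigma> (f * g) = mpoly_eval \<kappa> \<sigma> f * mpoly_eval \<kappa> \<sigma> g"
  proof (induction f rule: mpoly_induct_single)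
    case (single e c)
    show ?case
      by (induction g rule: mpoly_induct_single)
         (auto simp: mpoly_eval_def mpoly_lin_add algebra_simps mult_single map_mult monom_eval_add)
  qed (auto simp: mpoly_eval_def mpoly_lin_add algebra_simps)
next
  have "mpoly_eval \<kappa> \<sigma> (Poly_Mapping.single 0 1) = 1"
    by (simp only: mpoly_eval_def mpoly_lin_single) simp
  then show "mpoly_eval \<kappa> \<sigma> 1 = 1" by simp
qed

lemma (in ring_map) mpoly_eval_mvar [simp]: "mpoly_eval \<kappa> \<sigma> (mvar v) = \<sigma> v"
  by (simp add: mvar_def mpoly_eval_def)

lemma (in ring_map) mpoly_eval_mconst [simp]: "mpoly_eval \<kappa> \<sigma> (mconst c) = \<kappa> c"
  by (simp add: mconst_def mpoly_eval_def)

lemma (in ring_map) mpoly_eval_mmonom [simp]: "mpoly_eval \<kappa> \<sigma> (mmonom e) = monom_eval \<sigma> e"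
  by (simp add: mpoly_eval_def)

subsection \<open>Derivations of the polynomial ring\<close>

text \<open>The truncated subtraction \<open>e - single v 1\<close> is harmless because of the factor \<open>e\<^sub>v\<close>.\<close>

definition monom_der :: "('v \<Rightarrow> ('v, 'k) mpoly) \<Rightarrow> ('v \<Rightarrow>\<^sub>0 nat) \<Rightarrow> ('v, 'k::comm_ring_1) mpoly" where
  "monom_der h e = (\<Sum>v\<in>Poly_Mapping.keys e.
     of_nat (Poly_Mapping.lookup e v) * mmonom (e - Poly_Mapping.single v 1) * h v)"

definition mpoly_der :: "('v \<Rightarrow> ('v, 'k) mpoly) \<Rightarrow> ('v, 'k::comm_ring_1) mpoly \<Rightarrow> ('v, 'k) mpoly" where
  "mpoly_der h = mpoly_lin mconst (monom_der h)"

lemma monom_der_superset: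
  assumes "finite A" "Poly_Mapping.keys e \<subseteq> A"
  shows "monom_der h e = (\<Sum>v\<in>A.
     of_nat (Poly_Mapping.lookup e v) * mmonom (e - Poly_Mapping.single v 1) * h v)"
  unfolding monom_der_def
  by (rule sum.mono_neutral_left) (use assms in \<open>auto simp: in_keys_iff\<close>)

lemma monom_der_0 [simp]: "monom_der h 0 = 0"
  by (simp add: monom_der_def)

lemma monom_der_single [simp]: "monom_der h (Poly_Mapping.single v (Suc 0)) = h v"
  by (subst monom_der_superset[of "{v}"]) auto

lemma monom_minus_single_add:
  fixes e e' :: "'v \<Rightarrow>\<^sub>0 nat"
  assumes "Poly_Mapping.lookup e v \<noteq> 0"
  shows "e + e' - Poly_Mapping.single v 1 = (e - Poly_Mapping.single v 1) + e'"
  by (rule poly_mapping_eqI) (use assms in \<open>auto simp: lookup_add lookup_minus lookup_single when_def\<close>)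

lemma monom_der_add: "monom_der h (e + e') = monom_der h e * mmonom e' + mmonom e * monom_der h e'"
proof -
  let ?A = "Poly_Mapping.keys e \<union> Poly_Mapping.keys e'"
  have A: "Poly_Mapping.keys (e + e') \<subseteq> ?A"
    by (rule Poly_Mapping.keys_add)
  have *: "of_nat (Poly_Mapping.lookup e v) * mmonom (e + e' - Poly_Mapping.single v 1) * h v =
      (of_nat (Poly_Mapping.lookup e v) * mmonom (e - Poly_Mapping.single v 1) * h v) * mmonom e'"
    for e e' v
  proof (cases "Poly_Mapping.lookup e v = 0")
    case False
    then show ?thesis
      by (simp add: monom_minus_single_add mmonom_add mult_ac del: One_nat_def)
  qed auto
  have "monom_der h (e + e') =
     (\<Sum>v\<in>?A. (of_nat (Poly_Mapping.lookup e v) * mmonom (e - Poly_Mapping.single v 1) * h v) * mmonom e'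
        + mmonom e * (of_nat (Poly_Mapping.lookup e' v) * mmonom (e' - Poly_Mapping.single v 1) * h v))"
    unfolding monom_der_superset[OF _ A, simplified]
    using *[of e _ e'] *[of e' _ e]
    by (intro sum.cong refl) (simp add: lookup_add algebra_simps)
  also have "\<dots> = monom_der h e * mmonom e' + mmonom e * monom_der h e'"
    by (subst (1 2) monom_der_superset[of ?A])
       (auto simp: sum.distrib sum_distrib_left sum_distrib_right)
  finally show ?thesis .
qed

locale derivation =
  fixes d :: "('v, 'k::comm_ring_1) mpoly \<Rightarrow> ('v, 'k) mpoly"
  assumes d_add: "d (f + g) = d f + d g"
    and d_mult: "d (f * g) = d f * g + f * d g"
    and d_mconst [simp]: "d (mconst c) = 0"
begin

lemma d_0 [simp]: "d 0 = 0"
  using d_mconst[of 0] by (simp del: d_mconst)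

lemma d_1 [simp]: "d 1 = 0"
  using d_mconst[of 1] by (simp del: d_mconst)

lemma d_uminus: "d (- f) = - d f"
  using d_add[of f "- f"] by (simp add: eq_neg_iff_add_eq_0 add.commute)

lemma d_diff: "d (f - g) = d f - d g"
  using d_add[of f "- g"] by (simp add: d_uminus)

lemma d_sum: "d (\<Sum>i\<in>I. f i) = (\<Sum>i\<in>I. d (f i))"
  by (induction I rule: infinite_finite_induct) (auto simp: d_add)

lemma d_mconst_mult: "d (mconst c * f) = mconst c * d f"
  by (simp add: d_mult)

lemma d_of_nat [simp]: "d (of_nat j) = 0"
  by (induction j) (auto simp: d_add)

lemma d_of_nat_mult: "d (of_nat j * f) = of_nat j * d f"
  by (simp add: d_mult)

lemma d_power: "d (f ^ j) = of_nat j * f ^ (j - 1) * d f"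
proof (induction j)
  case (Suc j)
  show ?case
  proof (cases j)
    case (Suc i)
    with Suc.IH show ?thesis by (simp add: d_mult algebra_simps)
  qed (simp add: d_mult)
qed simp

lemma funpow_add: "(d ^^ j) (f + g) = (d ^^ j) f + (d ^^ j) g"
  by (induction j) (auto simp: d_add)

lemma funpow_0 [simp]: "(d ^^ j) 0 = 0"
  by (induction j) auto

lemma leibniz: "(d ^^ j) (f * g) = (\<Sum>i\<le>j. of_nat (j choose i) * (d ^^ i) f * (d ^^ (j - i)) g)"
proof (induction j)
  case (Suc j)
  have "(d ^^ Suc j) (f * g) = (\<Sum>i\<le>j. of_nat (j choose i) * (d ^^ Suc i) f * (d ^^ (j - i)) g) +
      (\<Sum>i\<le>j. of_nat (j choose i) * (d ^^ i) f * (d ^^ (Suc j - i)) g)"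
    by (simp add: Suc d_sum d_mult mult.assoc d_of_nat_mult algebra_simps sum.distrib Suc_diff_le)
  \<comment> \<open>The added term has the coefficient \<open>j choose Suc j = 0\<close>; with it
    the two sums can be aligned for Pascal's rule.\<close>
  also have "(\<Sum>i\<le>j. of_nat (j choose i) * (d ^^ i) f * (d ^^ (Suc j - i)) g) =
      (\<Sum>i\<le>Suc j. of_nat (j choose i) * (d ^^ i) f * (d ^^ (Suc j - i)) g)"
    by (simp add: binomial_eq_0)
  also have "\<dots> = f * (d ^^ Suc j) g +
      (\<Sum>i\<le>j. of_nat (j choose Suc i) * (d ^^ Suc i) f * (d ^^ (j - i)) g)"
    by (subst sum.atMost_Suc_shift) simp
  also have "(\<Sum>i\<le>j. of_nat (j choose i) * (d ^^ Suc i) f * (d ^^ (j - i)) g) + \<dots> =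
     f * (d ^^ Suc j) g + (\<Sum>i\<le>j. of_nat (Suc j choose Suc i) * (d ^^ Suc i) f * (d ^^ (j - i)) g)"
    by (simp add: algebra_simps sum.distrib del: sum.atMost_Suc)
  also have "\<dots> = (\<Sum>i\<le>Suc j. of_nat (Suc j choose i) * (d ^^ i) f * (d ^^ (Suc j - i)) g)"
    by (subst sum.atMost_Suc_shift) simp
  finally show ?case .
qed simp

end

lemma derivation_mpoly_der:
  fixes h :: "'v \<Rightarrow> ('v, 'k::comm_ring_1) mpoly"
  shows "derivation (mpoly_der h)"
proof
  fix f g :: "('v, 'k) mpoly" and c
  show "mpoly_der h (f + g) = mpoly_der h f + mpoly_der h g"
    by (simp add: mpoly_der_def mconst.mpoly_lin_add)
  show "mpoly_der h (f * g) = mpoly_der h f * g + f * mpoly_der h g"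
  proof (induction f rule: mpoly_induct_single)
    case (single e c)
    show ?case
    proof (induction g rule: mpoly_induct_single)
      case (single e' c')
      show ?case
        by (simp add: mpoly_der_def mult_single mconst.map_mult monom_der_add)
           (simp add: single_eq_mconst_mult[of e c] single_eq_mconst_mult[of e' c'] algebra_simps)
    qed (auto simp: mpoly_der_def mconst.mpoly_lin_add algebra_simps)
  qed (auto simp: mpoly_der_def mconst.mpoly_lin_add algebra_simps)
  have "mpoly_der h (Poly_Mapping.single 0 c) = 0"
    by (simp only: mpoly_der_def mconst.mpoly_lin_single) simp
  then show "mpoly_der h (mconst c) = 0"
    by (simp add: mconst_def)
qed

lemma mpoly_der_mvar [simp]: "mpoly_der h (mvar v) = h v"
  unfolding mvar_def mpoly_der_def by simp

subsection \<open>Calculating modulo an ideal\<close>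

locale ring_ideal =
  fixes J :: "'a::comm_ring_1 set"
  assumes zero_mem [simp]: "0 \<in> J"
    and add_mem: "a \<in> J \<Longrightarrow> b \<in> J \<Longrightarrow> a + b \<in> J"
    and mult_mem: "a \<in> J \<Longrightarrow> c * a \<in> J"
begin

lemma mult_mem': "a \<in> J \<Longrightarrow> a * c \<in> J"
  using mult_mem[of a c] by (simp add: mult.commute)

lemma uminus_mem: "a \<in> J \<Longrightarrow> - a \<in> J"
  using mult_mem[of a "-1"] by simp

lemma diff_mem: "a \<in> J \<Longrightarrow> b \<in> J \<Longrightarrow> a - b \<in> J"
  using add_mem[of a "- b"] uminus_mem[of b] by simp

lemma sum_mem: "(\<And>i. i \<in> I \<Longrightarrow> f i \<in> J) \<Longrightarrow> sum f I \<in> J"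
  by (induction I rule: infinite_finite_induct) (auto intro: add_mem)

definition eqm :: "'a \<Rightarrow> 'a \<Rightarrow> bool" (infix "\<approx>" 50) where
  "a \<approx> b \<longleftrightarrow> a - b \<in> J"

lemma eqm_refl [simp]: "a \<approx> a"
  by (simp add: eqm_def)

lemma eqm_sym: "a \<approx> b \<Longrightarrow> b \<approx> a"
  using uminus_mem[of "a - b"] by (simp add: eqm_def)

lemma eqm_trans [trans]: "a \<approx> b \<Longrightarrow> b \<approx> c \<Longrightarrow> a \<approx> c"
  using add_mem[of "a - b" "b - c"] by (simp add: eqm_def)

lemma eqm_0_iff: "a \<approx> 0 \<longleftrightarrow> a \<in> J"
  by (simp add: eqm_def)

lemma eqm_add: "a \<approx> b \<Longrightarrow> a' \<approx> b' \<Longrightarrow> a + a' \<approx> b + b'"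
  using add_mem[of "a - b" "a' - b'"] by (simp add: eqm_def algebra_simps)

lemma eqm_diff: "a \<approx> b \<Longrightarrow> a' \<approx> b' \<Longrightarrow> a - a' \<approx> b - b'"
  using diff_mem[of "a - b" "a' - b'"] by (simp add: eqm_def algebra_simps)

lemma eqm_mult: "a \<approx> b \<Longrightarrow> a' \<approx> b' \<Longrightarrow> a * a' \<approx> b * b'"
  using add_mem[OF mult_mem[of "a - b" a'] mult_mem[of "a' - b'" b]]
  by (simp add: eqm_def algebra_simps)

lemma eqm_power: "a \<approx> b \<Longrightarrow> a ^ j \<approx> b ^ j"
  by (induction j) (auto intro: eqm_mult)

lemma eqm_sum: "(\<And>i. i \<in> I \<Longrightarrow> f i \<approx> g i) \<Longrightarrow> sum f I \<approx> sum g I"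
  by (induction I rule: infinite_finite_induct) (auto intro: eqm_add)

lemma eqm_prod: "(\<And>i. i \<in> I \<Longrightarrow> f i \<approx> g i) \<Longrightarrow> prod f I \<approx> prod g I"
  by (induction I rule: infinite_finite_induct) (auto intro: eqm_mult)

lemma eqm_mem_iff: "a \<approx> b \<Longrightarrow> a \<in> J \<longleftrightarrow> b \<in> J"
  using eqm_trans[of a b 0] eqm_trans[of b a 0] eqm_sym[of a b] by (auto simp: eqm_0_iff)

definition dvdm :: "'a \<Rightarrow> 'a \<Rightarrow> bool" where
  "dvdm a b \<longleftrightarrow> (\<exists>c. b \<approx> a * c)"

lemma dvdmI: "b \<approx> a * c \<Longrightarrow> dvdm a b"
  by (auto simp: dvdm_def)

lemma dvdm_mult: "dvdm a b \<Longrightarrow> dvdm a (b * c)"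
  unfolding dvdm_def using eqm_mult[OF _ eqm_refl, of b _ c] by (metis mult.assoc)

lemma dvdm_eqm: "dvdm a b \<Longrightarrow> b \<approx> b' \<Longrightarrow> dvdm a b'"
  unfolding dvdm_def by (meson eqm_sym eqm_trans)

text \<open>Primality of the class of \<open>p\<close> in the quotient: \<open>p \<notin> J\<close>
  says that the class is nonzero, \<open>\<not> dvdm p 1\<close> that it is not a unit.\<close>

definition primem :: "'a \<Rightarrow> bool" where
  "primem p \<longleftrightarrow> p \<notin> J \<and> \<not> dvdm p 1 \<and> (\<forall>a b. dvdm p (a * b) \<longrightarrow> dvdm p a \<or> dvdm p b)"

end

locale prime_ring_ideal = ring_ideal +
  assumes one_notin: "1 \<notin> J"
    and prime_mem: "a * b \<in> J \<Longrightarrow> a \<in> J \<or> b \<in> J"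
begin

lemma mult_mem_iff: "a * b \<in> J \<longleftrightarrow> a \<in> J \<or> b \<in> J"
  using prime_mem mult_mem mult_mem' by blast

lemma power_notin: "a \<notin> J \<Longrightarrow> a ^ j \<notin> J"
  by (induction j) (auto simp: mult_mem_iff one_notin)

lemma prod_notin: "(\<And>i. i \<in> I \<Longrightarrow> f i \<notin> J) \<Longrightarrow> prod f I \<notin> J"
  by (induction I rule: infinite_finite_induct) (auto simp: mult_mem_iff one_notin)

lemma eqm_cancel: "a \<notin> J \<Longrightarrow> a * b \<approx> a * c \<Longrightarrow> b \<approx> c"
  using prime_mem[of a "b - c"] by (simp add: eqm_def algebra_simps)

text \<open>A prime \<open>x i\<close> that divides \<open>c * b\<close> but not \<open>c\<close>
  divides \<open>b\<close>. It is split off and cancelled, which is possible because a prime lies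
  outside \<open>J\<close>; the inner induction exhausts one exponent, the outer one the index
  set.\<close>

lemma prime_factors_coprime:
  assumes "finite I" "\<And>i. i \<in> I \<Longrightarrow> primem (x i)" "\<And>i. i \<in> I \<Longrightarrow> \<not> dvdm (x i) c"
    and "(\<Prod>i\<in>I. x i ^ e i) * a \<approx> c * b"
  shows "\<exists>b'. b \<approx> (\<Prod>i\<in>I. x i ^ e i) * b'"
  using assms
proof (induction I arbitrary: a b rule: finite_induct)
  case empty
  show ?case by (intro exI[of _ b]) simp
next
  case (insert i I)
  have prime: "primem (x i)" and ndvd: "\<not> dvdm (x i) c"
    using insert.prems by auto
  have "\<exists>b'. b \<approx> x i ^ j * b'" if "x i ^ j * a' \<approx> c * b" for j a' b
    using that
  proof (induction j arbitrary: a' b)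
    case 0
    show ?case by (intro exI[of _ b]) simp
  next
    case (Suc j)
    then have "dvdm (x i) (c * b)"
      using eqm_sym[OF Suc.prems] by (intro dvdmI[of _ _ "x i ^ j * a'"]) (simp add: mult_ac)
    then obtain b1 where b1: "b \<approx> x i * b1"
      using prime ndvd unfolding primem_def dvdm_def by blast
    have "x i * (x i ^ j * a') \<approx> c * b"
      using Suc.prems by (simp add: mult_ac)
    also have "c * b \<approx> x i * (c * b1)"
      using eqm_mult[OF eqm_refl b1, of c] by (simp add: mult_ac)
    finally have "x i ^ j * a' \<approx> c * b1"
      using prime by (auto simp: primem_def intro: eqm_cancel)
    then obtain b' where "b1 \<approx> x i ^ j * b'"
      using Suc.IH by blast
    then have "b \<approx> x i ^ Suc j * b'"
      using eqm_trans[OF b1 eqm_mult[OF eqm_refl, of b1 _ "x i"]] by (simp only: power_Suc mult.assoc)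
    then show ?case by blast
  qed
  moreover have "x i ^ e i * ((\<Prod>i\<in>I. x i ^ e i) * a) \<approx> c * b"
    using insert by (simp add: mult_ac)
  ultimately obtain b1 where b1: "b \<approx> x i ^ e i * b1"
    by blast
  have "x i ^ e i * ((\<Prod>i\<in>I. x i ^ e i) * a) \<approx> x i ^ e i * (c * b1)"
    using insert eqm_trans[OF _ eqm_mult[OF eqm_refl b1, of c]] by (simp add: mult_ac)
  then have "(\<Prod>i\<in>I. x i ^ e i) * a \<approx> c * b1"
    using prime eqm_cancel[OF power_notin] unfolding primem_def by blast
  then obtain b' where "b1 \<approx> (\<Prod>i\<in>I. x i ^ e i) * b'"
    using insert.IH insert.prems by blast
  then have "b \<approx> (\<Prod>i\<in>insert i I. x i ^ e i) * b'"
    using insert.hyps eqm_trans[OF b1 eqm_mult[OF eqm_refl, of b1 _ "x i ^ e i"]] by (simp add: mult.assoc)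
  then show ?case by blast
qed

end

subsection \<open>Locally nilpotent derivations modulo a prime ideal\<close>

text \<open>Every summand of the product rule lowers a single exponent, and only by one.\<close>

lemma (in derivation) prod_dvd_d_prod:
  assumes "\<And>i. i \<in> I \<Longrightarrow> l i > 0"
  shows "(\<Prod>i\<in>I. x i ^ (l i - 1)) dvd d (\<Prod>i\<in>I. x i ^ l i)"
  using assms
proof (induction I rule: infinite_finite_induct)
  case (insert i I)
  have dvd: "a ^ (j - 1) dvd a ^ j" for a :: "('v, 'k::comm_ring_1) mpoly" and j
    by (simp add: le_imp_power_dvd)
  have "(\<Prod>i\<in>I. x i ^ (l i - 1)) dvd (\<Prod>i\<in>I. x i ^ l i)"
    by (intro prod_dvd_prod dvd)
  then have "x i ^ (l i - 1) * (\<Prod>i\<in>I. x i ^ (l i - 1)) dvd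
      x i ^ (l i - 1) * (\<Prod>i\<in>I. x i ^ l i) * (of_nat (l i) * d (x i)) + x i ^ l i * d (\<Prod>i\<in>I. x i ^ l i)"
    using insert by (intro dvd_add dvd_mult2 mult_dvd_mono dvd_refl dvd) auto
  also have "\<dots> = d (\<Prod>i\<in>insert i I. x i ^ l i)"
    using insert.hyps by (simp add: d_mult d_power mult_ac)
  finally show ?case
    using insert.hyps by simp
qed auto

locale derivation_mod_ideal = derivation d + ring_ideal J
  for d :: "('v, 'k::comm_ring_1) mpoly \<Rightarrow> ('v, 'k) mpoly" and J :: "('v, 'k) mpoly set" +
  assumes d_mem: "f \<in> J \<Longrightarrow> d f \<in> J"
begin

lemma d_eqm: "f \<approx> g \<Longrightarrow> d f \<approx> d g"
  using d_mem[of "f - g"] by (simp add: eqm_def d_diff)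

lemma funpow_mem: "f \<in> J \<Longrightarrow> (d ^^ j) f \<in> J"
  by (induction j) (auto intro: d_mem)

lemma funpow_eqm: "f \<approx> g \<Longrightarrow> (d ^^ j) f \<approx> (d ^^ j) g"
  by (induction j) (auto intro: d_eqm)

lemma funpow_mem_le: "(d ^^ i) f \<in> J \<Longrightarrow> i \<le> j \<Longrightarrow> (d ^^ j) f \<in> J"
  using funpow_mem[of "(d ^^ i) f" "j - i"] by (metis Nat.funpow_add comp_apply le_add_diff_inverse2)

lemma nilpotent_add:
  assumes "\<exists>j. (d ^^ j) f \<in> J" "\<exists>j. (d ^^ j) g \<in> J"
  shows "\<exists>j. (d ^^ j) (f + g) \<in> J"
proof -
  obtain a b where ab: "(d ^^ a) f \<in> J" "(d ^^ b) g \<in> J"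
    using assms by blast
  then have "(d ^^ max a b) f \<in> J" "(d ^^ max a b) g \<in> J"
    by (auto intro: funpow_mem_le)
  then show ?thesis
    unfolding funpow_add by (blast intro: add_mem)
qed

text \<open>If \<open>a\<close> and \<open>b\<close> iterations kill the two factors, every term of
  the Leibniz sum of order \<open>a + b\<close> contains a factor that is already dead.\<close>

lemma nilpotent_mult:
  assumes "\<exists>j. (d ^^ j) f \<in> J" "\<exists>j. (d ^^ j) g \<in> J"
  shows "\<exists>j. (d ^^ j) (f * g) \<in> J"
proof -
  obtain a b where ab: "(d ^^ a) f \<in> J" "(d ^^ b) g \<in> J"
    using assms by blast
  have "(d ^^ (a + b)) (f * g) \<in> J"
    unfolding leibniz
  proof (rule sum_mem)
    fix i
    have "(d ^^ i) f \<in> J \<or> (d ^^ (a + b - i)) g \<in> J"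
      using funpow_mem_le[OF ab(1), of i] funpow_mem_le[OF ab(2), of "a + b - i"] by linarith
    then have "(d ^^ i) f * (d ^^ (a + b - i)) g \<in> J"
      by (auto intro: mult_mem mult_mem')
    then show "of_nat ((a + b) choose i) * (d ^^ i) f * (d ^^ (a + b - i)) g \<in> J"
      unfolding mult.assoc by (rule mult_mem)
  qed
  then show ?thesis by blast
qed

lemma nilpotent_mconst: "\<exists>j. (d ^^ j) (mconst c) \<in> J"
  by (rule exI[of _ 1]) simp

lemma nilpotent_prod:
  "(\<And>i. i \<in> I \<Longrightarrow> \<exists>j. (d ^^ j) (f i) \<in> J) \<Longrightarrow> \<exists>j. (d ^^ j) (prod f I) \<in> J"
  by (induction I rule: infinite_finite_induct)
     (use nilpotent_mconst[of 1] nilpotent_mult in auto)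

lemma nilpotent_power: "\<exists>j. (d ^^ j) f \<in> J \<Longrightarrow> \<exists>j. (d ^^ j) (f ^ k) \<in> J"
  using nilpotent_prod[of "{..<k}" "\<lambda>_. f"] by simp

lemma nilpotent_if_nilpotent_mvar:
  assumes "\<And>v. \<exists>j. (d ^^ j) (mvar v) \<in> J"
  shows "\<exists>j. (d ^^ j) f \<in> J"
  by (induction f rule: mpoly_induct)
     (use assms nilpotent_mconst nilpotent_add nilpotent_mult in auto)

end

section \<open>The degree function of a locally nilpotent derivation\<close>

locale lnd_mod_ideal = derivation_mod_ideal d J
  for d :: "('v, 'k::field_char_0) mpoly \<Rightarrow> ('v, 'k) mpoly" and J +
  assumes nilpotent: "\<exists>j. (d ^^ j) f \<in> J"
begin

text \<open>The degree of \<open>f\<close> along the orbits of the associated additive group action; it has no meaning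
  for \<open>f \<in> J\<close>.\<close>

definition ddeg :: "('v, 'k) mpoly \<Rightarrow> nat" where
  "ddeg f = (LEAST j. (d ^^ Suc j) f \<in> J)"

lemma funpow_mem_iff:
  assumes "f \<notin> J"
  shows "(d ^^ j) f \<in> J \<longleftrightarrow> ddeg f < j"
proof -
  obtain i where i: "(d ^^ i) f \<in> J"
    using nilpotent by blast
  with assms obtain i' where "i = Suc i'"
    by (cases i) auto
  with i have "(d ^^ Suc i') f \<in> J" by simp
  then have *: "(d ^^ Suc (ddeg f)) f \<in> J"
    unfolding ddeg_def by (rule LeastI)
  show ?thesis
  proof
    assume j: "(d ^^ j) f \<in> J"
    with assms obtain j' where "j = Suc j'"
      by (cases j) auto
    with j have "(d ^^ Suc j') f \<in> J" by simp
    then have "ddeg f \<le> j'"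
      unfolding ddeg_def by (rule Least_le)
    then show "ddeg f < j"
      using \<open>j = Suc j'\<close> by simp
  next
    assume "ddeg f < j"
    then show "(d ^^ j) f \<in> J"
      using funpow_mem_le[OF *] by simp
  qed
qed

lemma ddeg_eqI:
  assumes "f \<notin> J" "(d ^^ j) f \<notin> J" "(d ^^ Suc j) f \<in> J"
  shows "ddeg f = j"
  using assms funpow_mem_iff[of f j] funpow_mem_iff[of f "Suc j"] by simp

lemma ddeg_eq_0_iff: "f \<notin> J \<Longrightarrow> ddeg f = 0 \<longleftrightarrow> d f \<in> J"
  using funpow_mem_iff[of f 1] by simp

lemma ddeg_d:
  assumes "d f \<notin> J"
  shows "ddeg f = Suc (ddeg (d f))"
proof -
  have f: "f \<notin> J"
    using assms d_mem by blast
  have "(d ^^ Suc j) f = (d ^^ j) (d f)" for j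
    by (simp add: funpow_swap1)
  then have *: "ddeg f < Suc j \<longleftrightarrow> ddeg (d f) < j" for j
    using funpow_mem_iff[OF assms, of j] funpow_mem_iff[OF f, of "Suc j"] by simp
  then show ?thesis
    using *[of "ddeg (d f)"] *[of "Suc (ddeg (d f))"] by linarith
qed

lemma ddeg_eqm:
  assumes "f \<approx> g"
  shows "ddeg f = ddeg g"
  unfolding ddeg_def by (simp only: eqm_mem_iff[OF funpow_eqm[OF assms]])

end

locale lnd_mod_prime = lnd_mod_ideal d J + prime_ring_ideal J
  for d :: "('v, 'k::field_char_0) mpoly \<Rightarrow> ('v, 'k) mpoly" and J
begin

lemma mconst_notin: "c \<noteq> 0 \<Longrightarrow> mconst c \<notin> J"
proof
  assume "c \<noteq> 0" "mconst c \<in> J"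
  then have "mconst (inverse c) * mconst c \<in> J"
    by (intro mult_mem)
  with \<open>c \<noteq> 0\<close> show False
    using one_notin by (simp flip: mconst.map_mult)
qed

lemma of_nat_notin: "j > 0 \<Longrightarrow> of_nat j \<notin> J"
  using mconst_notin[of "of_nat j"] by (simp add: mconst.map_of_nat)

text \<open>The Leibniz sum of order \<open>ddeg f + ddeg g\<close> is congruent to its term at
  \<open>i = ddeg f\<close>. This term survives because \<open>J\<close> is prime and the binomial
  coefficient is invertible in characteristic zero.\<close>

lemma ddeg_mult:
  assumes f: "f \<notin> J" and g: "g \<notin> J"
  shows "ddeg (f * g) = ddeg f + ddeg g"
proof (rule ddeg_eqI)
  let ?a = "ddeg f" and ?b = "ddeg g"
  show "f * g \<notin> J"
    using f g prime_mem by blast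
  have *: "(d ^^ i) f * (d ^^ j) g \<in> J" if "i > ?a \<or> j > ?b" for i j
    using that f g funpow_mem_iff mult_mem_iff by auto
  define t where "t i = of_nat ((?a + ?b) choose i) * ((d ^^ i) f * (d ^^ (?a + ?b - i)) g)" for i
  have "(\<Sum>i\<in>{..?a + ?b} - {?a}. t i) \<in> J"
  proof (rule sum_mem)
    fix i assume "i \<in> {..?a + ?b} - {?a}"
    then have "i > ?a \<or> ?a + ?b - i > ?b" by auto
    then show "t i \<in> J"
      unfolding t_def by (intro mult_mem *)
  qed
  moreover have "(d ^^ (?a + ?b)) (f * g) = t ?a + (\<Sum>i\<in>{..?a + ?b} - {?a}. t i)"
    unfolding leibniz t_def mult.assoc by (rule sum.remove) auto
  ultimately have "(d ^^ (?a + ?b)) (f * g) \<approx> t ?a"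
    by (simp only: eqm_def add_diff_cancel_left')
  moreover have "t ?a \<notin> J"
    using f g funpow_mem_iff of_nat_notin[of "(?a + ?b) choose ?a"] by (simp add: t_def mult_mem_iff)
  ultimately show "(d ^^ (?a + ?b)) (f * g) \<notin> J"
    using eqm_mem_iff by blast
  show "(d ^^ Suc (?a + ?b)) (f * g) \<in> J"
    unfolding leibniz
  proof (rule sum_mem)
    fix i assume "i \<in> {..Suc (?a + ?b)}"
    then have "i > ?a \<or> Suc (?a + ?b) - i > ?b" by auto
    then show "of_nat (Suc (?a + ?b) choose i) * (d ^^ i) f * (d ^^ (Suc (?a + ?b) - i)) g \<in> J"
      unfolding mult.assoc by (intro mult_mem *)
  qed
qed

lemma ddeg_1 [simp]: "ddeg 1 = 0"
  using ddeg_eq_0_iff[OF one_notin] by simp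

lemma ddeg_power: "f \<notin> J \<Longrightarrow> ddeg (f ^ j) = j * ddeg f"
  by (induction j) (auto simp: ddeg_mult power_notin)

lemma ddeg_prod: "(\<And>i. i \<in> I \<Longrightarrow> f i \<notin> J) \<Longrightarrow> ddeg (prod f I) = (\<Sum>i\<in>I. ddeg (f i))"
  by (induction I rule: infinite_finite_induct) (auto simp: ddeg_mult prod_notin)

text \<open>The kernel consists of the elements of degree zero, and degrees add up on
  products.\<close>

lemma kernel_factorially_closed:
  assumes "f * g \<notin> J" "d (f * g) \<in> J"
  shows "d f \<in> J"
proof -
  have "f \<notin> J" "g \<notin> J"
    using assms mult_mem mult_mem' by blast+
  then show ?thesis
    using assms ddeg_mult[of f g] ddeg_eq_0_iff[of "f * g"] ddeg_eq_0_iff[of f] by simp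
qed

lemma kernel_prod_powers:
  assumes "finite I" "(\<Prod>i\<in>I. x i ^ l i) \<notin> J" "d (\<Prod>i\<in>I. x i ^ l i) \<in> J" "i \<in> I" "l i > 0"
  shows "d (x i) \<in> J"
proof -
  have "(\<Prod>i\<in>I. x i ^ l i) = x i * (x i ^ (l i - 1) * (\<Prod>i\<in>I - {i}. x i ^ l i))"
    using assms(1,4,5) by (simp add: prod.remove[of I i] power_eq_if mult.assoc)
  with assms(2,3) show ?thesis
    by (intro kernel_factorially_closed[of "x i" "x i ^ (l i - 1) * (\<Prod>i\<in>I - {i}. x i ^ l i)"]) simp_all
qed

text \<open>The Mason--Stothers argument: \<open>F\<close> and \<open>G\<close> have the same derivative up to a constant, which is
  divisible by both cofactors; if these are coprime, their degrees add up to at least \<open>ddeg F\<close>.\<close>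

lemma coprime_powers_in_kernel:
  fixes x y :: "nat \<Rightarrow> ('v, 'k) mpoly" and l l' :: "nat \<Rightarrow> nat" and I I' :: "nat set"
  defines "F \<equiv> (\<Prod>i\<in>I. x i ^ l i)" and "G \<equiv> (\<Prod>i\<in>I'. y i ^ l' i)"
    and "P \<equiv> (\<Prod>i\<in>I. x i ^ (l i - 1))" and "Q \<equiv> (\<Prod>i\<in>I'. y i ^ (l' i - 1))"
  assumes fin: "finite I" "finite I'"
    and l: "\<And>i. i \<in> I \<Longrightarrow> l i \<ge> 2" "\<And>i. i \<in> I' \<Longrightarrow> l' i \<ge> 2"
    and F: "F \<notin> J" and G: "G \<notin> J"
    and eq: "d F \<approx> mconst \<beta> * d G" and \<beta>: "\<beta> \<noteq> 0"
    and coprime: "\<And>a b. P * a \<approx> Q * b \<Longrightarrow> \<exists>c. a \<approx> Q * c"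
  shows "d F \<in> J"
proof (rule ccontr)
  assume nz: "d F \<notin> J"
  have x: "x i \<notin> J" if "i \<in> I" for i
  proof
    assume "x i \<in> J"
    then have "x i ^ l i \<in> J"
      using l(1)[OF that] mult_mem'[of "x i" "x i ^ (l i - 1)"] by (simp add: power_eq_if split: if_splits)
    then have "F \<in> J"
      unfolding F_def using fin that by (subst prod.remove[of _ i]) (auto intro: mult_mem')
    with F show False by simp
  qed
  have y: "y i \<notin> J" if "i \<in> I'" for i
  proof
    assume "y i \<in> J"
    then have "y i ^ l' i \<in> J"
      using l(2)[OF that] mult_mem'[of "y i" "y i ^ (l' i - 1)"] by (simp add: power_eq_if split: if_splits)
    then have "G \<in> J"
      unfolding G_def using fin that by (subst prod.remove[of _ i]) (auto intro: mult_mem')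
    with G show False by simp
  qed
  have "P dvd d F"
    unfolding P_def F_def by (rule prod_dvd_d_prod) (use l in fastforce)
  then obtain R where R: "d F = P * R" by (auto simp: dvd_def)
  have "Q dvd d G"
    unfolding Q_def G_def by (rule prod_dvd_d_prod) (use l in fastforce)
  then obtain S where S: "d G = Q * S" by (auto simp: dvd_def)
  have "P * R \<approx> Q * (mconst \<beta> * S)"
    using eq unfolding R S by (simp add: mult_ac)
  \<comment> \<open>Coprimality moves all of \<open>Q\<close> into the cofactor of \<open>P\<close>,
    so that \<open>d F\<close> is divisible by \<open>P * Q\<close>.\<close>
  then obtain V where "R \<approx> Q * V"
    using coprime by blast
  then have dF: "d F \<approx> P * (Q * V)"
    unfolding R by (rule eqm_mult[OF eqm_refl])
  then have PQV: "P * (Q * V) \<notin> J"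
    using nz eqm_mem_iff by blast
  then have nz': "P \<notin> J" "Q \<notin> J" "V \<notin> J"
    by (auto simp: mult_mem_iff)
  have "ddeg (d F) = ddeg P + ddeg Q + ddeg V"
    using ddeg_eqm[OF dF] nz' by (simp add: ddeg_mult mult_mem_iff)
  moreover have "2 * ddeg P \<ge> ddeg F"
  proof -
    have "ddeg F = (\<Sum>i\<in>I. l i * ddeg (x i))"
      unfolding F_def using x by (subst ddeg_prod) (auto simp: ddeg_power power_notin)
    also have "\<dots> \<le> (\<Sum>i\<in>I. 2 * ((l i - 1) * ddeg (x i)))"
      using l(1) by (intro sum_mono) (fastforce simp: mult.assoc[symmetric])
    also have "\<dots> = 2 * ddeg P"
      unfolding P_def using x by (subst ddeg_prod) (auto simp: ddeg_power power_notin sum_distrib_left)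
    finally show ?thesis .
  qed
  moreover have "2 * ddeg Q \<ge> ddeg G"
  proof -
    have "ddeg G = (\<Sum>i\<in>I'. l' i * ddeg (y i))"
      unfolding G_def using y by (subst ddeg_prod) (auto simp: ddeg_power power_notin)
    also have "\<dots> \<le> (\<Sum>i\<in>I'. 2 * ((l' i - 1) * ddeg (y i)))"
      using l(2) by (intro sum_mono) (fastforce simp: mult.assoc[symmetric])
    also have "\<dots> = 2 * ddeg Q"
      unfolding Q_def using y by (subst ddeg_prod) (auto simp: ddeg_power power_notin sum_distrib_left)
    finally show ?thesis .
  qed
  moreover have "ddeg G = ddeg F"
  proof -
    have "d G \<notin> J"
      using nz eqm_mem_iff[OF eq] mult_mem by blast
    moreover have "ddeg (d F) = ddeg (d G)"
      using ddeg_eqm[OF eq] \<open>d G \<notin> J\<close> \<beta> ddeg_eq_0_iff[OF mconst_notin[OF \<beta>]]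
      by (simp add: ddeg_mult mconst_notin)
    ultimately show ?thesis
      using nz by (simp add: ddeg_d)
  qed
  \<comment> \<open>The contradiction: \<open>ddeg F - 1 = ddeg (d F) \<ge> ddeg P + ddeg Q \<ge>
    (ddeg F + ddeg G) / 2 = ddeg F\<close>.\<close>
  ultimately show False
    using ddeg_d[OF nz] by simp
qed

end

subsection \<open>Gradings\<close>

definition wt :: "('v \<Rightarrow> int) \<Rightarrow> ('v \<Rightarrow>\<^sub>0 nat) \<Rightarrow> int" where
  "wt w e = (\<Sum>v\<in>Poly_Mapping.keys e. w v * int (Poly_Mapping.lookup e v))"

definition whom :: "('v \<Rightarrow> int) \<Rightarrow> int \<Rightarrow> ('v, 'k::comm_ring_1) mpoly \<Rightarrow> bool" where
  "whom w k f \<longleftrightarrow> (\<forall>e\<in>Poly_Mapping.keys f. wt w e = k)"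

definition wcomp :: "('v \<Rightarrow> int) \<Rightarrow> int \<Rightarrow> ('v, 'k::comm_ring_1) mpoly \<Rightarrow> ('v, 'k) mpoly" where
  "wcomp w k f = Poly_Mapping.mapp (\<lambda>e c. c when wt w e = k) f"

lemma wt_superset:
  assumes "finite A" "Poly_Mapping.keys e \<subseteq> A"
  shows "wt w e = (\<Sum>v\<in>A. w v * int (Poly_Mapping.lookup e v))"
  unfolding wt_def
  by (rule sum.mono_neutral_left) (use assms in \<open>auto simp: in_keys_iff\<close>)

lemma wt_0 [simp]: "wt w 0 = 0"
  by (simp add: wt_def)

lemma wt_single [simp]: "wt w (Poly_Mapping.single v j) = w v * int j"
  by (subst wt_superset[of "{v}"]) auto

lemma wt_add: "wt w (e + e') = wt w e + wt w e'"
proof -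
  let ?A = "Poly_Mapping.keys e \<union> Poly_Mapping.keys e'"
  have "Poly_Mapping.keys (e + e') \<subseteq> ?A"
    by (rule Poly_Mapping.keys_add)
  then show ?thesis
    by (subst (1 2 3) wt_superset[of ?A])
       (auto simp: lookup_add algebra_simps sum.distrib)
qed

lemma lookup_wcomp:
  "Poly_Mapping.lookup (wcomp w k f) e = (if wt w e = k then Poly_Mapping.lookup f e else 0)"
  by (auto simp: wcomp_def lookup_mapp when_def in_keys_iff)

lemma wcomp_0 [simp]: "wcomp w k 0 = 0"
  by (rule poly_mapping_eqI) (simp add: lookup_wcomp)

lemma wcomp_add: "wcomp w k (f + g) = wcomp w k f + wcomp w k g"
  by (rule poly_mapping_eqI) (simp add: lookup_wcomp lookup_add)

lemma wcomp_diff: "wcomp w k (f - g) = wcomp w k f - wcomp w k g"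
  by (rule poly_mapping_eqI) (simp add: lookup_wcomp lookup_minus)

lemma wcomp_sum: "wcomp w k (sum f I) = (\<Sum>i\<in>I. wcomp w k (f i))"
  by (induction I rule: infinite_finite_induct) (auto simp: wcomp_add)

lemma whom_wcomp [simp]: "whom w k (wcomp w k f)"
  by (auto simp: whom_def in_keys_iff lookup_wcomp split: if_splits)

lemma wcomp_whom: "whom w k f \<Longrightarrow> wcomp w j f = (if j = k then f else 0)"
  by (rule poly_mapping_eqI) (auto simp: lookup_wcomp whom_def in_keys_iff)

lemma whom_preserved_wcomp: "whom w k f \<Longrightarrow> whom w k (wcomp w' j f)"
  by (auto simp: whom_def in_keys_iff lookup_wcomp split: if_splits)

lemma wcomp_decomposition:
  assumes "finite K" "wt w ` Poly_Mapping.keys f \<subseteq> K"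
  shows "(\<Sum>k\<in>K. wcomp w k f) = f"
  by (rule poly_mapping_eqI)
     (use assms in \<open>auto simp: lookup_sum lookup_wcomp in_keys_iff sum.delta image_subset_iff\<close>)

lemma wcomp_decomposition': "f = (\<Sum>k\<in>wt w ` Poly_Mapping.keys f. wcomp w k f)"
  by (rule wcomp_decomposition[symmetric]) auto

lemma whom_0 [simp]: "whom w k 0"
  by (simp add: whom_def)

lemma whom_single: "whom w (wt w e) (Poly_Mapping.single e c)"
  by (simp add: whom_def)

lemma whom_mconst [simp]: "whom w 0 (mconst c)"
  by (simp add: whom_def mconst_def)

lemma whom_1 [simp]: "whom w 0 1"
  by (simp add: whom_def)

lemma whom_mvar [simp]: "whom w (w v) (mvar v)"
  by (simp add: whom_def mvar_def)

lemma whom_add: "whom w k f \<Longrightarrow> whom w k g \<Longrightarrow> whom w k (f + g)"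
  using Poly_Mapping.keys_add[of f g] by (auto simp: whom_def)

lemma whom_uminus: "whom w k f \<Longrightarrow> whom w k (- f)"
  by (auto simp: whom_def in_keys_iff)

lemma whom_diff: "whom w k f \<Longrightarrow> whom w k g \<Longrightarrow> whom w k (f - g)"
  using whom_add[of w k f "- g"] whom_uminus[of w k g] by simp

lemma whom_mult: "whom w j f \<Longrightarrow> whom w k g \<Longrightarrow> whom w (j + k) (f * g)"
  using Poly_Mapping.keys_mult[of f g] by (fastforce simp: whom_def wt_add)

lemma whom_power: "whom w k f \<Longrightarrow> whom w (int j * k) (f ^ j)"
  by (induction j) (auto intro: whom_mult simp: algebra_simps)

lemma whom_prod: "(\<And>i. i \<in> I \<Longrightarrow> whom w (k i) (f i)) \<Longrightarrow> whom w (sum k I) (prod f I)"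
  by (induction I rule: infinite_finite_induct) (auto intro: whom_mult)

lemma wcomp_mult_whom:
  assumes "whom w i f"
  shows "wcomp w (i + j) (f * g) = f * wcomp w j g"
proof -
  have single: "wcomp w (wt w e + j) (Poly_Mapping.single e c * g) = Poly_Mapping.single e c * wcomp w j g"
    for e c
  proof (induction g rule: mpoly_induct_single)
    case (single e' c')
    show ?case
      unfolding mult_single wcomp_whom[OF whom_single] by (simp add: wt_add mult_single)
  qed (auto simp: wcomp_add algebra_simps)
  let ?m = "\<lambda>e. Poly_Mapping.single e (Poly_Mapping.lookup f e)"
  have "wcomp w (i + j) ((\<Sum>e\<in>Poly_Mapping.keys f. ?m e) * g) = (\<Sum>e\<in>Poly_Mapping.keys f. ?m e) * wcomp w j g"
    unfolding sum_distrib_right wcomp_sum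
    by (rule sum.cong[OF refl], subst single[symmetric]) (use assms in \<open>simp add: whom_def\<close>)
  then show ?thesis
    by (simp flip: mpoly_monom_expansion)
qed

lemma wcomp_mult:
  "wcomp w k (f * g) = (\<Sum>i\<in>wt w ` Poly_Mapping.keys f. wcomp w i f * wcomp w (k - i) g)"
proof -
  have comp: "wcomp w k (wcomp w i f * g) = wcomp w i f * wcomp w (k - i) g" for i
    using wcomp_mult_whom[OF whom_wcomp[of w i f], of "k - i" g] by simp
  have "wcomp w k (f * g) = wcomp w k ((\<Sum>i\<in>wt w ` Poly_Mapping.keys f. wcomp w i f) * g)"
    by (simp flip: wcomp_decomposition')
  also have "\<dots> = (\<Sum>i\<in>wt w ` Poly_Mapping.keys f. wcomp w i f * wcomp w (k - i) g)"
    unfolding sum_distrib_right wcomp_sum by (rule sum.cong[OF refl], rule comp)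
  finally show ?thesis .
qed

definition graded_ideal :: "('v \<Rightarrow> int) \<Rightarrow> ('v, 'k::comm_ring_1) mpoly set \<Rightarrow> bool" where
  "graded_ideal w J \<longleftrightarrow> (\<forall>f\<in>J. \<forall>k. wcomp w k f \<in> J)"

text \<open>The polynomials all of whose components lie in \<open>J\<close> form an ideal containing
  the generators; the third assumption, minimality of \<open>J\<close>, then applies to it.\<close>

lemma graded_ideal_generated:
  assumes "ring_ideal J" "G \<subseteq> J" "\<And>Q. ring_ideal Q \<Longrightarrow> G \<subseteq> Q \<Longrightarrow> J \<subseteq> Q"
    and "\<And>g. g \<in> G \<Longrightarrow> \<exists>k. whom w k g"
  shows "graded_ideal w J"
proof -
  interpret ring_ideal J by fact
  let ?Q = "{f. \<forall>k. wcomp w k f \<in> J}"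
  have "ring_ideal ?Q"
    by unfold_locales (auto simp: wcomp_add wcomp_mult intro!: add_mem sum_mem mult_mem)
  moreover have "G \<subseteq> ?Q"
  proof
    fix g assume "g \<in> G"
    with assms(4) obtain k where "whom w k g" by blast
    with \<open>g \<in> G\<close> assms(2) show "g \<in> ?Q"
      by (auto simp: wcomp_whom)
  qed
  ultimately show ?thesis
    using assms(3) by (auto simp: graded_ideal_def)
qed

lemma derivation_eqI:
  assumes "derivation d" "derivation d'" "\<And>v. d (mvar v) = d' (mvar v)"
  shows "d f = d' f"
proof -
  interpret d: derivation d by fact
  interpret d': derivation d' by fact
  show ?thesis
    by (induction f rule: mpoly_induct) (auto simp: assms(3) d.d_add d'.d_add d.d_mult d'.d_mult)
qed

section \<open>Homogeneous derivations and components of derivations\<close>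

definition der_whom ::
    "('v \<Rightarrow> int) \<Rightarrow> int \<Rightarrow> (('v, 'k::comm_ring_1) mpoly \<Rightarrow> ('v, 'k) mpoly) \<Rightarrow> bool" where
  "der_whom w \<delta> d \<longleftrightarrow> (\<forall>v. whom w (w v + \<delta>) (d (mvar v)))"

text \<open>Prescribing only the values on variables makes the component a derivation by
  construction; \<open>wcomp_d\<close> shows that it extracts the right component of
  \<open>d f\<close> for every homogeneous \<open>f\<close>.\<close>

definition der_comp ::
    "('v \<Rightarrow> int) \<Rightarrow> int \<Rightarrow> (('v, 'k::comm_ring_1) mpoly \<Rightarrow> ('v, 'k) mpoly) \<Rightarrow> ('v, 'k) mpoly \<Rightarrow> ('v, 'k) mpoly" where
  "der_comp w \<epsilon> d = mpoly_der (\<lambda>v. wcomp w (w v + \<epsilon>) (d (mvar v)))"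

context derivation
begin

lemma wcomp_d:
  assumes "whom w k f"
  shows "wcomp w (k + \<epsilon>) (d f) = der_comp w \<epsilon> d f"
proof -
  interpret D: derivation "der_comp w \<epsilon> d"
    unfolding der_comp_def by (rule derivation_mpoly_der)
  have monom: "wcomp w (wt w e + \<epsilon>) (d (mmonom e)) = der_comp w \<epsilon> d (mmonom e)" for e
  proof (induction e rule: monom_induct)
    case zero
    show ?case by simp
  next
    case (add e v)
    let ?e = "mmonom e :: ('v, 'k) mpoly"
    have "wcomp w (wt w e + w v + \<epsilon>) (d (?e * mvar v)) =
       wcomp w (w v + (wt w e + \<epsilon>)) (mvar v * d ?e) + wcomp w (wt w e + (w v + \<epsilon>)) (?e * d (mvar v))"
      by (simp add: d_mult wcomp_add algebra_simps)
    also have "\<dots> = der_comp w \<epsilon> d (?e * mvar v)"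
      using add by (simp add: wcomp_mult_whom[OF whom_mvar] wcomp_mult_whom[OF whom_single] D.d_mult)
        (simp add: der_comp_def)
    finally show ?case
      by (simp add: wt_add mmonom_add mvar_def)
  qed
  let ?m = "\<lambda>e. Poly_Mapping.single e (Poly_Mapping.lookup f e)"
  have "wcomp w (k + \<epsilon>) (d (?m e)) = der_comp w \<epsilon> d (?m e)" if "e \<in> Poly_Mapping.keys f" for e
  proof -
    have "wcomp w (0 + (wt w e + \<epsilon>)) (mconst c * d (mmonom e)) = mconst c * der_comp w \<epsilon> d (mmonom e)" for c
      unfolding monom[symmetric] by (rule wcomp_mult_whom) simp
    then show ?thesis
      using that assms
      by (simp add: single_eq_mconst_mult[of e "Poly_Mapping.lookup f e"] d_mconst_mult D.d_mconst_mult whom_def)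
  qed
  then have "wcomp w (k + \<epsilon>) (d (\<Sum>e\<in>Poly_Mapping.keys f. ?m e)) = der_comp w \<epsilon> d (\<Sum>e\<in>Poly_Mapping.keys f. ?m e)"
    by (simp add: d_sum D.d_sum wcomp_sum)
  then show ?thesis
    by (simp flip: mpoly_monom_expansion)
qed

lemma whom_d:
  assumes "der_whom w \<delta> d" "whom w k f"
  shows "whom w (k + \<delta>) (d f)"
proof -
  have *: "wcomp w (w v + \<delta>) (d (mvar v)) = d (mvar v)" for v
    using wcomp_whom[of w "w v + \<delta>" "d (mvar v)" "w v + \<delta>"] assms(1) by (simp add: der_whom_def)
  have "der_comp w \<delta> d f = d f"
    unfolding der_comp_def
    by (rule derivation_eqI[OF derivation_mpoly_der derivation_axioms]) (simp add: *)
  then show ?thesis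
    using wcomp_d[OF assms(2), of \<delta>] whom_wcomp[of w "k + \<delta>" "d f"] by simp
qed

lemma whom_funpow_d:
  assumes "der_whom w \<delta> d" "whom w k f"
  shows "whom w (k + int j * \<delta>) ((d ^^ j) f)"
proof (induction j)
  case (Suc j)
  from whom_d[OF assms(1) this] show ?case by (simp add: algebra_simps)
qed (use assms in simp)

end

subsection \<open>Homogenization of locally nilpotent derivations\<close>

text \<open>The component of highest degree (modulo \<open>J\<close>) of a locally nilpotent derivation is again locally
  nilpotent, because it computes the highest components of iterated derivatives.\<close>

lemma (in lnd_mod_ideal) homogenize:
  assumes graded: "graded_ideal w J"
    and V: "finite V" "\<And>v. v \<notin> V \<Longrightarrow> d (mvar v) = 0"
    and nz: "d (mvar u) \<notin> J"
  obtains \<delta> d' where "lnd_mod_ideal d' J" "der_whom w \<delta> d'" "\<exists>v. d' (mvar v) \<notin> J"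
    "\<And>v. v \<notin> V \<Longrightarrow> d' (mvar v) = 0"
    "\<And>w' \<delta>'. der_whom w' \<delta>' d \<Longrightarrow> der_whom w' \<delta>' d'"
proof -
  \<comment> \<open>The degrees in which \<open>d\<close> is nonzero modulo \<open>J\<close>. Only
    the finitely many variables in \<open>V\<close> contribute, so there is a highest one.\<close>
  define E where "E = {\<epsilon>. \<exists>v. wcomp w (w v + \<epsilon>) (d (mvar v)) \<notin> J}"
  have "E \<subseteq> (\<Union>v\<in>V. (\<lambda>e. wt w e - w v) ` Poly_Mapping.keys (d (mvar v)))"
  proof
    fix \<epsilon> assume "\<epsilon> \<in> E"
    then obtain v where v: "wcomp w (w v + \<epsilon>) (d (mvar v)) \<notin> J"
      by (auto simp: E_def)
    then have "wcomp w (w v + \<epsilon>) (d (mvar v)) \<noteq> 0" "v \<in> V"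
      using V(2)[of v] by (metis zero_mem, metis wcomp_0 zero_mem)
    then obtain e where "Poly_Mapping.lookup (wcomp w (w v + \<epsilon>) (d (mvar v))) e \<noteq> 0"
      by (metis poly_mapping_eqI lookup_zero)
    then have "e \<in> Poly_Mapping.keys (d (mvar v))" "\<epsilon> = wt w e - w v"
      by (auto simp: lookup_wcomp in_keys_iff split: if_splits)
    with \<open>v \<in> V\<close> show "\<epsilon> \<in> (\<Union>v\<in>V. (\<lambda>e. wt w e - w v) ` Poly_Mapping.keys (d (mvar v)))"
      by blast
  qed
  then have fin: "finite E"
    by (rule finite_subset) (use V in auto)
  have "E \<noteq> {}"
  proof
    assume "E = {}"
    then have "wcomp w (w u + (k - w u)) (d (mvar u)) \<in> J" for k
      unfolding E_def by blast
    then have "(\<Sum>k\<in>wt w ` Poly_Mapping.keys (d (mvar u)). wcomp w k (d (mvar u))) \<in> J"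
      by (intro sum_mem) simp
    with nz show False
      by (simp flip: wcomp_decomposition')
  qed
  define \<delta> where "\<delta> = Max E"
  define d' where "d' = der_comp w \<delta> d"
  interpret d': derivation d'
    unfolding d'_def der_comp_def by (rule derivation_mpoly_der)
  have d'_mvar: "d' (mvar v) = wcomp w (w v + \<delta>) (d (mvar v))" for v
    by (simp add: d'_def der_comp_def)
  have hom: "der_whom w \<delta> d'"
    by (simp add: der_whom_def d'_mvar)
  have d'_mem: "d' f \<in> J" if "f \<in> J" for f
  proof -
    have "d' (wcomp w k f) \<in> J" for k
      unfolding d'_def wcomp_d[OF whom_wcomp, symmetric]
      using graded that by (auto simp: graded_ideal_def intro: d_mem)
    then have "d' (\<Sum>k\<in>wt w ` Poly_Mapping.keys f. wcomp w k f) \<in> J"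
      unfolding d'.d_sum by (intro sum_mem)
    then show ?thesis
      by (simp flip: wcomp_decomposition')
  qed
  have high: "der_comp w \<epsilon> d f \<in> J" if "\<epsilon> > \<delta>" for \<epsilon> f
  proof -
    interpret D: derivation "der_comp w \<epsilon> d"
      unfolding der_comp_def by (rule derivation_mpoly_der)
    have "\<epsilon> \<notin> E"
      using that Max_ge[OF fin, of \<epsilon>] leD unfolding \<delta>_def by blast
    then have "der_comp w \<epsilon> d (mvar v) \<in> J" for v
      by (simp add: E_def der_comp_def)
    then show ?thesis
      by (induction f rule: mpoly_induct) (auto simp: D.d_add D.d_mult intro: add_mem mult_mem mult_mem')
  qed
  \<comment> \<open>Modulo \<open>J\<close>, only degrees below \<open>k\<close> occur in
    \<open>f\<close>. The derivation \<open>d\<close> shifts this bound by \<delta>, while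
    \<open>d - d'\<close> sends a homogeneous \<open>f\<close> of degree \<open>k\<close> strictly
    below degree \<open>k + \<delta>\<close>.\<close>
  define low where "low k f \<longleftrightarrow> (\<forall>j\<ge>k. wcomp w j f \<in> J)" for k f
  have low_add: "low k (f + g)" if "low k f" "low k g" for k f g
    using that by (auto simp: low_def wcomp_add intro: add_mem)
  have low_d: "low (k + \<delta>) (d f)" if "low k f" for k f
    unfolding low_def
  proof (intro allI impI)
    fix j assume j: "j \<ge> k + \<delta>"
    have "wcomp w j (d (wcomp w i f)) \<in> J" for i
    proof (cases "i \<ge> k")
      case True
      then have "wcomp w i f \<in> J"
        using that by (simp add: low_def)
      then show ?thesis
        using graded d_mem by (auto simp: graded_ideal_def)
    next
      case False
      then have "der_comp w (j - i) d (wcomp w i f) \<in> J"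
        using j by (intro high) auto
      then show ?thesis
        using wcomp_d[OF whom_wcomp, of w i "j - i" f] by simp
    qed
    then have "wcomp w j (d (\<Sum>i\<in>wt w ` Poly_Mapping.keys f. wcomp w i f)) \<in> J"
      unfolding d_sum wcomp_sum by (intro sum_mem)
    then show "wcomp w j (d f) \<in> J"
      by (simp flip: wcomp_decomposition')
  qed
  have low_diff: "low (k + \<delta>) (d f - d' f)" if "whom w k f" for k f
    unfolding low_def
  proof (intro allI impI)
    fix j assume j: "j \<ge> k + \<delta>"
    have d': "wcomp w j (d' f) = (if j = k + \<delta> then d' f else 0)"
      by (intro wcomp_whom d'.whom_d hom that)
    have "wcomp w j (d f) = der_comp w (j - k) d f"
      using wcomp_d[OF that, of "j - k"] by simp
    with d' high[of "j - k" f] j show "wcomp w j (d f - d' f) \<in> J"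
      by (auto simp: wcomp_diff d'_def)
  qed
  have low_iter: "low (k + int j * \<delta>) ((d ^^ j) f - (d' ^^ j) f)" if "whom w k f" for k j f
  proof (induction j)
    case (Suc j)
    \<comment> \<open>Telescoping: the next difference is \<open>d\<close> applied to the previous
      one, plus \<open>d - d'\<close> applied to an iterate of \<open>d'\<close>.\<close>
    have "low (k + int j * \<delta> + \<delta>) (d ((d ^^ j) f - (d' ^^ j) f) + (d ((d' ^^ j) f) - d' ((d' ^^ j) f)))"
      by (intro low_add low_d Suc low_diff d'.whom_funpow_d hom that)
    then show ?case
      by (simp add: d_diff algebra_simps)
  qed (simp add: low_def)
  interpret d': derivation_mod_ideal d' J
    by unfold_locales (rule d'_mem)
  have nil_hom: "\<exists>j. (d' ^^ j) f \<in> J" if "whom w k f" for k f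
  proof -
    \<comment> \<open>The component of \<open>(d ^^ j) f\<close> in degree
      \<open>k + j * \<delta>\<close> is congruent to \<open>(d' ^^ j) f\<close>, and it lies in
      \<open>J\<close> because \<open>J\<close> is graded.\<close>
    obtain j where "(d ^^ j) f \<in> J"
      using nilpotent by blast
    then have 1: "wcomp w (k + int j * \<delta>) ((d ^^ j) f) \<in> J"
      using graded by (auto simp: graded_ideal_def)
    moreover have "wcomp w (k + int j * \<delta>) ((d ^^ j) f - (d' ^^ j) f) \<in> J"
      using low_iter[OF that, of j] by (simp add: low_def)
    moreover have "wcomp w (k + int j * \<delta>) ((d' ^^ j) f) = (d' ^^ j) f"
      using wcomp_whom[OF d'.whom_funpow_d[OF hom that]] by simp
    ultimately have "(d' ^^ j) f \<in> J"
      using diff_mem[of "wcomp w (k + int j * \<delta>) ((d ^^ j) f)"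
          "wcomp w (k + int j * \<delta>) ((d ^^ j) f) - (d' ^^ j) f"]
      by (simp add: wcomp_diff)
    then show ?thesis by blast
  qed
  have "lnd_mod_ideal d' J"
  proof
    fix f
    show "\<exists>j. (d' ^^ j) f \<in> J"
      by (rule d'.nilpotent_if_nilpotent_mvar) (rule nil_hom, rule whom_mvar)
  qed
  moreover have "\<exists>v. d' (mvar v) \<notin> J"
    using Max_in[OF fin \<open>E \<noteq> {}\<close>] by (auto simp: E_def d'_mvar \<delta>_def)
  moreover have "d' (mvar v) = 0" if "v \<notin> V" for v
    using V(2)[OF that] by (simp add: d'_mvar)
  moreover have "der_whom w' \<delta>' d'" if "der_whom w' \<delta>' d" for w' \<delta>'
    using that by (simp add: der_whom_def d'_mvar whom_preserved_wcomp)
  ultimately show ?thesis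
    using that hom by blast
qed

text \<open>One weight is treated after another. Homogeneity already reached is not lost, since a
  component for one grading stays homogeneous for every other grading for which the polynomial
  was.\<close>

lemma homogenize_finite:
  assumes "lnd_mod_ideal d J" "finite W" "\<And>w. w \<in> W \<Longrightarrow> graded_ideal w J"
    and V: "finite V" "\<And>v. v \<notin> V \<Longrightarrow> d (mvar v) = 0"
    and nz: "\<exists>u. d (mvar u) \<notin> J"
  shows "\<exists>d'. lnd_mod_ideal d' J \<and> (\<forall>w\<in>W. \<exists>\<delta>. der_whom w \<delta> d') \<and> (\<exists>v. d' (mvar v) \<notin> J) \<and>
    (\<forall>v. v \<notin> V \<longrightarrow> d' (mvar v) = 0)"
  using assms(2,3)
proof (induction W rule: finite_induct)
  case empty
  show ?case
    by (rule exI[of _ d]) (use assms(1) V nz in auto)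
next
  case (insert w W)
  have "\<exists>d'. lnd_mod_ideal d' J \<and> (\<forall>w\<in>W. \<exists>\<delta>. der_whom w \<delta> d') \<and> (\<exists>v. d' (mvar v) \<notin> J) \<and>
      (\<forall>v. v \<notin> V \<longrightarrow> d' (mvar v) = 0)"
    by (rule insert.IH) (rule insert.prems, simp)
  then obtain d' where "lnd_mod_ideal d' J \<and> (\<forall>w\<in>W. \<exists>\<delta>. der_whom w \<delta> d') \<and> (\<exists>v. d' (mvar v) \<notin> J) \<and>
      (\<forall>v. v \<notin> V \<longrightarrow> d' (mvar v) = 0)" ..
  then have d': "lnd_mod_ideal d' J" "\<forall>w\<in>W. \<exists>\<delta>. der_whom w \<delta> d'"
    "\<exists>v. d' (mvar v) \<notin> J" "\<forall>v. v \<notin> V \<longrightarrow> d' (mvar v) = 0"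
    by simp_all
  interpret d': lnd_mod_ideal d' J by fact
  from d'(3) obtain u where u: "d' (mvar u) \<notin> J" ..
  obtain \<delta> d'' where d'': "lnd_mod_ideal d'' J" "der_whom w \<delta> d''" "\<exists>v. d'' (mvar v) \<notin> J"
    "\<And>v. v \<notin> V \<Longrightarrow> d'' (mvar v) = 0"
    and keep: "\<And>w' \<delta>'. der_whom w' \<delta>' d' \<Longrightarrow> der_whom w' \<delta>' d''"
    by (rule d'.homogenize[of w V u])
       (use insert.prems V(1) d'(4) u in simp_all)
  moreover have "\<forall>w'\<in>insert w W. \<exists>\<delta>. der_whom w' \<delta> d''"
    using d''(2) d'(2) keep by (metis insert_iff)
  ultimately show ?case
    by (intro exI[of _ d''] conjI allI impI)
qed

subsection \<open>Quotients of polynomial rings\<close>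

text \<open>Calculations in \<open>mpoly_ring V Quot Idl G\<close> are carried out in the full type of polynomials, modulo
  the ideal \<open>J\<close> generated by \<open>G\<close> and all variables outside \<open>V\<close>.\<close>

lemma mpoly_ring_simps:
  "carrier (mpoly_ring V) = {p. mpoly_vars p \<subseteq> V}" "f \<oplus>\<^bsub>mpoly_ring V\<^esub> g = f + g"
  "f \<otimes>\<^bsub>mpoly_ring V\<^esub> g = f * g" "\<zero>\<^bsub>mpoly_ring V\<^esub> = 0" "\<one>\<^bsub>mpoly_ring V\<^esub> = 1"
  by (simp_all add: mpoly_ring_def ring_of_type_algebra_def)

lemma mpoly_ring_uminus:
  fixes f :: "('v, 'k::comm_ring_1) mpoly"
  assumes f: "mpoly_vars f \<subseteq> V"
  shows "\<ominus>\<^bsub>mpoly_ring V\<^esub> f = - f"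
proof -
  interpret cring "mpoly_ring V :: ('v, 'k) mpoly ring"
    by (rule cring_mpoly_ring)
  show ?thesis
    by (rule minus_equality) (use f in \<open>simp_all add: mpoly_ring_simps\<close>)
qed

definition mpoly_restrict :: "'v set \<Rightarrow> ('v, 'k::comm_ring_1) mpoly \<Rightarrow> ('v, 'k) mpoly" where
  "mpoly_restrict V = mpoly_eval mconst (\<lambda>v. if v \<in> V then mvar v else 0)"

interpretation restrict: ring_map "mpoly_restrict V"
  unfolding mpoly_restrict_def by (rule mconst.ring_map_mpoly_eval)

lemma mpoly_restrict_mconst [simp]: "mpoly_restrict V (mconst c) = mconst c"
  by (simp add: mpoly_restrict_def)

lemma mpoly_restrict_mvar [simp]: "mpoly_restrict V (mvar v) = (if v \<in> V then mvar v else 0)"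
  by (simp add: mpoly_restrict_def)

lemma mpoly_vars_restrict: "mpoly_vars (mpoly_restrict V f) \<subseteq> V"
proof (induction f rule: mpoly_induct)
  case (add f g)
  then show ?case
    using mpoly_vars_add[of "mpoly_restrict V f" "mpoly_restrict V g"]
    by (auto simp: restrict.map_add)
next
  case (mult f g)
  then show ?case
    using mpoly_vars_mult[of "mpoly_restrict V f" "mpoly_restrict V g"]
    by (auto simp: restrict.map_mult)
qed auto

lemma monom_eval_mvar: "monom_eval mvar e = mmonom e"
  by (induction e rule: monom_induct) (auto simp: monom_eval_add mmonom_add mvar_def)

lemma mpoly_restrict_ident:
  assumes "mpoly_vars f \<subseteq> V"
  shows "mpoly_restrict V f = f"
proof -
  have "mpoly_restrict V (Poly_Mapping.single e (Poly_Mapping.lookup f e)) =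
      Poly_Mapping.single e (Poly_Mapping.lookup f e)" if "e \<in> Poly_Mapping.keys f" for e
  proof -
    have "monom_eval (\<lambda>v. if v \<in> V then mvar v else 0) e = monom_eval (mvar :: _ \<Rightarrow> ('a, 'b) mpoly) e"
      unfolding monom_eval_def
      by (rule prod.cong) (use that assms in \<open>auto simp: mpoly_vars_def\<close>)
    then have "mpoly_restrict V (mmonom e :: ('a, 'b) mpoly) = mmonom e"
      by (simp add: mpoly_restrict_def monom_eval_mvar)
    then show ?thesis
      by (simp add: single_eq_mconst_mult[of e "Poly_Mapping.lookup f e"] restrict.map_mult)
  qed
  then have "mpoly_restrict V (\<Sum>e\<in>Poly_Mapping.keys f. Poly_Mapping.single e (Poly_Mapping.lookup f e)) =
      (\<Sum>e\<in>Poly_Mapping.keys f. Poly_Mapping.single e (Poly_Mapping.lookup f e))"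
    by (simp add: restrict.map_sum)
  then show ?thesis
    by (simp flip: mpoly_monom_expansion)
qed

locale mpoly_quotient =
  fixes V :: "'v set" and G :: "('v, 'k::field_char_0) mpoly set"
  assumes G: "G \<subseteq> carrier (mpoly_ring V)"
begin

abbreviation "R \<equiv> mpoly_ring V :: ('v, 'k) mpoly ring"
abbreviation "I \<equiv> genideal R G"
abbreviation "B \<equiv> R Quot I"
abbreviation "\<iota> c \<equiv> I +>\<^bsub>R\<^esub> mconst c"

text \<open>The preimage form links \<open>J\<close> to \<open>B\<close> directly;
  \<open>generators_subset\<close> and \<open>J_minimal\<close> then identify it as the ideal
  generated by \<open>G\<close> and the outside variables.\<close>

definition J :: "('v, 'k) mpoly set" where
  "J = {f. mpoly_restrict V f \<in> I}"

definition \<pi> :: "('v, 'k) mpoly \<Rightarrow> ('v, 'k) mpoly set" where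
  "\<pi> f = I +>\<^bsub>R\<^esub> mpoly_restrict V f"

sublocale R: cring R
  by (rule cring_mpoly_ring)

sublocale I: ideal I R
  by (rule R.genideal_ideal[OF G])

lemma restrict_carrier [simp]: "mpoly_restrict V f \<in> carrier R"
  using mpoly_vars_restrict[of V f] by (simp add: mpoly_ring_simps)

sublocale J: ring_ideal J
proof
  show "0 \<in> J"
    using I.zero_closed by (simp add: J_def mpoly_ring_simps)
  show "a + b \<in> J" if "a \<in> J" "b \<in> J" for a b
    using that I.a_closed[of "mpoly_restrict V a" "mpoly_restrict V b"]
    by (simp add: J_def restrict.map_add mpoly_ring_simps)
  show "c * a \<in> J" if "a \<in> J" for a c
    using that I.I_l_closed[of "mpoly_restrict V a" "mpoly_restrict V c"]
    by (simp add: J_def restrict.map_mult mpoly_ring_simps mpoly_vars_restrict)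
qed

lemma generators_subset: "G \<union> mvar ` (- V) \<subseteq> J"
proof -
  have "g \<in> J" if "g \<in> G" for g
  proof -
    have "mpoly_vars g \<subseteq> V"
      using that G by (auto simp: mpoly_ring_simps)
    with that R.genideal_self[OF G] show ?thesis
      by (auto simp: J_def mpoly_restrict_ident)
  qed
  moreover have "mvar v \<in> J" if "v \<notin> V" for v
    using that J.zero_mem by (simp add: J_def)
  ultimately show ?thesis by auto
qed

text \<open>Since \<open>Q\<close> contains the outside variables, every polynomial differs from its
  restriction by an element of \<open>Q\<close>; and \<open>Q\<close> cut down to
  \<open>carrier R\<close> is an ideal of \<open>R\<close> that contains \<open>G\<close>.\<close>

lemma J_minimal:
  assumes "ring_ideal Q" "G \<union> mvar ` (- V) \<subseteq> Q"
  shows "J \<subseteq> Q"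
proof
  fix f assume f: "f \<in> J"
  interpret Q: ring_ideal Q by fact
  have "ideal (Q \<inter> carrier R) R"
  proof (rule idealI[OF R.ring_axioms])
    show "subgroup (Q \<inter> carrier R) (add_monoid R)"
    proof (rule R.add.subgroupI)
      show "\<ominus>\<^bsub>R\<^esub> a \<in> Q \<inter> carrier R" if "a \<in> Q \<inter> carrier R" for a
        using that by (auto simp: mpoly_ring_simps mpoly_ring_uminus Q.uminus_mem)
      show "a \<oplus>\<^bsub>R\<^esub> b \<in> Q \<inter> carrier R" if "a \<in> Q \<inter> carrier R" "b \<in> Q \<inter> carrier R" for a b
        using that mpoly_vars_add[of a b] by (auto simp: mpoly_ring_simps Q.add_mem)
      show "Q \<inter> carrier R \<noteq> {}"
      proof -
        have "0 \<in> Q \<inter> carrier R" by (simp add: mpoly_ring_simps)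
        then show ?thesis by blast
      qed
    qed auto
    show "x \<otimes>\<^bsub>R\<^esub> a \<in> Q \<inter> carrier R" "a \<otimes>\<^bsub>R\<^esub> x \<in> Q \<inter> carrier R"
      if "a \<in> Q \<inter> carrier R" "x \<in> carrier R" for a x
      using that mpoly_vars_mult[of a x] mpoly_vars_mult[of x a]
      by (auto simp: mpoly_ring_simps Q.mult_mem Q.mult_mem')
  qed
  then have "I \<subseteq> Q \<inter> carrier R"
    by (rule R.genideal_minimal) (use assms G in auto)
  then have "mpoly_restrict V f \<in> Q"
    using f by (auto simp: J_def)
  moreover have "f - mpoly_restrict V f \<in> Q" for f
  proof (induction f rule: mpoly_induct)
    case (var v)
    then show ?case using assms(2) by auto
  next
    case (add f g)
    then show ?case
      using Q.add_mem[of "f - mpoly_restrict V f" "g - mpoly_restrict V g"]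
      by (simp add: restrict.map_add algebra_simps)
  next
    case (mult f g)
    then show ?case
      using Q.add_mem[OF Q.mult_mem[of _ g] Q.mult_mem[of _ "mpoly_restrict V f"]]
      by (fastforce simp: restrict.map_mult algebra_simps)
  qed auto
  ultimately show "f \<in> Q"
    using Q.add_mem[of "mpoly_restrict V f" "f - mpoly_restrict V f"] by simp
qed

lemma J_restrict: "f \<in> J \<longleftrightarrow> mpoly_restrict V f \<in> J"
  by (simp add: J_def mpoly_restrict_ident mpoly_vars_restrict)

lemma pi_eq_iff: "\<pi> f = \<pi> g \<longleftrightarrow> f - g \<in> J"
proof -
  have "mpoly_restrict V f \<ominus>\<^bsub>R\<^esub> mpoly_restrict V g = mpoly_restrict V (f - g)"
    by (simp add: a_minus_def mpoly_ring_uminus mpoly_vars_restrict mpoly_ring_simps restrict.map_diff)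
  with R.quotient_eq_iff_same_a_r_cos[OF I.ideal_axioms restrict_carrier restrict_carrier, of f g]
  show ?thesis
    by (simp add: J_def \<pi>_def)
qed

lemma pi_add: "\<pi> (f + g) = \<pi> f \<oplus>\<^bsub>B\<^esub> \<pi> g"
  using ring_hom_add[OF I.rcos_ring_hom restrict_carrier restrict_carrier, of f g]
  by (simp add: \<pi>_def restrict.map_add mpoly_ring_simps)

lemma pi_mult: "\<pi> (f * g) = \<pi> f \<otimes>\<^bsub>B\<^esub> \<pi> g"
  using ring_hom_mult[OF I.rcos_ring_hom restrict_carrier restrict_carrier, of f g]
  by (simp add: \<pi>_def restrict.map_mult mpoly_ring_simps)

lemma pi_closed [simp]: "\<pi> f \<in> carrier B"
  using ring_hom_closed[OF I.rcos_ring_hom restrict_carrier, of f] by (simp add: \<pi>_def)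

lemma pi_mconst: "\<pi> (mconst c) = \<iota> c"
  by (simp add: \<pi>_def)

lemma pi_1: "\<pi> 1 = \<one>\<^bsub>B\<^esub>"
  using ring_hom_one[OF I.rcos_ring_hom] by (simp add: \<pi>_def mpoly_ring_simps)

sublocale B: cring B
  by (rule I.quotient_is_cring[OF R.is_cring])

lemma pi_0: "\<pi> 0 = \<zero>\<^bsub>B\<^esub>"
  using pi_add[of 0 0] B.add.r_cancel_one'[of "\<pi> 0" "\<pi> 0"] by simp

lemma pi_eq_0_iff: "\<pi> f = \<zero>\<^bsub>B\<^esub> \<longleftrightarrow> f \<in> J"
  using pi_eq_iff[of f 0] by (simp add: pi_0)

lemma pi_surj: "x \<in> carrier B \<Longrightarrow> \<exists>f. x = \<pi> f"
  by (auto simp: FactRing_def A_RCOSETS_def' \<pi>_def mpoly_ring_simps) (metis mpoly_restrict_ident)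

section \<open>Derivations of the quotient and derivations preserving \<open>J\<close>\<close>

lemma not_rigidI:
  assumes "lnd_mod_ideal d J" "d f \<notin> J"
  shows "\<not> rigid_algebra B \<iota>"
proof -
  interpret d: lnd_mod_ideal d J by fact
  \<comment> \<open>Any representative serves, because \<open>d\<close> maps \<open>J\<close> into
    itself.\<close>
  define D where "D x = \<pi> (d (SOME f. x = \<pi> f))" for x
  have D: "D (\<pi> f) = \<pi> (d f)" for f
  proof -
    have "\<pi> f = \<pi> (SOME g. \<pi> f = \<pi> g)"
      by (rule someI[of "\<lambda>g. \<pi> f = \<pi> g" f]) simp
    then show ?thesis
      using d.d_mem[of "f - (SOME g. \<pi> f = \<pi> g)"] by (simp add: D_def pi_eq_iff d.d_diff J.uminus_mem)
        (metis J.uminus_mem minus_diff_eq)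
  qed
  have iter: "(D ^^ j) (\<pi> f) = \<pi> ((d ^^ j) f)" for j f
    by (induction j) (auto simp: D)
  have "alg_derivation B \<iota> D"
    unfolding alg_derivation_def
  proof (intro conjI ballI allI)
    show "D \<in> carrier B \<rightarrow> carrier B"
      by (auto simp: D_def)
    fix x assume "x \<in> carrier B"
    then obtain f where x: "x = \<pi> f"
      using pi_surj by blast
    show "D (\<iota> c \<otimes>\<^bsub>B\<^esub> x) = \<iota> c \<otimes>\<^bsub>B\<^esub> D x" for c
      by (simp add: x D d.d_mconst_mult flip: pi_mconst pi_mult)
    fix y assume "y \<in> carrier B"
    then obtain g where y: "y = \<pi> g"
      using pi_surj by blast
    show "D (x \<oplus>\<^bsub>B\<^esub> y) = D x \<oplus>\<^bsub>B\<^esub> D y"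
      by (simp add: x y D d.d_add flip: pi_add)
    show "D (x \<otimes>\<^bsub>B\<^esub> y) = D x \<otimes>\<^bsub>B\<^esub> y \<oplus>\<^bsub>B\<^esub> x \<otimes>\<^bsub>B\<^esub> D y"
      by (simp add: x y D d.d_mult flip: pi_add pi_mult)
  qed
  moreover have "\<exists>j>0. (D ^^ j) x = \<zero>\<^bsub>B\<^esub>" if "x \<in> carrier B" for x
  proof -
    obtain f where x: "x = \<pi> f"
      using \<open>x \<in> carrier B\<close> pi_surj by blast
    obtain j where "(d ^^ j) f \<in> J"
      using d.nilpotent by blast
    then have "(d ^^ Suc j) f \<in> J"
      by (rule d.funpow_mem_le) simp
    then show ?thesis
      unfolding x iter pi_eq_0_iff by blast
  qed
  moreover have "D (\<pi> f) \<noteq> \<zero>\<^bsub>B\<^esub>"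
    using assms(2) by (simp add: D pi_eq_0_iff)
  ultimately show ?thesis
    unfolding rigid_algebra_def locally_nilpotent_derivation_def using pi_closed by blast
qed

lemma not_rigidE:
  assumes "\<not> rigid_algebra B \<iota>"
  obtains d where "lnd_mod_ideal d J" "\<And>v. v \<notin> V \<Longrightarrow> d (mvar v) = 0" "\<exists>v. d (mvar v) \<notin> J"
proof -
  from assms obtain D x where D: "alg_derivation B \<iota> D"
    and nil: "\<And>x. x \<in> carrier B \<Longrightarrow> \<exists>j>0. (D ^^ j) x = \<zero>\<^bsub>B\<^esub>"
    and x: "x \<in> carrier B" "D x \<noteq> \<zero>\<^bsub>B\<^esub>"
    unfolding rigid_algebra_def locally_nilpotent_derivation_def by blast
  have closed: "D x \<in> carrier B" if "x \<in> carrier B" for x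
    using D that by (auto simp: alg_derivation_def)
  have D_add: "D (x \<oplus>\<^bsub>B\<^esub> y) = D x \<oplus>\<^bsub>B\<^esub> D y"
    and D_mult: "D (x \<otimes>\<^bsub>B\<^esub> y) = D x \<otimes>\<^bsub>B\<^esub> y \<oplus>\<^bsub>B\<^esub> x \<otimes>\<^bsub>B\<^esub> D y"
    and D_const: "D (\<iota> c \<otimes>\<^bsub>B\<^esub> x) = \<iota> c \<otimes>\<^bsub>B\<^esub> D x"
    if "x \<in> carrier B" "y \<in> carrier B" for x y c
    using D that unfolding alg_derivation_def by blast+
  \<comment> \<open>A lift of \<open>D\<close>: arbitrary representatives of its values on the
    variables in \<open>V\<close>, and \<open>0\<close> on the others, whose classes are zero. The
    derivation \<open>?d\<close> induces \<open>D\<close> because the two agree on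
    generators.\<close>
  define h where "h v = (if v \<in> V then SOME g. D (\<pi> (mvar v)) = \<pi> g else 0)" for v
  have h: "\<pi> (h v) = D (\<pi> (mvar v))" if "v \<in> V" for v
  proof -
    have "\<exists>g. D (\<pi> (mvar v)) = \<pi> g"
      using pi_surj closed by simp
    from someI_ex[OF this] that show ?thesis
      by (simp add: h_def)
  qed
  let ?d = "mpoly_der h"
  interpret d: derivation ?d
    by (rule derivation_mpoly_der)
  have D_0: "D (\<pi> 0) = \<pi> 0"
    using D_add[of "\<pi> 0" "\<pi> 0"] closed[of "\<pi> 0"] B.add.r_cancel_one'[of "D (\<pi> 0)" "D (\<pi> 0)"]
    by (simp add: pi_0)
  have D_1: "D (\<pi> 1) = \<pi> 0"
    using D_mult[of "\<pi> 1" "\<pi> 1"] closed[of "\<pi> 1"] B.add.r_cancel_one'[of "D (\<pi> 1)" "D (\<pi> 1)"]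
    by (simp add: pi_0 pi_1)
  have pi_d: "\<pi> (?d f) = D (\<pi> f)" for f
  proof (induction f rule: mpoly_induct)
    case (const c)
    have "D (\<pi> (mconst c)) = D (\<iota> c \<otimes>\<^bsub>B\<^esub> \<pi> 1)"
      by (simp flip: pi_mconst pi_mult)
    also have "\<dots> = \<pi> (mconst c * 0)"
      unfolding pi_mult pi_mconst using D_const[of "\<pi> 1" "\<pi> 1"] by (simp add: D_1)
    finally show ?case by simp
  next
    case (var v)
    show ?case
    proof (cases "v \<in> V")
      case False
      then have "\<pi> (mvar v) = \<pi> 0"
        using generators_subset by (auto simp: pi_eq_iff)
      with False show ?thesis
        by (simp add: D_0 h_def)
    qed (simp add: h)
  next
    case (add f g)
    then show ?case
      by (simp add: d.d_add pi_add D_add)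
  next
    case (mult f g)
    then show ?case
      by (simp add: d.d_mult pi_add pi_mult D_mult)
  qed
  interpret d: derivation_mod_ideal ?d J
  proof
    fix f assume "f \<in> J"
    then have "\<pi> f = \<pi> 0"
      by (simp add: pi_eq_iff)
    then have "\<pi> (?d f) = \<zero>\<^bsub>B\<^esub>"
      by (simp add: pi_d D_0) (simp add: pi_0)
    then show "?d f \<in> J"
      by (simp add: pi_eq_0_iff)
  qed
  have iter: "\<pi> ((?d ^^ j) f) = (D ^^ j) (\<pi> f)" for j f
    by (induction j) (auto simp: pi_d)
  have "lnd_mod_ideal ?d J"
  proof
    fix f
    show "\<exists>j. (?d ^^ j) f \<in> J"
      using nil[of "\<pi> f"] unfolding pi_eq_0_iff[symmetric] iter by auto
  qed
  moreover have "?d (mvar v) = 0" if "v \<notin> V" for v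
    using that by (simp add: h_def)
  moreover have "\<exists>v. ?d (mvar v) \<notin> J"
  proof (rule ccontr)
    assume "\<not> ?thesis"
    then have "?d f \<in> J" for f
      by (induction f rule: mpoly_induct)
         (auto simp: d.d_add d.d_mult simp del: mpoly_der_mvar intro: J.add_mem J.mult_mem J.mult_mem')
    then have "D (\<pi> f) = \<zero>\<^bsub>B\<^esub>" for f
      by (simp add: pi_eq_0_iff flip: pi_d)
    with x pi_surj show False by blast
  qed
  ultimately show ?thesis
    using that by blast
qed

lemma prime_ideal_J:
  assumes "domain B"
  shows "prime_ring_ideal J"
proof -
  interpret domain B by fact
  show ?thesis
  proof
    show "1 \<notin> J"
      using one_not_zero by (simp add: pi_1 flip: pi_eq_0_iff)
    show "a \<in> J \<or> b \<in> J" if "a * b \<in> J" for a b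
      using that integral[of "\<pi> a" "\<pi> b"] by (simp add: pi_mult flip: pi_eq_0_iff)
  qed
qed

text \<open>In a factorial domain irreducible elements are prime. Irreducibility is expressed
  through representatives, the form in which homogeneous factorizations can be applied to
  it.\<close>

lemma irreducible_imp_primem:
  assumes "factorial_domain B"
    and "p \<notin> J" "\<not> J.dvdm p 1"
    and irr: "\<And>a b. J.eqm p (a * b) \<Longrightarrow> J.dvdm a 1 \<or> J.dvdm b 1"
  shows "J.primem p"
proof -
  interpret factorial_domain B by fact
  have dvd: "\<pi> a divides\<^bsub>B\<^esub> \<pi> b \<longleftrightarrow> J.dvdm a b" for a b
  proof
    assume "\<pi> a divides\<^bsub>B\<^esub> \<pi> b"
    then obtain c where "\<pi> b = \<pi> (a * c)"
      using pi_surj by (auto simp: factor_def pi_mult)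
    then show "J.dvdm a b"
      by (auto simp: J.dvdm_def J.eqm_def pi_eq_iff)
  next
    assume "J.dvdm a b"
    then obtain c where "\<pi> b = \<pi> (a * c)"
      by (auto simp: J.dvdm_def J.eqm_def pi_eq_iff)
    then show "\<pi> a divides\<^bsub>B\<^esub> \<pi> b"
      by (auto simp: factor_def pi_mult)
  qed
  have unit: "\<pi> a \<in> Units B \<longleftrightarrow> J.dvdm a 1" for a
    using B.divides_one[of "\<pi> a"] by (simp add: dvd flip: pi_1)
  have p: "\<pi> p \<in> carrier B - {\<zero>\<^bsub>B\<^esub>}"
    using assms(2) by (simp add: pi_eq_0_iff)
  have "ring_irreducible\<^bsub>B\<^esub> (\<pi> p)"
  proof (rule ring_irreducibleI[OF p])
    show "\<pi> p \<notin> Units B"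
      using assms(3) unit by simp
    fix x y assume "x \<in> carrier B" "y \<in> carrier B" "\<pi> p = x \<otimes>\<^bsub>B\<^esub> y"
    then obtain a b where "x = \<pi> a" "y = \<pi> b" "\<pi> p = \<pi> (a * b)"
      using pi_surj by (metis pi_mult)
    with irr[of a b] show "x \<in> Units B \<or> y \<in> Units B"
      by (simp add: unit J.eqm_def pi_eq_iff)
  qed
  then have "Divisibility.irreducible (mult_of B) (\<pi> p)"
    by (intro ring_irreducibleE(3)) auto
  then have "Divisibility.prime (mult_of B) (\<pi> p)"
    using p assms(1) by (intro factorial_monoid.irreducible_prime) (auto simp: factorial_domain_def)
  then have "Divisibility.prime B (\<pi> p)"
    by (simp add: prime_eq_prime_mult)
  then have "J.dvdm p a \<or> J.dvdm p b" if "J.dvdm p (a * b)" for a b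
    using that by (simp add: Divisibility.prime_def pi_mult flip: dvd)
  with assms(2,3) show ?thesis
    by (simp add: J.primem_def)
qed

end

unbundle no fps_syntax

subsection \<open>Trinomial data\<close>

lemma independent_pair_det:
  fixes x y :: "'k::field ^ 2"
  assumes "x \<noteq> y" "vec.independent {x, y}"
  shows "x $ 1 * y $ 2 - x $ 2 * y $ 1 \<noteq> 0"
proof
  assume det: "x $ 1 * y $ 2 - x $ 2 * y $ 1 = 0"
  have zero: "s = 0 \<and> t = 0" if "s *s x + t *s y = 0" for s t
  proof -
    let ?u = "\<lambda>v. if v = x then s else t"
    have "(\<Sum>v\<in>{x, y}. ?u v *s v) = 0"
      using assms(1) that by simp
    then have "?u x = 0" "?u y = 0"
      using vec.independentD[OF assms(2), of "{x, y}" ?u] by blast+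
    then show ?thesis
      using assms(1) by simp
  qed
  have "y $ 2 *s x + (- (x $ 2)) *s y = 0" "y $ 1 *s x + (- (x $ 1)) *s y = 0"
    using det by (simp_all add: vec_eq_iff forall_2 algebra_simps)
  with zero have "y $ 2 = 0" "x $ 2 = 0" "y $ 1 = 0" "x $ 1 = 0"
    by fastforce+
  then have "x = y"
    by (simp add: vec_eq_iff forall_2)
  with assms(1) show False by simp
qed

definition mpoly_at :: "('v \<Rightarrow> 'k) \<Rightarrow> ('v, 'k::comm_ring_1) mpoly \<Rightarrow> 'k" where
  "mpoly_at x = mpoly_eval id x"

lemma ring_map_id: "ring_map id"
  by unfold_locales auto

lemma ring_map_mpoly_at: "ring_map (mpoly_at x)"
  unfolding mpoly_at_def by (rule ring_map.ring_map_mpoly_eval[OF ring_map_id])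

interpretation at: ring_map "mpoly_at x"
  by (rule ring_map_mpoly_at)

lemma mpoly_at_mvar [simp]: "mpoly_at x (mvar v) = x v"
  by (simp add: mpoly_at_def ring_map.mpoly_eval_mvar[OF ring_map_id])

lemma mpoly_at_mconst [simp]: "mpoly_at x (mconst c) = c"
  by (simp add: mpoly_at_def ring_map.mpoly_eval_mconst[OF ring_map_id])

lemma mpoly_at_mmonom: "mpoly_at x (mmonom e) = monom_eval x e"
  by (simp add: mpoly_at_def ring_map.mpoly_eval_mmonom[OF ring_map_id])

lemma (in ring_map) ring_ideal_kernel: "ring_ideal {f. \<kappa> f = 0}"
  by unfold_locales (auto simp: map_add map_mult)

locale trinomial =
  fixes r m :: nat and n :: "nat \<Rightarrow> nat" and l :: "nat \<Rightarrow> nat \<Rightarrow> nat"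
    and A :: "'k::{alg_closed_field, field_char_0} trinomial_coeffs"
  assumes data: "trinomial_data r n l A"
begin

abbreviation "V \<equiv> trinomial_vars r m n A"
abbreviation "q \<equiv> trinomial_q A"
abbreviation T :: "nat \<Rightarrow> nat \<Rightarrow> (trinomial_var, 'k) mpoly" where
  "T i j \<equiv> mvar (TVar i j)"
abbreviation F :: "nat \<Rightarrow> (trinomial_var, 'k) mpoly" where
  "F i \<equiv> trinomial_monom n l i"

sublocale mpoly_quotient V "trinomial_relations r n l A"
  by unfold_locales (rule trinomial_relations_subset)

notation J.eqm (infix "\<approx>" 50)

text \<open>Type 1 behaves like Type 2 with an additional column \<open>(1, 0)\<close> whose monomial is \<open>1\<close>.\<close>

definition \<alpha> :: "nat \<Rightarrow> 'k" where
  "\<alpha> i = (case A of Type1 a \<Rightarrow> - a i | Type2 M \<Rightarrow> M i $ 1)"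

definition \<beta> :: "nat \<Rightarrow> 'k" where
  "\<beta> i = (case A of Type1 a \<Rightarrow> 1 | Type2 M \<Rightarrow> M i $ 2)"

text \<open>The minors of the coefficient matrix; in Type 1 this is
  \<open>a j - a i\<close>.\<close>

definition \<Delta> :: "nat \<Rightarrow> nat \<Rightarrow> 'k" where
  "\<Delta> i j = \<alpha> i * \<beta> j - \<beta> i * \<alpha> j"

lemma q_cases: "q = (if is_Type1 A then 1 else 0)"
  by (cases A) auto

lemma type1_simps:
  assumes "A = Type1 a"
  shows "is_Type1 A" "q = 1" "\<alpha> i = - a i" "\<beta> i = 1"
  unfolding \<alpha>_def \<beta>_def unfolding assms by simp_all

lemma type2_simps:
  fixes M :: "nat \<Rightarrow> 'k ^ 2"
  assumes "A = Type2 M"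
  shows "\<not> is_Type1 A" "q = 0" "\<alpha> i = M i $ 1" "\<beta> i = M i $ 2"
  unfolding \<alpha>_def \<beta>_def unfolding assms by simp_all

lemma r_pos: "r > 0"
  using data by (simp add: trinomial_data_def)

lemma q_le_r: "q \<le> r"
  using r_pos by (simp add: q_cases)

lemma n_pos: "i \<in> {q..r} \<Longrightarrow> n i > 0"
  using data by (simp add: trinomial_data_def)

lemma l_pos: "i \<in> {q..r} \<Longrightarrow> j \<in> {1..n i} \<Longrightarrow> l i j > 0"
  using data by (simp add: trinomial_data_def)

lemma \<Delta>_nz: "i \<in> {q..r} \<Longrightarrow> j \<in> {q..r} \<Longrightarrow> i \<noteq> j \<Longrightarrow> \<Delta> i j \<noteq> 0"
proof (cases A)
  case (Type1 a)
  assume "i \<in> {q..r}" "j \<in> {q..r}" "i \<noteq> j"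
  then have "a i \<noteq> a j"
    using data by (simp add: Type1 trinomial_data_def)
  then show ?thesis
    by (simp add: \<Delta>_def type1_simps[OF Type1])
next
  case (Type2 M)
  assume "i \<in> {q..r}" "j \<in> {q..r}" "i \<noteq> j"
  then have "M i \<noteq> M j \<and> vec.independent {M i, M j}"
    using data by (simp add: Type2 trinomial_data_def)
  then show ?thesis
    using independent_pair_det[of "M i" "M j"] by (simp add: \<Delta>_def type2_simps[OF Type2])
qed

lemma column_nz: "i \<in> {q..r} \<Longrightarrow> \<alpha> i \<noteq> 0 \<or> \<beta> i \<noteq> 0"
proof (cases A)
  case (Type2 M)
  assume i: "i \<in> {q..r}"
  obtain k where "k \<in> {q..r}" "i \<noteq> k"
    using r_pos that[of "if i = 0 then 1 else 0"] by (auto simp: type2_simps(2)[OF Type2])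
  then have "\<alpha> i * \<beta> k - \<beta> i * \<alpha> k \<noteq> 0"
    using \<Delta>_nz[OF i] unfolding \<Delta>_def by blast
  then show ?thesis by fastforce
next
  case (Type1 a)
  show ?thesis
    by (simp add: type1_simps(4)[OF Type1])
qed

lemma TVar_in_V: "TVar i j \<in> V \<longleftrightarrow> i \<in> {q..r} \<and> j \<in> {1..n i}"
  by (auto simp: trinomial_vars_def)

lemma SVar_in_V: "SVar k \<in> V \<longleftrightarrow> k \<in> {1..m}"
  by (auto simp: trinomial_vars_def)

lemma finite_V: "finite V"
proof -
  have "{TVar i j | i j. i \<in> {q..r} \<and> j \<in> {1..n i}} = (\<lambda>(i, j). TVar i j) ` (SIGMA i:{q..r}. {1..n i})"
    by auto
  then show ?thesis
    by (simp add: trinomial_vars_def)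
qed

lemma V_cases:
  assumes "v \<in> V"
  obtains (TVar) i j where "v = TVar i j" "i \<in> {q..r}" "j \<in> {1..n i}" | (SVar) k where "v = SVar k" "k \<in> {1..m}"
  using assms by (auto simp: trinomial_vars_def)

lemma is_quotient:
  "trinomial_algebra r m n l A = B" "trinomial_const r m n l A = (\<lambda>c. \<iota> c)"
  by (auto simp: trinomial_algebra_def trinomial_const_def trinomial_ideal_def)

section \<open>The relations as linear dependences between the monomials\<close>

definition three_term :: "nat \<Rightarrow> (trinomial_var, 'k) mpoly" where
  "three_term i = mconst (\<Delta> (i + 1) (i + 2)) * F i - mconst (\<Delta> i (i + 2)) * F (i + 1)
     + mconst (\<Delta> i (i + 1)) * F (i + 2)"

text \<open>Cofactor expansion of the determinant along its first row.\<close>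

lemma relations_type2:
  assumes "A = Type2 M"
  shows "trinomial_relations r n l A = three_term ` {i. i + 2 \<le> r}"
proof -
  let ?det = "\<lambda>i. det (vector [
     vector [F i, F (i + 1), F (i + 2)],
     vector [mconst (M i $ 1), mconst (M (i + 1) $ 1), mconst (M (i + 2) $ 1)],
     vector [mconst (M i $ 2), mconst (M (i + 1) $ 2), mconst (M (i + 2) $ 2)]]
     :: ((trinomial_var, 'k) mpoly) ^ 3 ^ 3)"
  have "trinomial_relations r n l A = {?det i | i. i + 2 \<le> r}"
    by (simp add: assms)
  moreover have "?det i = three_term i" for i
    unfolding det_3 three_term_def
    by (simp add: \<Delta>_def type2_simps[OF assms] mconst.map_diff mconst.map_mult algebra_simps)
  ultimately show ?thesis by auto
qed

text \<open>The columns of the coefficient matrix satisfy the three-term identity, hence so do the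
  values of any linear form on them; in Type 1 the terms with \<open>X2\<close> cancel. Applied to
  evaluations, this produces points of the variety.\<close>

lemma map_relations:
  assumes "ring_map \<psi>" "g \<in> trinomial_relations r n l A"
    and eq: "\<And>i. i \<in> {q..r} \<Longrightarrow> \<psi> (F i) = \<psi> (mconst (\<alpha> i)) * X1 + \<psi> (mconst (\<beta> i)) * X2"
    and 1: "is_Type1 A \<Longrightarrow> X1 = 1"
  shows "\<psi> g = 0"
proof -
  interpret ring_map \<psi> by fact
  show ?thesis
  proof (cases A)
    case (Type1 a)
    with assms(2) obtain i where i: "1 \<le> i" "i + 1 \<le> r" and g: "g = F i - F (i + 1) - mconst (a (i + 1) - a i)"
      by auto
    have "\<psi> g = \<psi> (F i) - \<psi> (F (i + 1)) - \<psi> (mconst (a (i + 1) - a i))"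
      unfolding g by (simp add: map_diff)
    also have "\<dots> = 0"
      using i 1 by (simp add: eq type1_simps[OF Type1] mconst.map_diff mconst.map_minus map_diff map_minus)
    finally show ?thesis .
  next
    case (Type2 M)
    with assms(2) obtain i where i: "i + 2 \<le> r" and g: "g = three_term i"
      using relations_type2 by auto
    have "\<psi> g = \<psi> (mconst (\<Delta> (i + 1) (i + 2))) * \<psi> (F i) - \<psi> (mconst (\<Delta> i (i + 2))) * \<psi> (F (i + 1))
        + \<psi> (mconst (\<Delta> i (i + 1))) * \<psi> (F (i + 2))"
      by (simp add: g three_term_def map_diff map_add map_mult)
    also have "\<dots> = 0"
      using i by (simp add: eq type2_simps(2)[OF Type2] \<Delta>_def mconst.map_diff mconst.map_mult
          map_diff map_mult algebra_simps)
    finally show ?thesis .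
  qed
qed

lemma mconst_cancel: "c \<noteq> 0 \<Longrightarrow> mconst c * f \<in> J \<Longrightarrow> f \<in> J"
  using J.mult_mem[of "mconst c * f" "mconst (inverse c)"]
  by (simp add: mult.assoc[symmetric] flip: mconst.map_mult)

text \<open>The relations confine the vector of all \<open>F i\<close> to the span of the two rows
  of coefficients; \<open>X1\<close> and \<open>X2\<close> are its coordinates there.\<close>

lemma F_linear:
  obtains X1 X2 where "is_Type1 A \<Longrightarrow> X1 = 1"
    "\<And>i. i \<in> {q..r} \<Longrightarrow> F i \<approx> mconst (\<alpha> i) * X1 + mconst (\<beta> i) * X2"
proof (cases A)
  case (Type1 a)
  let ?X2 = "F 1 + mconst (a 1)"
  have "F i \<approx> mconst (- a i) + ?X2" if "i \<ge> 1" "i \<le> r" for i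
    using that
  proof (induction i rule: dec_induct)
    case base
    show ?case by (simp add: mconst.map_minus)
  next
    case (step i)
    have "F i - F (i + 1) - mconst (a (i + 1) - a i) \<in> trinomial_relations r n l A"
      using step by (auto simp: Type1)
    then have "F i - F (i + 1) - mconst (a (i + 1) - a i) \<in> J"
      using generators_subset by blast
    moreover have "F i - (mconst (- a i) + ?X2) \<in> J"
      using step by (simp add: J.eqm_def)
    ultimately show ?case
      using J.diff_mem[of "F i - (mconst (- a i) + ?X2)" "F i - F (i + 1) - mconst (a (i + 1) - a i)"]
      by (simp add: J.eqm_def mconst.map_diff mconst.map_minus algebra_simps)
  qed
  then show ?thesis
    by (intro that[of 1 ?X2]) (auto simp: type1_simps[OF Type1])
next
  case (Type2 M)
  have D: "\<Delta> 0 1 \<noteq> 0"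
    using r_pos by (intro \<Delta>_nz) (auto simp: type2_simps[OF Type2])
  \<comment> \<open>Cramer's rule for the columns \<open>0\<close> and \<open>1\<close>. The
    recursion below solves each three-term relation for its last monomial, as
    \<open>\<Delta> i (i + 1)\<close> is nonzero.\<close>
  define X1 where "X1 = mconst (\<beta> 1 / \<Delta> 0 1) * F 0 - mconst (\<beta> 0 / \<Delta> 0 1) * F 1"
  define X2 where "X2 = mconst (\<alpha> 0 / \<Delta> 0 1) * F 1 - mconst (\<alpha> 1 / \<Delta> 0 1) * F 0"
  define lin where "lin i = mconst (\<alpha> i) * X1 + mconst (\<beta> i) * X2" for i
  have lin_01: "lin i = mconst (\<Delta> i 1 / \<Delta> 0 1) * F 0 + mconst (\<Delta> 0 i / \<Delta> 0 1) * F 1" for i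
    by (simp add: lin_def X1_def X2_def \<Delta>_def mconst.map_diff mconst.map_mult diff_divide_distrib
        algebra_simps divide_inverse)
  have "\<Delta> 1 1 = 0" "\<Delta> 0 0 = 0"
    by (simp_all add: \<Delta>_def)
  with D have "lin 0 = F 0" "lin 1 = F 1"
    by (simp_all add: lin_01)
  have rec: "F (i + 2) \<approx> lin (i + 2)" if "F i \<approx> lin i" "F (i + 1) \<approx> lin (i + 1)" "i + 2 \<le> r" for i
  proof -
    let ?g = "three_term i"
    have "?g \<in> J"
      using generators_subset that(3) relations_type2[OF Type2] by blast
    moreover have "mconst (\<Delta> (i + 1) (i + 2)) * (F i - lin i) \<in> J" "mconst (\<Delta> i (i + 2)) * (F (i + 1) - lin (i + 1)) \<in> J"
      using that by (auto simp: J.eqm_def intro: J.mult_mem)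
    ultimately have "?g - mconst (\<Delta> (i + 1) (i + 2)) * (F i - lin i) + mconst (\<Delta> i (i + 2)) * (F (i + 1) - lin (i + 1)) \<in> J"
      using J.add_mem[OF J.diff_mem] by blast
    also have "?g - mconst (\<Delta> (i + 1) (i + 2)) * (F i - lin i) + mconst (\<Delta> i (i + 2)) * (F (i + 1) - lin (i + 1)) =
        mconst (\<Delta> i (i + 1)) * (F (i + 2) - lin (i + 2))"
      by (simp add: three_term_def lin_def \<Delta>_def mconst.map_diff mconst.map_mult algebra_simps)
    finally show ?thesis
      unfolding J.eqm_def by (rule mconst_cancel[rotated]) (use that(3) in \<open>intro \<Delta>_nz, auto simp: type2_simps[OF Type2]\<close>)
  qed
  have "F i \<approx> lin i \<and> (i + 1 \<le> r \<longrightarrow> F (i + 1) \<approx> lin (i + 1))" if "i \<le> r" for i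
    using that
  proof (induction i)
    case 0
    show ?case
      using \<open>lin 0 = F 0\<close> \<open>lin 1 = F 1\<close> by simp
  next
    case (Suc i)
    then show ?case
      using rec[of i] by simp
  qed
  then show ?thesis
    by (intro that[of X1 X2]) (auto simp: type2_simps[OF Type2] lin_def)
qed

subsection \<open>Points of the variety\<close>

definition point :: "(trinomial_var \<Rightarrow> 'k) \<Rightarrow> bool" where
  "point x \<longleftrightarrow> (\<forall>f\<in>J. mpoly_at x f = 0)"

lemma at_F: "mpoly_at x (F i) = (\<Prod>j=1..n i. x (TVar i j) ^ l i j)"
  by (simp add: trinomial_monom_def at.map_prod at.map_power)

lemma pointI:
  assumes "\<And>v. v \<notin> V \<Longrightarrow> x v = 0"
    and "\<And>i. i \<in> {q..r} \<Longrightarrow> mpoly_at x (F i) = \<alpha> i * X1 + \<beta> i * X2"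
    and "is_Type1 A \<Longrightarrow> X1 = 1"
  shows "point x"
proof -
  have "mpoly_at x g = 0" if "g \<in> trinomial_relations r n l A" for g
    by (rule map_relations[OF at.ring_map_axioms that, where ?X1.0 = X1 and ?X2.0 = X2]) (use assms in auto)
  then have "J \<subseteq> {f. mpoly_at x f = 0}"
    using assms(1) by (intro J_minimal[OF at.ring_ideal_kernel]) auto
  then show ?thesis
    by (auto simp: point_def)
qed

text \<open>Every block has to take a prescribed value: one chosen variable of the block carries a
  root of it, and the other variables are \<open>1\<close>.\<close>

lemma point_exists:
  assumes "is_Type1 A \<Longrightarrow> X1 = 1" and "\<And>i. i \<in> {q..r} \<Longrightarrow> j i \<in> {1..n i}"
  obtains x where "point x" "\<And>v. v \<notin> V \<Longrightarrow> x v = 0"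
    "\<And>i. i \<in> {q..r} \<Longrightarrow> mpoly_at x (F i) = \<alpha> i * X1 + \<beta> i * X2"
    "\<And>i. i \<in> {q..r} \<Longrightarrow> x (TVar i (j i)) = 0 \<longleftrightarrow> \<alpha> i * X1 + \<beta> i * X2 = 0"
    "\<And>i k. i \<in> {q..r} \<Longrightarrow> k \<in> {1..n i} \<Longrightarrow> k \<noteq> j i \<Longrightarrow> x (TVar i k) = 1"
    "\<And>k. k \<in> {1..m} \<Longrightarrow> x (SVar k) = 1"
proof -
  have "\<exists>y. y ^ l i (j i) = \<alpha> i * X1 + \<beta> i * X2" if "i \<in> {q..r}" for i
    by (intro nth_root_exists l_pos assms that)
  then obtain y where y: "\<And>i. i \<in> {q..r} \<Longrightarrow> y i ^ l i (j i) = \<alpha> i * X1 + \<beta> i * X2"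
    by metis
  define x where "x v = (if v \<in> V then case v of TVar i k \<Rightarrow> if k = j i then y i else 1 | SVar k \<Rightarrow> 1 else 0)" for v
  have xT: "x (TVar i k) = (if k = j i then y i else 1)" if "i \<in> {q..r}" "k \<in> {1..n i}" for i k
    using that by (simp add: x_def TVar_in_V)
  have F: "mpoly_at x (F i) = \<alpha> i * X1 + \<beta> i * X2" if "i \<in> {q..r}" for i
  proof -
    have "mpoly_at x (F i) = (\<Prod>k=1..n i. if k = j i then y i ^ l i (j i) else 1)"
      unfolding at_F using that by (intro prod.cong) (auto simp: xT)
    also have "\<dots> = y i ^ l i (j i)"
      using assms(2)[OF that] by simp
    finally show ?thesis
      using y that by simp
  qed
  have out: "x v = 0" if "v \<notin> V" for v
    using that by (simp add: x_def)
  show ?thesis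
  proof (rule that[of x])
    show "point x"
      by (rule pointI[OF out F assms(1)])
    show "x (TVar i (j i)) = 0 \<longleftrightarrow> \<alpha> i * X1 + \<beta> i * X2 = 0" if "i \<in> {q..r}" for i
      using assms(2)[OF that] y[OF that] l_pos[OF that assms(2)[OF that]] that
      by (metis xT power_eq_0_iff)
  qed (use out F in \<open>auto simp: xT\<close>, simp add: x_def SVar_in_V)
qed

lemma generic_parameter:
  "\<exists>t. \<forall>i\<in>{q..r}. \<alpha> i * 1 + \<beta> i * t \<noteq> 0"
proof -
  \<comment> \<open>For \<open>\<beta> i = 0\<close> the quotient is \<open>0\<close> by convention,
    which merely excludes one more value of \<open>t\<close>.\<close>
  have "\<exists>t. t \<notin> (\<lambda>i. - \<alpha> i / \<beta> i) ` {q..r}"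
    by (rule ex_new_if_finite[OF infinite_UNIV_char_0]) auto
  then obtain t where t: "t \<notin> (\<lambda>i. - \<alpha> i / \<beta> i) ` {q..r}" by blast
  have "\<alpha> i + \<beta> i * t \<noteq> 0" if "i \<in> {q..r}" for i
  proof (cases "\<beta> i = 0")
    case False
    show ?thesis
    proof
      assume "\<alpha> i + \<beta> i * t = 0"
      with False have "t = - \<alpha> i / \<beta> i"
        by (simp add: field_simps eq_neg_iff_add_eq_0)
      with t that show False by blast
    qed
  qed (use column_nz[OF that] in auto)
  then show ?thesis
    by (intro exI[of _ t]) simp
qed

lemma generic_point:
  obtains x where "point x" "\<And>v. v \<in> V \<Longrightarrow> x v \<noteq> 0"
proof -
  obtain t where t: "\<forall>i\<in>{q..r}. \<alpha> i * 1 + \<beta> i * t \<noteq> 0"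
    using generic_parameter by blast
  have 1: "1 \<in> {1..n i}" if "i \<in> {q..r}" for i
    using n_pos[OF that] by auto
  obtain x where x: "point x"
    "\<And>i. i \<in> {q..r} \<Longrightarrow> x (TVar i 1) = 0 \<longleftrightarrow> \<alpha> i * 1 + \<beta> i * t = 0"
    "\<And>i k. i \<in> {q..r} \<Longrightarrow> k \<in> {1..n i} \<Longrightarrow> k \<noteq> 1 \<Longrightarrow> x (TVar i k) = 1"
    "\<And>k. k \<in> {1..m} \<Longrightarrow> x (SVar k) = 1"
    using point_exists[of 1 "\<lambda>_. 1" t] 1 by metis
  have "x v \<noteq> 0" if "v \<in> V" for v
    using that
  proof (cases rule: V_cases)
    case (TVar i j)
    then show ?thesis
      using x(2,3)[of i] t by (cases "j = 1") auto
  qed (simp add: x(4))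
  with x(1) that show ?thesis by blast
qed

lemma mconst_in_J_iff: "mconst c \<in> J \<longleftrightarrow> c = 0"
proof
  assume "mconst c \<in> J"
  obtain x where "point x" by (rule generic_point)
  with \<open>mconst c \<in> J\<close> have "mpoly_at x (mconst c) = 0"
    by (auto simp: point_def simp del: mpoly_at_mconst)
  then show "c = 0" by simp
qed auto

subsection \<open>Triangular derivations\<close>

text \<open>The three-term identity again, now for derivatives: those of the \<open>F i\<close> are
  the values of one linear form on the columns, times a common \<open>P\<close>. In Type 1 the
  coordinate \<open>u1\<close> belongs to the constant \<open>1\<close>, whose derivative is
  zero.\<close>

lemma derivation_mod_J:
  assumes "derivation d" "\<And>v. v \<notin> V \<Longrightarrow> d (mvar v) = 0"
    and "\<And>i. i \<in> {q..r} \<Longrightarrow> d (F i) = mconst (\<alpha> i * u1 + \<beta> i * u2) * P"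
    and "is_Type1 A \<Longrightarrow> u1 = 0"
  shows "derivation_mod_ideal d J"
proof -
  interpret d: derivation d by fact
  have rel: "d g = 0" if "g \<in> trinomial_relations r n l A" for g
  proof (cases A)
    case (Type1 a)
    with that obtain i where i: "1 \<le> i" "i + 1 \<le> r" and g: "g = F i - F (i + 1) - mconst (a (i + 1) - a i)"
      by auto
    show ?thesis
      unfolding g using i assms(3)[of i] assms(3)[of "i + 1"] assms(4)
      by (simp add: d.d_diff type1_simps[OF Type1])
  next
    case (Type2 M)
    with that obtain i where i: "i + 2 \<le> r" and g: "g = three_term i"
      using relations_type2 by auto
    have "d g = mconst (\<Delta> (i + 1) (i + 2)) * d (F i) - mconst (\<Delta> i (i + 2)) * d (F (i + 1))
        + mconst (\<Delta> i (i + 1)) * d (F (i + 2))"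
      by (simp add: g three_term_def d.d_diff d.d_add d.d_mconst_mult)
    also have "\<dots> = 0"
      using i by (simp add: assms(3) type2_simps(2)[OF Type2] \<Delta>_def mconst.map_add mconst.map_diff
          mconst.map_mult algebra_simps)
    finally show ?thesis .
  qed
  \<comment> \<open>The set of all \<open>f\<close> with \<open>d f \<in> J\<close> need not be an
    ideal; by the product rule, closure under multiples also uses \<open>f \<in> J\<close>.\<close>
  have "ring_ideal {f. f \<in> J \<and> d f \<in> J}"
    by unfold_locales (auto simp: d.d_add d.d_mult intro: J.add_mem J.mult_mem J.mult_mem')
  then have "J \<subseteq> {f. f \<in> J \<and> d f \<in> J}"
    by (rule J_minimal) (use generators_subset rel assms(2) in auto)
  then show ?thesis
    by unfold_locales auto
qed

lemma not_rigid_if_S: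
  assumes "m \<noteq> 0"
  shows "\<not> rigid_algebra B \<iota>"
proof -
  define d where "d = mpoly_der (\<lambda>v. if v = SVar 1 then 1 else 0 :: (trinomial_var, 'k) mpoly)"
  interpret d: derivation d
    unfolding d_def by (rule derivation_mpoly_der)
  have d_mvar: "d (mvar v) = (if v = SVar 1 then 1 else 0)" for v
    by (simp add: d_def)
  have "d (\<Prod>j\<in>I. T i j ^ l i j) = 0" for i I
    by (induction I rule: infinite_finite_induct) (auto simp: d.d_mult d.d_power d_mvar)
  then have "d (F i) = mconst (\<alpha> i * 0 + \<beta> i * 0) * 0" for i
    by (simp add: trinomial_monom_def)
  then interpret d: derivation_mod_ideal d J
    using assms by (intro derivation_mod_J[of d 0 0 0] d.derivation_axioms) (auto simp: d_mvar SVar_in_V)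
  have "lnd_mod_ideal d J"
  proof
    fix f
    show "\<exists>j. (d ^^ j) f \<in> J"
    proof (rule d.nilpotent_if_nilpotent_mvar)
      fix v
      show "\<exists>j. (d ^^ j) (mvar v) \<in> J"
        by (rule exI[of _ "Suc (Suc 0)"]) (simp add: d_mvar)
    qed
  qed
  moreover have "d (mvar (SVar 1)) \<notin> J"
    using mconst_in_J_iff[of 1] by (simp add: d_mvar)
  ultimately show ?thesis
    by (rule not_rigidI)
qed

text \<open>All variables except one in each block \<open>i \<in> S\<close> are constant; the derivatives of the
  monomials \<open>F i\<close> are then prescribed multiples of a common polynomial.\<close>

lemma not_rigid_if_linear:
  assumes S: "S \<subseteq> {q..r}" "c \<in> S"
    and j: "\<And>i. i \<in> S \<Longrightarrow> j i \<in> {1..n i}" "\<And>i. i \<in> S - {c} \<Longrightarrow> l i (j i) = 1"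
    and u1: "is_Type1 A \<Longrightarrow> u1 = 0"
    and nz: "\<alpha> c * u1 + \<beta> c * u2 \<noteq> 0" and zero: "\<And>i. i \<in> {q..r} - S \<Longrightarrow> \<alpha> i * u1 + \<beta> i * u2 = 0"
  shows "\<not> rigid_algebra B \<iota>"
proof -
  have fin: "finite S"
    using S finite_subset by blast
  define rest where "rest i = (\<Prod>k\<in>{1..n i} - {j i}. T i k ^ l i k)" for i
  define E where "E i = of_nat (l i (j i)) * T i (j i) ^ (l i (j i) - 1) * rest i" for i
  define \<kappa> where "\<kappa> i = \<alpha> i * u1 + \<beta> i * u2" for i
  \<comment> \<open>\<open>E i\<close> is the partial derivative of \<open>F i\<close> by its
    distinguished variable. Supplying the \<open>E i'\<close> of all other blocks gives each
    \<open>F i\<close> with \<open>i \<in> S\<close> the derivative \<open>\<kappa> i\<close> times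
    one and the same product.\<close>
  define h where "h v = (case v of SVar _ \<Rightarrow> 0 | TVar i k \<Rightarrow>
      if i \<in> S \<and> k = j i then mconst (\<kappa> i) * (\<Prod>i'\<in>S - {i}. E i') else 0)" for v
  define d where "d = mpoly_der h"
  interpret d: derivation d
    unfolding d_def by (rule derivation_mpoly_der)
  have d_T: "d (T i k) = (if i \<in> S \<and> k = j i then mconst (\<kappa> i) * (\<Prod>i'\<in>S - {i}. E i') else 0)" for i k
    by (simp add: d_def h_def)
  have d_const: "d (\<Prod>k\<in>K. T i k ^ l i k) = 0" if "i \<notin> S \<or> j i \<notin> K" for i K
    using that by (induction K rule: infinite_finite_induct) (auto simp: d.d_mult d.d_power d_T)
  have F: "F i = T i (j i) ^ l i (j i) * rest i" if "i \<in> S" for i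
    unfolding trinomial_monom_def rest_def using j(1)[OF that] by (intro prod.remove) auto
  have d_F: "d (F i) = mconst (\<kappa> i) * (\<Prod>i'\<in>S. E i')" if i: "i \<in> {q..r}" for i
  proof (cases "i \<in> S")
    case True
    have "d (rest i) = 0"
      unfolding rest_def by (rule d_const) simp
    then have "d (F i) = E i * d (T i (j i))"
      using True by (simp add: F d.d_mult d.d_power E_def mult_ac)
    also have "\<dots> = mconst (\<kappa> i) * (\<Prod>i'\<in>S. E i')"
      using True fin by (simp add: d_T prod.remove[of S i] mult_ac)
    finally show ?thesis .
  next
    case False
    then show ?thesis
      using d_const[of i] zero[of i] i by (simp add: trinomial_monom_def \<kappa>_def)
  qed
  interpret d: derivation_mod_ideal d J
  proof (rule derivation_mod_J[of d u1 u2])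
    show "d (mvar v) = 0" if "v \<notin> V" for v
      using that S j(1) by (auto simp: d_def h_def TVar_in_V split: trinomial_var.splits)
    show "d (F i) = mconst (\<alpha> i * u1 + \<beta> i * u2) * (\<Prod>i'\<in>S. E i')" if "i \<in> {q..r}" for i
      using d_F[OF that] by (simp add: \<kappa>_def)
  qed (use u1 d.derivation_axioms in auto)
  have d_E: "d (E i) = 0" if "i \<in> S - {c}" for i
  proof -
    have "E i = rest i"
      using j(2)[OF that] by (simp add: E_def)
    moreover have "d (rest i) = 0"
      unfolding rest_def by (rule d_const) simp
    ultimately show ?thesis by simp
  qed
  have d_prod_E: "d (\<Prod>i\<in>S - {c}. E i) = 0"
  proof -
    have "d (\<Prod>i\<in>S'. E i) = 0" if "S' \<subseteq> S - {c}" for S'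
      using that by (induction S' rule: infinite_finite_induct) (auto simp: d.d_mult d_E)
    then show ?thesis by simp
  qed
  have nil_const: "\<exists>k. (d ^^ k) f \<in> J" if "d f = 0" for f
    by (rule exI[of _ 1]) (simp add: that)
  \<comment> \<open>Only in block \<open>c\<close> may the distinguished exponent exceed
    \<open>1\<close>. The derivative of its variable involves just the other \<open>E i\<close>,
    which are constants, so two steps kill it; \<open>E c\<close> and then the remaining variables
    follow.\<close>
  have nil_c: "\<exists>k'. (d ^^ k') (T c k) \<in> J" for k
  proof (rule exI[of _ "Suc (Suc 0)"])
    show "(d ^^ Suc (Suc 0)) (T c k) \<in> J"
      by (simp add: d_T d.d_mult d_prod_E)
  qed
  have nil_E: "\<exists>k. (d ^^ k) (E i) \<in> J" if "i \<in> S" for i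
  proof (cases "i = c")
    case True
    have "\<exists>k. (d ^^ k) (of_nat (l i (j i))) \<in> J"
      by (rule nil_const) simp
    then show ?thesis
      unfolding E_def rest_def True
      by (intro d.nilpotent_mult d.nilpotent_power d.nilpotent_prod nil_c)
  next
    case False
    then show ?thesis
      using that by (intro nil_const d_E) auto
  qed
  have "lnd_mod_ideal d J"
  proof
    fix f
    show "\<exists>k. (d ^^ k) f \<in> J"
    proof (rule d.nilpotent_if_nilpotent_mvar)
      fix v
      have "\<exists>k. (d ^^ k) (d (mvar v)) \<in> J"
      proof (cases "\<exists>i\<in>S. v = TVar i (j i)")
        case True
        then obtain i where i: "i \<in> S" "v = TVar i (j i)" by blast
        then have "d (mvar v) = mconst (\<kappa> i) * (\<Prod>i'\<in>S - {i}. E i')"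
          by (simp add: d_T)
        then show ?thesis
          by (simp only:) (intro d.nilpotent_mult d.nilpotent_mconst d.nilpotent_prod nil_E, auto)
      next
        case False
        then have "d (mvar v) = 0"
          by (auto simp: d_def h_def split: trinomial_var.splits)
        then show ?thesis
          by (intro exI[of _ 0]) simp
      qed
      then obtain k where "(d ^^ k) (d (mvar v)) \<in> J" ..
      then show "\<exists>k. (d ^^ k) (mvar v) \<in> J"
        by (intro exI[of _ "Suc k"]) (simp add: funpow_swap1)
    qed
  qed
  moreover have "d (T c (j c)) \<notin> J"
  proof
    assume *: "d (T c (j c)) \<in> J"
    obtain x where x: "point x" "\<And>v. v \<in> V \<Longrightarrow> x v \<noteq> 0"
      using generic_point by blast
    have xT: "x (TVar i k) \<noteq> 0" if "i \<in> S" "k \<in> {1..n i}" for i k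
      using that S by (intro x) (auto simp: TVar_in_V)
    have "mpoly_at x (d (T c (j c))) = \<kappa> c * (\<Prod>i\<in>S - {c}. mpoly_at x (E i))"
      using S by (simp add: d_T at.map_mult at.map_prod)
    moreover have "mpoly_at x (E i) \<noteq> 0" if "i \<in> S - {c}" for i
      using that j[of i] xT[of i]
      by (auto simp: E_def rest_def at.map_mult at.map_prod at.map_power at.map_of_nat)
    ultimately have "mpoly_at x (d (T c (j c))) \<noteq> 0"
      using nz fin by (simp add: \<kappa>_def)
    with * x(1) show False
      by (simp add: point_def)
  qed
  ultimately show ?thesis
    by (rule not_rigidI)
qed

text \<open>The differences of the \<open>F i\<close> are constants, so all \<open>F i\<close> are
  given the same derivative, by the vector \<open>(0, 1)\<close>; \<open>b\<close> is the one block
  whose exponents are arbitrary.\<close>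

lemma not_rigid_type1:
  assumes "is_Type1 A" "b \<in> {1..r}" "\<forall>i\<in>{1..r} - {b}. \<exists>j\<in>{1..n i}. l i j = 1"
  shows "\<not> rigid_algebra B \<iota>"
proof -
  have q: "q = 1"
    using assms(1) by (simp add: q_cases)
  have "\<exists>j. j \<in> {1..n i} \<and> (i \<noteq> b \<longrightarrow> l i j = 1)" if "i \<in> {1..r}" for i
  proof (cases "i = b")
    case True
    then show ?thesis
      using that n_pos[of i] by (intro exI[of _ 1]) (auto simp: q)
  qed (use assms(3) that in blast)
  then obtain j where "\<And>i. i \<in> {1..r} \<Longrightarrow> j i \<in> {1..n i} \<and> (i \<noteq> b \<longrightarrow> l i (j i) = 1)"
    by metis
  moreover have "\<beta> b = 1"
    using assms(1) by (auto simp: \<beta>_def split: trinomial_coeffs.splits)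
  ultimately show ?thesis
    using assms by (intro not_rigid_if_linear[of "{1..r}" b j 0 1]) (auto simp: q)
qed

text \<open>The vector \<open>(\<beta> b, - \<alpha> b)\<close> annihilates column \<open>b\<close>,
  so \<open>F b\<close> stays constant and block \<open>b\<close> can be left out; \<open>c\<close>
  is the one remaining block with arbitrary exponents.\<close>

lemma not_rigid_type2:
  assumes "is_Type2 A" "b \<in> {0..r}" "c \<in> {0..r}" "\<forall>i\<in>{0..r} - {b, c}. \<exists>j\<in>{1..n i}. l i j = 1"
  shows "\<not> rigid_algebra B \<iota>"
proof -
  have q: "q = 0" "\<not> is_Type1 A"
    using assms(1) by (cases A; simp)+
  obtain c' where c': "c' \<in> {0..r}" "c' \<noteq> b" "\<forall>i\<in>{0..r} - {b, c'}. \<exists>j\<in>{1..n i}. l i j = 1"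
  proof (cases "c = b")
    case True
    have "(if b = 0 then 1 else 0) \<in> {0..r}" "(if b = 0 then 1 else 0) \<noteq> b"
      using r_pos by auto
    with that assms(4) True show ?thesis by blast
  qed (use that assms in blast)
  have "\<exists>j. j \<in> {1..n i} \<and> (i \<noteq> c' \<longrightarrow> l i j = 1)" if "i \<in> {0..r} - {b}" for i
  proof (cases "i = c'")
    case True
    then show ?thesis
      using that n_pos[of i] by (intro exI[of _ 1]) (auto simp: q)
  qed (use c'(3) that in blast)
  then obtain j where j: "\<And>i. i \<in> {0..r} - {b} \<Longrightarrow> j i \<in> {1..n i} \<and> (i \<noteq> c' \<longrightarrow> l i (j i) = 1)"
    by metis
  have "\<alpha> c' * \<beta> b + \<beta> c' * (- \<alpha> b) \<noteq> 0"
    using \<Delta>_nz[of c' b] c' assms(2) by (simp add: \<Delta>_def q)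
  then show ?thesis
    using c' assms(2) j q by (intro not_rigid_if_linear[of "{0..r} - {b}" c' j "\<beta> b" "- \<alpha> b"]) auto
qed

end

subsection \<open>Roots of unity and independence of characters\<close>

text \<open>A zero of the sum of all \<open>y ^ k\<close> with \<open>k < N\<close>; it is not
  \<open>1\<close>, where the value is \<open>N\<close>, nonzero in characteristic zero.\<close>

lemma nontrivial_root_of_unity:
  assumes "N \<ge> 2"
  shows "\<exists>y :: 'k::{alg_closed_field, field_char_0}. y ^ N = 1 \<and> y \<noteq> 1"
proof -
  define M where "M = N - 2"
  with assms have N: "N = Suc (Suc M)" by simp
  have "\<exists>y::'k. (\<Sum>k\<le>Suc M. 1 * y ^ k) = 0"
    by (rule alg_closed) auto
  then obtain y :: 'k where y: "(\<Sum>k<N. y ^ k) = 0"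
    by (auto simp: N lessThan_Suc_atMost)
  have "y \<noteq> 1"
  proof
    assume "y = 1"
    with y have "of_nat N = (0 :: 'k)" by simp
    with assms show False by simp
  qed
  moreover have "y ^ N = 1"
    using y power_diff_1_eq[of y N] by simp
  ultimately show ?thesis by blast
qed

text \<open>By Bezout every \<open>l\<close>-th root of unity is also a \<open>g\<close>-th one for
  \<open>g = gcd l k\<close>. If \<open>l div g\<close> were at least \<open>2\<close>, a
  \<open>g\<close>-th root of a nontrivial \<open>(l div g)\<close>-th root of unity would
  contradict this.\<close>

lemma dvd_if_roots_of_unity:
  assumes "l > 0" "\<And>z :: 'k::{alg_closed_field, field_char_0}. z ^ l = 1 \<Longrightarrow> z ^ k = 1"
  shows "l dvd k"
proof (cases "k = 0")
  case False
  define g where "g = gcd l k"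
  have "g > 0"
    using assms(1) by (simp add: g_def)
  obtain u v where uv: "l * u = k * v + g"
    using bezout_nat[of l k] assms(1) by (auto simp: g_def)
  have g: "z ^ g = 1" if "z ^ l = 1" for z :: 'k
  proof -
    have "z ^ (l * u) = z ^ (k * v) * z ^ g"
      unfolding uv by (simp add: power_add)
    then show ?thesis
      using that assms(2)[OF that] by (simp add: power_mult)
  qed
  obtain N where N: "l = g * N"
    using gcd_dvd1[of l k] unfolding g_def by (rule dvdE)
  have "\<not> N \<ge> 2"
  proof
    assume "N \<ge> 2"
    then obtain y :: 'k where y: "y ^ N = 1" "y \<noteq> 1"
      using nontrivial_root_of_unity by blast
    obtain z where z: "z ^ g = y"
      using nth_root_exists[OF \<open>g > 0\<close>] by blast
    then have "z ^ l = 1"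
      using y by (simp add: N power_mult)
    with g z y show False by blast
  qed
  then have "N = 1"
    using assms(1) N by (cases N rule: nat.exhaust; simp)
  then show ?thesis
    using N gcd_dvd2[of l k] by (simp add: g_def)
qed simp

text \<open>Artin's argument: shifting the relation by \<open>h1\<close> and subtracting
  \<open>chr e0 h1\<close> times the original removes the term of \<open>e0\<close>.\<close>

lemma characters_independent:
  fixes chr :: "'e \<Rightarrow> 'h \<Rightarrow> 'k::field" and prd :: "'h \<Rightarrow> 'h \<Rightarrow> 'h" and one :: 'h
  assumes "finite E" and H: "\<And>h h'. h \<in> H \<Longrightarrow> h' \<in> H \<Longrightarrow> prd h h' \<in> H" "one \<in> H"
    and mult: "\<And>e h h'. h \<in> H \<Longrightarrow> h' \<in> H \<Longrightarrow> chr e (prd h h') = chr e h * chr e h'" "\<And>e. chr e one = 1"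
    and sep: "\<And>e e'. e \<in> E \<Longrightarrow> e' \<in> E \<Longrightarrow> e \<noteq> e' \<Longrightarrow> \<exists>h\<in>H. chr e h \<noteq> chr e' h"
    and zero: "\<And>h. h \<in> H \<Longrightarrow> (\<Sum>e\<in>E. c e * chr e h) = 0"
    and "e \<in> E"
  shows "c e = 0"
  using assms(1,6-)
proof (induction E arbitrary: c e rule: finite_induct)
  case (insert e0 E)
  have E: "c e = 0" if e: "e \<in> E" for e
  proof -
    have "e \<noteq> e0"
      using e insert.hyps by blast
    then obtain h1 where h1: "h1 \<in> H" "chr e h1 \<noteq> chr e0 h1"
      using insert.prems(1)[of e e0] e by blast
    have "(\<Sum>e\<in>E. (c e * (chr e h1 - chr e0 h1)) * chr e h) = 0" if "h \<in> H" for h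
    proof -
      have "(\<Sum>e\<in>E. (c e * (chr e h1 - chr e0 h1)) * chr e h) =
          (\<Sum>e\<in>insert e0 E. c e * chr e (prd h1 h)) - chr e0 h1 * (\<Sum>e\<in>insert e0 E. c e * chr e h)"
        using insert.hyps h1(1) that
        by (simp add: mult algebra_simps sum_subtractf sum_distrib_left)
      also have "\<dots> = 0"
        using insert.prems(2) h1 that H by simp
      finally show ?thesis .
    qed
    then have "c e * (chr e h1 - chr e0 h1) = 0"
      using insert.IH[of "\<lambda>e. c e * (chr e h1 - chr e0 h1)" e] insert.prems(1) e by blast
    then show ?thesis
      using h1(2) by simp
  qed
  moreover have "c e0 = 0"
    using insert.prems(2)[OF H(2)] insert.hyps E by (simp add: mult(2))
  ultimately show ?case
    using insert.prems(3) by blast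
qed simp

subsection \<open>Density of points on varieties of Type 1\<close>

lemma monom_eval_prod: "monom_eval (\<lambda>v. f v * g v) e = monom_eval f e * monom_eval g e"
  by (simp add: monom_eval_def power_mult_distrib prod.distrib)

lemma monom_eval_one: "monom_eval (\<lambda>v. 1) e = 1"
  by (simp add: monom_eval_def)

lemma mmonom_sum: "mmonom (\<Sum>i\<in>I. f i) = (\<Prod>i\<in>I. mmonom (f i))"
  by (induction I rule: infinite_finite_induct) (auto simp: mmonom_add)

lemma (in ring_map) map_poly_hom: "ring_map (map_poly \<kappa>)"
  by unfold_locales
     (auto intro!: poly_eqI simp: coeff_map_poly coeff_mult map_add map_mult map_sum)

context trinomial
begin

section \<open>Reduced monomials and the torus that fixes all blocks\<close>

definition block :: "nat \<Rightarrow> trinomial_var \<Rightarrow>\<^sub>0 nat" where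
  "block i = (\<Sum>j=1..n i. Poly_Mapping.single (TVar i j) (l i j))"

lemma lookup_block:
  "Poly_Mapping.lookup (block i) v = (case v of TVar i' j \<Rightarrow> if i' = i \<and> j \<in> {1..n i} then l i j else 0 | SVar _ \<Rightarrow> 0)"
proof (cases v)
  case (TVar i' j)
  then show ?thesis
    by (auto simp: block_def lookup_sum lookup_single when_def sum.delta' cong: if_cong)
qed (simp add: block_def lookup_sum lookup_single)

lemma mmonom_block: "mmonom (block i) = F i"
  by (simp add: block_def mmonom_sum trinomial_monom_def mvar_power)

lemma block_subtract:
  assumes "\<And>j. j \<in> {1..n i} \<Longrightarrow> l i j \<le> Poly_Mapping.lookup e (TVar i j)"
  shows "e = (e - block i) + block i"
proof (rule poly_mapping_eqI)
  fix v
  show "Poly_Mapping.lookup e v = Poly_Mapping.lookup ((e - block i) + block i) v"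
    using assms by (cases v) (auto simp: lookup_add lookup_minus lookup_block)
qed

text \<open>No \<open>F i\<close> divides the monomial: these are the normal forms for rewriting
  \<open>F i\<close> to \<open>\<alpha> i + t\<close> in Type 1.\<close>

definition reduced :: "(trinomial_var \<Rightarrow>\<^sub>0 nat) \<Rightarrow> bool" where
  "reduced e \<longleftrightarrow> Poly_Mapping.keys e \<subseteq> V \<and>
     (\<forall>i\<in>{q..r}. \<exists>j\<in>{1..n i}. Poly_Mapping.lookup e (TVar i j) < l i j)"

text \<open>The diagonal maps that preserve every \<open>F i\<close>; they act on each fibre of
  \<open>t\<close>.\<close>

definition unit_torus :: "(trinomial_var \<Rightarrow> 'k) set" where
  "unit_torus = {h. (\<forall>v. h v \<noteq> 0) \<and> (\<forall>i\<in>{q..r}. (\<Prod>j=1..n i. h (TVar i j) ^ l i j) = 1)}"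

text \<open>Within a block, two exponent vectors with the same character differ by an integral
  multiple \<open>w\<close> of \<open>l i\<close>. A reduced vector is below \<open>l i\<close> at
  some index of the block, so neither \<open>w \<ge> 1\<close> nor \<open>w \<le> -1\<close> is
  possible.\<close>

lemma unit_torus_separates:
  assumes "m = 0" "reduced e" "reduced e'" "e \<noteq> e'"
  shows "\<exists>h\<in>unit_torus. monom_eval h e \<noteq> monom_eval h e'"
proof (rule ccontr)
  assume "\<not> ?thesis"
  then have eq: "monom_eval h e = monom_eval h e'" if "h \<in> unit_torus" for h
    using that by blast
  obtain v where v: "Poly_Mapping.lookup e v \<noteq> Poly_Mapping.lookup e' v"
    using assms(4) by (meson poly_mapping_eqI)
  then have "v \<in> Poly_Mapping.keys e \<or> v \<in> Poly_Mapping.keys e'"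
    by (auto simp: in_keys_iff)
  then have "v \<in> V"
    using assms(2,3) by (auto simp: reduced_def)
  then obtain i j where ij: "v = TVar i j" "i \<in> {q..r}" "j \<in> {1..n i}"
    using assms(1) by (auto simp: trinomial_vars_def)
  define a where "a k = Poly_Mapping.lookup e (TVar i k)" for k
  define b where "b k = Poly_Mapping.lookup e' (TVar i k)" for k
  have eval: "monom_eval (\<lambda>v. if v = u then s else 1) e = s ^ Poly_Mapping.lookup e u" for s :: 'k and u e
  proof -
    have "monom_eval (\<lambda>v. if v = u then s else 1) e =
        (\<Prod>v\<in>insert u (Poly_Mapping.keys e). (if v = u then s else 1) ^ Poly_Mapping.lookup e v)"
      by (rule monom_eval_superset) auto
    also have "\<dots> = (\<Prod>v\<in>insert u (Poly_Mapping.keys e). if v = u then s ^ Poly_Mapping.lookup e u else 1)"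
      by (rule prod.cong) auto
    finally show ?thesis
      by simp
  qed
  have single: "(\<Prod>j=1..n i'. (if TVar i' j = TVar i k then s else 1) ^ l i' j) = (if i' = i then s ^ l i k else 1)"
    if "k \<in> {1..n i}" for i' k and s :: 'k
  proof -
    have "(\<Prod>j=1..n i'. (if TVar i' j = TVar i k then s else 1) ^ l i' j) =
        (\<Prod>j=1..n i'. if j = k then (if i' = i then s ^ l i k else 1) else 1)"
      by (rule prod.cong) auto
    then show ?thesis
      using that by auto
  qed
  \<comment> \<open>Changing one coordinate by roots of unity of order dividing \<open>l i k\<close>
    tests the difference modulo \<open>l i k\<close>.\<close>
  have dvd: "int (l i k) dvd int (a k) - int (b k)" if k: "k \<in> {1..n i}" for k
  proof -
    have ab: "z ^ a k = z ^ b k" if z: "z ^ l i k = 1" for z :: 'k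
    proof -
      have "z \<noteq> 0"
        using z l_pos[OF ij(2) k] by (auto simp: power_0_left)
      then have "(\<lambda>v. if v = TVar i k then z else 1) \<in> unit_torus"
        using single[OF k, of _ z] z by (auto simp: unit_torus_def)
      from eq[OF this] show ?thesis
        unfolding eval a_def b_def .
    qed
    have "l i k dvd b' - a'" if "a' \<le> b'" "\<And>z :: 'k. z ^ l i k = 1 \<Longrightarrow> z ^ a' = z ^ b'" for a' b'
    proof (rule dvd_if_roots_of_unity[where 'k = 'k])
      show "l i k > 0"
        using l_pos[OF ij(2) k] .
      fix z :: 'k assume z: "z ^ l i k = 1"
      have "z \<noteq> 0"
        using z l_pos[OF ij(2) k] by (auto simp: power_0_left)
      moreover have "z ^ b' = z ^ a' * z ^ (b' - a')"
        using that(1) by (simp flip: power_add)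
      ultimately show "z ^ (b' - a') = 1"
        using that(2)[OF z] by simp
    qed
    note * = this
    show ?thesis
    proof (cases "a k \<le> b k")
      case True
      then have "int (l i k) dvd int (b k - a k)"
        using *[OF True ab] by (simp only: int_dvd_int_iff)
      with True show ?thesis
        by (simp add: of_nat_diff dvd_diff_commute)
    next
      case False
      then have le: "b k \<le> a k" by simp
      then have "int (l i k) dvd int (a k - b k)"
        using *[OF le ab[symmetric]] by (simp only: int_dvd_int_iff)
      with le show ?thesis
        by (simp add: of_nat_diff)
    qed
  qed
  have proportional: "int (l i k) * (int (a k') - int (b k')) = int (l i k') * (int (a k) - int (b k))"
    if k: "k \<in> {1..n i}" "k' \<in> {1..n i}" for k k'
  proof -
    \<comment> \<open>A one-parameter subgroup of the torus at the parameter \<open>2\<close>. In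
      characteristic zero \<open>2\<close> has infinite order, so equal powers give equal
      exponents.\<close>
    define h :: "trinomial_var \<Rightarrow> 'k" where
      "h v = (if v = TVar i k' then 2 ^ l i k else 1) * (if v = TVar i k then inverse (2 ^ l i k') else 1)" for v
    have "(\<Prod>j=1..n i'. h (TVar i' j) ^ l i' j) =
        (if i' = i then (2 ^ l i k) ^ l i k' else 1) * (if i' = i then (inverse (2 ^ l i k')) ^ l i k else 1)" for i'
      unfolding h_def power_mult_distrib prod.distrib single[OF k(1)] single[OF k(2)] ..
    moreover have "(2 ^ l i k) ^ l i k' * (inverse (2 ^ l i k')) ^ l i k = (1 :: 'k)"
      by (simp add: power_inverse mult.commute[of "l i k"] flip: power_mult)
    moreover have "h v \<noteq> 0" for v
      by (auto simp: h_def)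
    ultimately have "h \<in> unit_torus"
      by (simp add: unit_torus_def)
    from eq[OF this] have "(2 ^ l i k) ^ a k' * inverse (2 ^ l i k') ^ a k = (2 ^ l i k) ^ b k' * (inverse (2 ^ l i k') ^ b k :: 'k)"
      by (simp add: h_def[abs_def] monom_eval_prod eval a_def b_def)
    then have "((2::'k) ^ l i k) ^ a k' * (2 ^ l i k') ^ b k = (2 ^ l i k) ^ b k' * (2 ^ l i k') ^ a k"
      by (simp add: power_inverse field_simps)
    then have "(2::'k) ^ (l i k * a k' + l i k' * b k) = 2 ^ (l i k * b k' + l i k' * a k)"
      unfolding power_add power_mult .
    then have "of_nat (2 ^ (l i k * a k' + l i k' * b k)) = (of_nat (2 ^ (l i k * b k' + l i k' * a k)) :: 'k)"
      by simp
    then have "(2::nat) ^ (l i k * a k' + l i k' * b k) = 2 ^ (l i k * b k' + l i k' * a k)"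
      by (subst (asm) of_nat_eq_iff)
    then have "l i k * a k' + l i k' * b k = l i k * b k' + l i k' * a k"
      by simp
    then have "int (l i k * a k' + l i k' * b k) = int (l i k * b k' + l i k' * a k)"
      by simp
    then show ?thesis
      by (simp add: algebra_simps)
  qed
  from dvd[OF ij(3)] obtain w where w: "int (a j) - int (b j) = int (l i j) * w"
    by (auto simp: dvd_def)
  have ab: "int (a k) - int (b k) = int (l i k) * w" if "k \<in> {1..n i}" for k
  proof -
    have "int (l i j) * (int (a k) - int (b k)) = int (l i j) * (int (l i k) * w)"
      using proportional[OF ij(3) that] unfolding w by (simp add: mult_ac)
    then show ?thesis
      using l_pos[OF ij(2,3)] by simp
  qed
  obtain k where k: "k \<in> {1..n i}" "a k < l i k"
    using assms(2) ij(2) unfolding reduced_def a_def by blast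
  obtain k' where k': "k' \<in> {1..n i}" "b k' < l i k'"
    using assms(3) ij(2) unfolding reduced_def b_def by blast
  have "w < 1"
  proof (rule ccontr)
    assume "\<not> w < 1"
    then have "int (l i k) * 1 \<le> int (l i k) * w"
      by (intro mult_left_mono) auto
    then show False
      using ab[OF k(1)] k(2) by linarith
  qed
  moreover have "w > -1"
  proof (rule ccontr)
    assume "\<not> w > -1"
    then have "int (l i k') * w \<le> int (l i k') * (-1)"
      by (intro mult_left_mono) auto
    then show False
      using ab[OF k'(1)] k'(2) by linarith
  qed
  ultimately have "w = 0" by linarith
  then show False
    using v w by (simp add: ij a_def b_def)
qed

text \<open>Elements of the algebra are combinations of reduced monomials with coefficients in \<open>K[t]\<close>, where
  \<open>t = F i + a\<^sub>i\<close>; on a fibre of \<open>t\<close> the reduced monomials are multiples of distinct characters.\<close>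

lemma mem_J_if_vanishing:
  assumes type1: "is_Type1 A" and m: "m = 0"
    and vanish: "\<And>x. point x \<Longrightarrow> (\<And>v. v \<in> V \<Longrightarrow> x v \<noteq> 0) \<Longrightarrow> mpoly_at x f = 0"
  shows "f \<in> J"
proof -
  obtain X1 t where X1: "X1 = 1" and "\<And>i. i \<in> {q..r} \<Longrightarrow> F i \<approx> mconst (\<alpha> i) * X1 + mconst (\<beta> i) * t"
    using F_linear type1 by metis
  moreover have \<beta>: "\<beta> i = 1" for i
    using type1 by (auto simp: \<beta>_def split: trinomial_coeffs.splits)
  ultimately have F_t: "F i \<approx> mconst (\<alpha> i) + t" if "i \<in> {q..r}" for i
    using that by simp
  have qr: "r \<in> {q..r}"
    using q_le_r by simp
  \<comment> \<open>Substitutes \<open>t\<close> for the indeterminate of \<open>K[t]\<close>;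
    \<open>?\<Psi>\<close> then reads a polynomial with coefficients in \<open>K[t]\<close> as an
    element of the polynomial ring.\<close>
  define pt where "pt p = poly (map_poly mconst p) t" for p
  interpret pt: ring_map pt
  proof
    show "pt (p + p') = pt p + pt p'" for p p'
      unfolding pt_def by (simp add: ring_map.map_add[OF mconst.map_poly_hom])
    show "pt (p * p') = pt p * pt p'" for p p'
      unfolding pt_def by (simp add: ring_map.map_mult[OF mconst.map_poly_hom])
    show "pt 1 = 1"
      by (simp add: pt_def)
  qed
  have pt_linear: "pt [:\<alpha> i, 1:] = mconst (\<alpha> i) + t" for i
    by (simp add: pt_def map_poly_pCons)
  let ?\<Psi> = "mpoly_eval pt mvar"
  interpret \<Psi>: ring_map ?\<Psi>
    by (rule pt.ring_map_mpoly_eval)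
  define NF where "NF f \<longleftrightarrow> (\<exists>g. (\<forall>e\<in>Poly_Mapping.keys g. reduced e) \<and> f \<approx> ?\<Psi> g)" for f
  have NF_add: "NF (f + g)" if fg: "NF f" "NF g" for f g
  proof -
    obtain f' g' where fg': "\<forall>e\<in>Poly_Mapping.keys f'. reduced e" "f \<approx> ?\<Psi> f'"
      "\<forall>e\<in>Poly_Mapping.keys g'. reduced e" "g \<approx> ?\<Psi> g'"
      using fg unfolding NF_def by blast
    then have "f + g \<approx> ?\<Psi> (f' + g')"
      unfolding \<Psi>.map_add by (intro J.eqm_add)
    moreover have "\<forall>e\<in>Poly_Mapping.keys (f' + g'). reduced e"
      using fg' Poly_Mapping.keys_add[of f' g'] by blast
    ultimately show ?thesis
      unfolding NF_def by blast
  qed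
  \<comment> \<open>Replacing a full block by \<open>\<alpha> i + t\<close> moves it into the
    coefficient and lowers the total degree of the monomial, so the rewriting ends.\<close>
  have NF_monom: "NF (pt p * mmonom e)" for p e
  proof (induction "nat (wt (\<lambda>_. 1) e)" arbitrary: p e rule: less_induct)
    case less
    show ?case
    proof (cases "Poly_Mapping.keys e \<subseteq> V")
      case False
      then obtain v where v: "v \<in> Poly_Mapping.keys e" "v \<notin> V" by blast
      have "e = (e - Poly_Mapping.single v 1) + Poly_Mapping.single v 1"
        by (rule poly_mapping_eqI)
           (use v(1) in \<open>auto simp: lookup_add lookup_minus lookup_single when_def in_keys_iff\<close>)
      then have "mmonom e = mmonom (e - Poly_Mapping.single v 1) * mvar v"
        by (metis mmonom_add mvar_def)
      moreover have "mvar v \<in> J"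
        using v(2) generators_subset by blast
      ultimately have "mmonom e \<in> J"
        using J.mult_mem by metis
      then have "pt p * mmonom e \<approx> ?\<Psi> 0"
        by (simp add: J.eqm_0_iff J.mult_mem)
      then show ?thesis
        unfolding NF_def by (intro exI[of _ 0]) simp
    next
      case keys: True
      show ?thesis
      proof (cases "reduced e")
        case True
        have "?\<Psi> (Poly_Mapping.single e p) = pt p * mmonom e"
          by (simp add: mpoly_eval_def pt.mpoly_lin_single monom_eval_mvar)
        then show ?thesis
          unfolding NF_def using True by (intro exI[of _ "Poly_Mapping.single e p"]) simp
      next
        case False
        then obtain i where i: "i \<in> {q..r}" "\<And>j. j \<in> {1..n i} \<Longrightarrow> l i j \<le> Poly_Mapping.lookup e (TVar i j)"
          using keys by (force simp: reduced_def not_less)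
        define e0 where "e0 = e - block i"
        have e: "e = e0 + block i"
          unfolding e0_def by (rule block_subtract[OF i(2)])
        have "wt (\<lambda>_. 1) (block i) > 0"
        proof -
          have 1: "1 \<in> {1..n i}"
            using n_pos[OF i(1)] by auto
          have "TVar i 1 \<in> Poly_Mapping.keys (block i)"
            using 1 l_pos[OF i(1) 1] by (simp add: in_keys_iff lookup_block)
          then show ?thesis
            unfolding wt_def by (intro sum_pos) (auto simp: in_keys_iff)
        qed
        moreover have "wt (\<lambda>_. 1) e0 \<ge> 0"
          by (simp add: wt_def sum_nonneg)
        ultimately have "NF (pt (p * [:\<alpha> i, 1:]) * mmonom e0)"
          by (intro less) (simp add: e wt_add)
        moreover have "pt p * mmonom e \<approx> pt (p * [:\<alpha> i, 1:]) * mmonom e0"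
        proof -
          have "pt p * mmonom e0 * F i \<approx> pt p * mmonom e0 * (mconst (\<alpha> i) + t)"
            by (intro J.eqm_mult J.eqm_refl F_t i)
          then show ?thesis
            unfolding e mmonom_add mmonom_block pt.map_mult pt_linear by (simp only: mult_ac)
        qed
        ultimately show ?thesis
          unfolding NF_def using J.eqm_trans by blast
      qed
    qed
  qed
  have "NF f"
  proof (induction f rule: mpoly_induct_single)
    case zero
    show ?case
      using NF_monom[of 0 0] by simp
  next
    case (single e c)
    have "pt [:c:] = mconst c"
      by (simp add: pt_def map_poly_pCons)
    then show ?case
      using NF_monom[of "[:c:]" e] by (simp add: single_eq_mconst_mult[of e c])
  qed (rule NF_add)
  then obtain g where g: "\<And>e. e \<in> Poly_Mapping.keys g \<Longrightarrow> reduced e" "f \<approx> ?\<Psi> g"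
    unfolding NF_def by blast
  \<comment> \<open>Take a fibre \<open>t = t0\<close> on which no \<open>F i\<close> vanishes and a
    point \<open>x\<close> in it. Its translates under the torus stay in the fibre, where
    \<open>f\<close> becomes a combination of distinct characters; hence every coefficient vanishes
    at \<open>t0\<close>.\<close>
  have coeffs_vanish: "poly (Poly_Mapping.lookup g e) t0 = 0"
    if t0: "\<forall>i\<in>{q..r}. \<alpha> i + t0 \<noteq> 0" and e: "e \<in> Poly_Mapping.keys g" for t0 e
  proof -
    obtain x where x: "point x" "\<And>v. v \<notin> V \<Longrightarrow> x v = 0"
      "\<And>i. i \<in> {q..r} \<Longrightarrow> mpoly_at x (F i) = \<alpha> i + t0"
      "\<And>i. i \<in> {q..r} \<Longrightarrow> x (TVar i 1) = 0 \<longleftrightarrow> \<alpha> i + t0 = 0"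
      "\<And>i k. i \<in> {q..r} \<Longrightarrow> k \<in> {1..n i} \<Longrightarrow> k \<noteq> 1 \<Longrightarrow> x (TVar i k) = 1"
    proof (rule point_exists[of 1 "\<lambda>_. 1" t0])
      show "1 \<in> {1..n i}" if "i \<in> {q..r}" for i
        using n_pos[OF that] by auto
    qed (auto simp: \<beta>)
    have x_nz: "x v \<noteq> 0" if "v \<in> V" for v
      using that
    proof (cases rule: V_cases)
      case (TVar i j)
      then show ?thesis
        using x(4,5)[of i] t0 by (cases "j = 1") auto
    qed (simp add: m)
    have main: "(\<Sum>e\<in>Poly_Mapping.keys g. (poly (Poly_Mapping.lookup g e) t0 * monom_eval x e) * monom_eval h e) = 0"
      if h: "h \<in> unit_torus" for h
    proof -
      let ?x = "\<lambda>v. h v * x v"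
      have F_x: "mpoly_at ?x (F i) = \<alpha> i + t0" if "i \<in> {q..r}" for i
      proof -
        have "mpoly_at ?x (F i) = (\<Prod>j=1..n i. h (TVar i j) ^ l i j) * mpoly_at x (F i)"
          by (simp add: at_F power_mult_distrib prod.distrib)
        then show ?thesis
          using h x(3) that by (simp add: unit_torus_def)
      qed
      have point: "point ?x"
        by (rule pointI[of _ 1 t0]) (use x(2) F_x \<beta> in auto)
      have t: "mpoly_at ?x t = t0"
      proof -
        have "mpoly_at ?x (F r - (mconst (\<alpha> r) + t)) = 0"
          using point F_t[OF qr] by (simp only: point_def J.eqm_def)
        then show ?thesis
          using F_x[OF qr] by (simp add: at.map_diff at.map_add)
      qed
      have "mpoly_at ?x (pt p) = poly p t0" for p
      proof -
        have "pt p = (\<Sum>i\<le>degree p. mconst (coeff p i) * t ^ i)"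
        proof -
          have "mconst c \<noteq> (0 :: (trinomial_var, 'k) mpoly)" if "c \<noteq> 0" for c
            using that by (metis lookup_single_eq lookup_zero mconst_def)
          then have "degree (map_poly mconst p :: (trinomial_var, 'k) mpoly poly) = degree p"
            by (intro degree_map_poly) auto
          then show ?thesis
            unfolding pt_def poly_altdef by (simp add: coeff_map_poly)
        qed
        then show ?thesis
          by (simp add: at.map_sum at.map_mult at.map_power t poly_altdef)
      qed
      then have "mpoly_at ?x (?\<Psi> g) =
          (\<Sum>e\<in>Poly_Mapping.keys g. poly (Poly_Mapping.lookup g e) t0 * monom_eval ?x e)"
        by (simp add: mpoly_eval_def mpoly_lin_def at.map_sum at.map_mult monom_eval_mvar mpoly_at_mmonom)
      moreover have "mpoly_at ?x (f - ?\<Psi> g) = 0"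
        using point g(2) by (simp only: point_def J.eqm_def)
      moreover have "mpoly_at ?x f = 0"
        using x_nz h by (intro vanish point) (auto simp: unit_torus_def)
      ultimately show ?thesis
        by (simp add: at.map_diff monom_eval_prod mult_ac)
    qed
    have "poly (Poly_Mapping.lookup g e) t0 * monom_eval x e = 0"
    proof (rule characters_independent[where H = unit_torus and prd = "\<lambda>h h' v. h v * h' v"
          and one = "\<lambda>_. 1" and chr = "\<lambda>e h. monom_eval h e" and E = "Poly_Mapping.keys g" and c = "\<lambda>e. poly (Poly_Mapping.lookup g e) t0 * monom_eval x e"])
      show "(\<lambda>v. h v * h' v) \<in> unit_torus" if "h \<in> unit_torus" "h' \<in> unit_torus" for h h'
        using that by (simp add: unit_torus_def power_mult_distrib prod.distrib)
    qed (use main e g(1) unit_torus_separates m in \<open>auto simp: unit_torus_def monom_eval_prod monom_eval_one\<close>)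
    moreover have "monom_eval x e \<noteq> 0"
      using g(1)[OF e] x_nz by (auto simp: monom_eval_def reduced_def)
    ultimately show ?thesis by simp
  qed
  \<comment> \<open>A nonzero coefficient has finitely many roots, yet it vanishes at all but
    finitely many \<open>t0\<close>.\<close>
  have "Poly_Mapping.keys g = {}"
  proof (rule ccontr)
    assume "Poly_Mapping.keys g \<noteq> {}"
    then obtain e where e: "e \<in> Poly_Mapping.keys g" by blast
    then have "finite {t. poly (Poly_Mapping.lookup g e) t = 0}"
      by (intro poly_roots_finite) (simp add: in_keys_iff)
    moreover have "UNIV - (\<lambda>i. - \<alpha> i) ` {q..r} \<subseteq> {t. poly (Poly_Mapping.lookup g e) t = 0}"
    proof
      fix t0 assume t0: "t0 \<in> UNIV - (\<lambda>i. - \<alpha> i) ` {q..r}"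
      have "\<alpha> i + t0 \<noteq> 0" if "i \<in> {q..r}" for i
        using t0 that by (auto simp: add_eq_0_iff)
      then show "t0 \<in> {t. poly (Poly_Mapping.lookup g e) t = 0}"
        using coeffs_vanish[OF _ e] by blast
    qed
    ultimately have "finite (UNIV - (\<lambda>i. - \<alpha> i) ` {q..r})"
      by (rule finite_subset[rotated])
    then have "finite (UNIV :: 'k set)"
      by simp
    then show False
      using infinite_UNIV_char_0 by blast
  qed
  then have "g = 0" by simp
  with g(2) show ?thesis
    by (simp add: J.eqm_0_iff)
qed

subsection \<open>Rigidity in Type 1\<close>

text \<open>The polynomials whose derivatives all vanish at \<open>x\<close> are those vanishing on the orbit of \<open>x\<close>.\<close>

lemma orbit_ideal_prime:
  assumes "lnd_mod_ideal d J" "point x"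
  defines "Jx \<equiv> {f. \<forall>k. mpoly_at x ((d ^^ k) f) = 0}"
  shows "lnd_mod_prime d Jx" "J \<subseteq> Jx"
proof -
  interpret d: lnd_mod_ideal d J by fact
  show sub: "J \<subseteq> Jx"
    using assms(2) by (auto simp: Jx_def point_def intro: d.funpow_mem)
  have at_leibniz: "mpoly_at x ((d ^^ k) (f * g)) =
      (\<Sum>i\<le>k. of_nat (k choose i) * mpoly_at x ((d ^^ i) f) * mpoly_at x ((d ^^ (k - i)) g))" for k f g
    unfolding d.leibniz by (simp add: at.map_sum at.map_mult at.map_of_nat)
  \<comment> \<open>This \<open>a\<close> is the degree of \<open>f\<close> along the orbit of
    \<open>x\<close>; local nilpotency bounds it.\<close>
  have deg: "\<exists>a. mpoly_at x ((d ^^ a) f) \<noteq> 0 \<and> (\<forall>k>a. mpoly_at x ((d ^^ k) f) = 0)" if "f \<notin> Jx" for f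
  proof -
    let ?K = "{k. mpoly_at x ((d ^^ k) f) \<noteq> 0}"
    obtain j where "(d ^^ j) f \<in> J"
      using d.nilpotent by blast
    then have "mpoly_at x ((d ^^ k) f) = 0" if "j \<le> k" for k
      using assms(2) d.funpow_mem_le that by (auto simp: point_def)
    then have "?K \<subseteq> {..<j}"
      using not_le by blast
    then have "finite ?K"
      by (rule finite_subset) simp
    moreover have "?K \<noteq> {}"
      using that by (auto simp: Jx_def)
    ultimately show ?thesis
      using Max_in[of ?K] Max_ge[of ?K] by (intro exI[of _ "Max ?K"]) (auto simp: not_less[symmetric])
  qed
  show "lnd_mod_prime d Jx"
  proof
    show "0 \<in> Jx"
      by (simp add: Jx_def)
    show "a + b \<in> Jx" if "a \<in> Jx" "b \<in> Jx" for a b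
      using that by (simp add: Jx_def d.funpow_add at.map_add)
    show "c * a \<in> Jx" if "a \<in> Jx" for a c
      using that by (simp add: Jx_def at_leibniz)
    show "d f \<in> Jx" if "f \<in> Jx" for f
    proof -
      have "mpoly_at x ((d ^^ Suc k) f) = 0" for k
        using that unfolding Jx_def by blast
      then show ?thesis
        by (simp add: Jx_def funpow_swap1)
    qed
    show "\<exists>j. (d ^^ j) f \<in> Jx" for f
      using d.nilpotent sub by blast
    show "1 \<notin> Jx"
      unfolding Jx_def by (auto intro: exI[of _ 0])
    show "f \<in> Jx \<or> g \<in> Jx" if fg: "f * g \<in> Jx" for f g
    proof (rule ccontr)
      assume "\<not> ?thesis"
      then obtain a b where a: "mpoly_at x ((d ^^ a) f) \<noteq> 0" "\<And>k. k > a \<Longrightarrow> mpoly_at x ((d ^^ k) f) = 0"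
        and b: "mpoly_at x ((d ^^ b) g) \<noteq> 0" "\<And>k. k > b \<Longrightarrow> mpoly_at x ((d ^^ k) g) = 0"
        using deg by metis
      have "mpoly_at x ((d ^^ (a + b)) (f * g)) =
          (\<Sum>i\<le>a + b. if i = a then of_nat ((a + b) choose a) * mpoly_at x ((d ^^ a) f) * mpoly_at x ((d ^^ b) g) else 0)"
        unfolding at_leibniz
      proof (rule sum.cong[OF refl])
        fix i assume "i \<in> {..a + b}"
        show "of_nat ((a + b) choose i) * mpoly_at x ((d ^^ i) f) * mpoly_at x ((d ^^ (a + b - i)) g) =
            (if i = a then of_nat ((a + b) choose a) * mpoly_at x ((d ^^ a) f) * mpoly_at x ((d ^^ b) g) else 0)"
          using a(2)[of i] b(2)[of "a + b - i"] by (cases i a rule: linorder_cases) auto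
      qed
      also have "\<dots> = of_nat ((a + b) choose a) * mpoly_at x ((d ^^ a) f) * mpoly_at x ((d ^^ b) g)"
        by simp
      finally show False
        using fg a b by (simp add: Jx_def)
    qed
  qed
qed

text \<open>The degree argument is run on the orbit of one point with nonzero coordinates at a time,
  and shows that each \<open>d (T i j)\<close> vanishes at that point. Density of these points then
  gives membership in \<open>J\<close>.\<close>

lemma rigid_type1:
  assumes "is_Type1 A" "m = 0"
    and i: "i1 \<in> {1..r}" "i2 \<in> {1..r}" "i1 \<noteq> i2"
    and l: "\<And>j. j \<in> {1..n i1} \<Longrightarrow> l i1 j \<ge> 2" "\<And>j. j \<in> {1..n i2} \<Longrightarrow> l i2 j \<ge> 2"
  shows "rigid_algebra B \<iota>"
proof (rule ccontr)
  assume "\<not> rigid_algebra B \<iota>"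
  then obtain d where d: "lnd_mod_ideal d J" "\<And>v. v \<notin> V \<Longrightarrow> d (mvar v) = 0" "\<exists>v. d (mvar v) \<notin> J"
    by (rule not_rigidE) (rule that; simp)
  interpret d: lnd_mod_ideal d J by fact
  have q: "q = 1"
    using assms(1) by (simp add: q_cases)
  have \<beta>: "\<beta> i = 1" for i
    using assms(1) by (auto simp: \<beta>_def split: trinomial_coeffs.splits)
  obtain X1 t where "X1 = 1" "\<And>i. i \<in> {q..r} \<Longrightarrow> F i \<approx> mconst (\<alpha> i) * X1 + mconst (\<beta> i) * t"
    using F_linear assms(1) by metis
  then have F_t: "F i \<approx> mconst (\<alpha> i) + t" if "i \<in> {1..r}" for i
    using that by (simp add: \<beta> q)
  have F_diff: "F i - F i' - mconst (\<alpha> i - \<alpha> i') \<in> J" if "i \<in> {1..r}" "i' \<in> {1..r}" for i i'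
    using J.eqm_diff[OF F_t[OF that(1)] F_t[OF that(2)]] by (simp add: J.eqm_def mconst.map_diff algebra_simps)
  have c: "\<alpha> i1 - \<alpha> i2 \<noteq> 0"
    using \<Delta>_nz[of i1 i2] i by (simp add: \<Delta>_def \<beta> q)
  have T_J: "d (T i j) \<in> J" if ij: "i \<in> {1..r}" "j \<in> {1..n i}" for i j
  proof (rule mem_J_if_vanishing[OF assms(1,2)])
    fix x assume x: "point x" "\<And>v. v \<in> V \<Longrightarrow> x v \<noteq> 0"
    let ?Jx = "{f. \<forall>k. mpoly_at x ((d ^^ k) f) = 0}"
    interpret Jx: lnd_mod_prime d ?Jx
      by (rule orbit_ideal_prime[OF d(1) x(1)])
    have sub: "J \<subseteq> ?Jx"
      by (rule orbit_ideal_prime[OF d(1) x(1)])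
    have F_notin: "F i \<notin> ?Jx" if "i \<in> {1..r}" for i
    proof -
      have "mpoly_at x ((d ^^ 0) (F i)) \<noteq> 0"
        using that x(2) by (auto simp: at_F TVar_in_V q)
      then show ?thesis by blast
    qed
    have dF_eq: "d (F i) - d (F i') \<in> ?Jx" if "i \<in> {1..r}" "i' \<in> {1..r}" for i i'
      using d.d_mem[OF F_diff[OF that]] sub by (auto simp: d.d_diff)
    let ?P = "\<lambda>i. \<Prod>j\<in>{1..n i}. T i j ^ (l i j - 1)"
    have F_dvd: "?P i dvd F i" for i
      unfolding trinomial_monom_def by (intro prod_dvd_prod le_imp_power_dvd) simp
    have "d (F i1) \<in> ?Jx"
      unfolding trinomial_monom_def
    proof (rule Jx.coprime_powers_in_kernel[where \<beta> = 1])
      fix a b assume ab: "Jx.eqm (?P i1 * a) (?P i2 * b)"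
      obtain P' Q' where PQ: "F i1 = ?P i1 * P'" "F i2 = ?P i2 * Q'"
        using F_dvd[of i1] F_dvd[of i2] unfolding dvd_def by (elim exE)
      \<comment> \<open>The Bezout identity: on the orbit \<open>F i1 - F i2\<close> is a nonzero
        constant, and each of the two is a multiple of its cofactor, so \<open>a\<close> can be
        solved for modulo \<open>?P i2\<close>.\<close>
      let ?c = "mconst (inverse (\<alpha> i1 - \<alpha> i2))"
      have "P' * (?P i1 * a - ?P i2 * b) \<in> ?Jx"
        using ab by (intro Jx.mult_mem) (simp only: Jx.eqm_def)
      moreover have "a * (F i1 - F i2 - mconst (\<alpha> i1 - \<alpha> i2)) \<in> ?Jx"
        using F_diff[OF i(1,2)] sub by (intro Jx.mult_mem) blast
      ultimately have "?c * (P' * (?P i1 * a - ?P i2 * b) - a * (F i1 - F i2 - mconst (\<alpha> i1 - \<alpha> i2))) \<in> ?Jx"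
        by (rule Jx.mult_mem[OF Jx.diff_mem])
      also have "?c * (P' * (?P i1 * a - ?P i2 * b) - a * (F i1 - F i2 - mconst (\<alpha> i1 - \<alpha> i2))) =
          (?c * mconst (\<alpha> i1 - \<alpha> i2)) * a - ?P i2 * (?c * (P' * b - Q' * a))"
        unfolding PQ by (simp add: algebra_simps)
      also have "?c * mconst (\<alpha> i1 - \<alpha> i2) = 1"
        using c by (simp flip: mconst.map_mult)
      finally show "\<exists>c. Jx.eqm a (?P i2 * c)"
        unfolding Jx.eqm_def by (intro exI[of _ "?c * (P' * b - Q' * a)"]) simp
    next
      show "Jx.eqm (d (\<Prod>j=1..n i1. T i1 j ^ l i1 j)) (mconst 1 * d (\<Prod>j=1..n i2. T i2 j ^ l i2 j))"
        using dF_eq[OF i(1,2)] by (simp add: Jx.eqm_def trinomial_monom_def)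
    qed (use F_notin i l in \<open>auto simp: trinomial_monom_def\<close>)
    then have "d (F i) \<in> ?Jx"
      using Jx.add_mem[OF dF_eq[OF ij(1) i(1)]] by force
    then have "d (T i j) \<in> ?Jx"
      using F_notin[OF ij(1)] l_pos[of i j] ij unfolding trinomial_monom_def
      by (intro Jx.kernel_prod_powers[of "{1..n i}" "T i" "l i"]) (auto simp: q)
    then have "mpoly_at x ((d ^^ 0) (d (T i j))) = 0"
      by blast
    then show "mpoly_at x (d (T i j)) = 0"
      by simp
  qed
  have "d (mvar v) \<in> J" for v
  proof (cases "v \<in> V")
    case True
    then show ?thesis
      using T_J assms(2) by (cases rule: V_cases) (auto simp: q)
  qed (simp add: d(2))
  with d(3) show False by blast
qed

end

subsection \<open>Homogeneous factorizations\<close>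

text \<open>Compare the lowest and the highest components of both sides.\<close>

lemma homogeneous_factors:
  assumes "prime_ring_ideal J" and graded: "graded_ideal w J"
    and h: "whom w k h" "h \<notin> J" and fg: "h - f * g \<in> J"
  obtains a b where "a + b = k" "f - wcomp w a f \<in> J" "g - wcomp w b g \<in> J"
proof -
  interpret prime_ring_ideal J by fact
  define K where "K f = {i. wcomp w i f \<notin> J}" for f
  have fin: "finite (K f)" for f
  proof (rule finite_subset)
    show "K f \<subseteq> wt w ` Poly_Mapping.keys f"
    proof
      fix i assume "i \<in> K f"
      then have "wcomp w i f \<noteq> 0" by (auto simp: K_def)
      then obtain e where "Poly_Mapping.lookup (wcomp w i f) e \<noteq> 0"
        by (metis poly_mapping_eqI lookup_zero)
      then show "i \<in> wt w ` Poly_Mapping.keys f"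
        by (auto simp: lookup_wcomp in_keys_iff split: if_splits)
    qed
  qed simp
  have only: "f - wcomp w a f \<in> J" if "K f \<subseteq> {a}" for f a
  proof -
    let ?S = "insert a (wt w ` Poly_Mapping.keys f)"
    have "f = (\<Sum>i\<in>?S. wcomp w i f)"
      by (rule wcomp_decomposition[symmetric]) auto
    also have "\<dots> = wcomp w a f + (\<Sum>i\<in>?S - {a}. wcomp w i f)"
      by (rule sum.remove) auto
    finally have "f - wcomp w a f = (\<Sum>i\<in>?S - {a}. wcomp w i f)"
      by (simp add: algebra_simps)
    also have "\<dots> \<in> J"
      using that by (intro sum_mem) (auto simp: K_def)
    finally show ?thesis .
  qed
  have nonempty: "K f \<noteq> {}" if "f \<notin> J" for f
  proof
    assume "K f = {}"
    then have "wcomp w i f \<in> J" for i by (auto simp: K_def)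
    then have "(\<Sum>i\<in>wt w ` Poly_Mapping.keys f. wcomp w i f) \<in> J"
      by (intro sum_mem)
    with that show False
      by (simp flip: wcomp_decomposition')
  qed
  have "f * g \<notin> J"
    using add_mem[OF fg, of "f * g"] h(2) by auto
  then have "f \<notin> J" "g \<notin> J"
    using mult_mem_iff by auto
  \<comment> \<open>If a single pair of components contributes to degree \<open>a + b\<close> of the
    product, its product is nonzero modulo the prime \<open>J\<close>, so this is the degree of
    \<open>h\<close>. The lowest and the highest pair both qualify.\<close>
  have extreme: "a + b = k"
    if ab: "a \<in> K f" "b \<in> K g" and unique: "\<And>i. i \<in> K f \<Longrightarrow> a + b - i \<in> K g \<Longrightarrow> i = a" for a b
  proof (rule ccontr)
    assume "a + b \<noteq> k"
    then have "wcomp w (a + b) h = 0"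
      using wcomp_whom[OF h(1)] by auto
    moreover have "wcomp w (a + b) (h - f * g) \<in> J"
      using graded fg by (auto simp: graded_ideal_def)
    ultimately have "wcomp w (a + b) (f * g) \<in> J"
      using uminus_mem[of "wcomp w (a + b) (h - f * g)"] by (simp add: wcomp_diff)
    moreover have "a \<in> wt w ` Poly_Mapping.keys f"
    proof (rule ccontr)
      assume "a \<notin> wt w ` Poly_Mapping.keys f"
      then have "wcomp w a f = 0"
        by (intro poly_mapping_eqI) (auto simp: lookup_wcomp in_keys_iff)
      with ab(1) show False by (simp add: K_def)
    qed
    ultimately have "wcomp w a f * wcomp w b g + (\<Sum>i\<in>wt w ` Poly_Mapping.keys f - {a}. wcomp w i f * wcomp w (a + b - i) g) \<in> J"
      unfolding wcomp_mult by (subst (asm) sum.remove[of _ a]) auto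
    moreover have "(\<Sum>i\<in>wt w ` Poly_Mapping.keys f - {a}. wcomp w i f * wcomp w (a + b - i) g) \<in> J"
    proof (rule sum_mem)
      fix i assume "i \<in> wt w ` Poly_Mapping.keys f - {a}"
      then have "i \<notin> K f \<or> a + b - i \<notin> K g"
        using unique by blast
      then show "wcomp w i f * wcomp w (a + b - i) g \<in> J"
        by (auto simp: K_def intro: mult_mem mult_mem')
    qed
    ultimately have "wcomp w a f * wcomp w b g \<in> J"
      using diff_mem by fastforce
    with ab show False
      by (simp add: K_def mult_mem_iff)
  qed
  have f: "Min (K f) \<in> K f" "Max (K f) \<in> K f" and g: "Min (K g) \<in> K g" "Max (K g) \<in> K g"
    using Min_in[OF fin nonempty] Max_in[OF fin nonempty] \<open>f \<notin> J\<close> \<open>g \<notin> J\<close> by blast+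
  have f_le: "Min (K f) \<le> i" "i \<le> Max (K f)" if "i \<in> K f" for i
    using that fin by (auto intro: Min_le Max_ge)
  have g_le: "Min (K g) \<le> i" "i \<le> Max (K g)" if "i \<in> K g" for i
    using that fin by (auto intro: Min_le Max_ge)
  have min: "Min (K f) + Min (K g) = k"
    by (rule extreme[OF f(1) g(1)]) (use f_le(1) g_le(1) in force)
  have max: "Max (K f) + Max (K g) = k"
    by (rule extreme[OF f(2) g(2)]) (use f_le(2) g_le(2) in force)
  have "Min (K f) \<le> Max (K f)" "Min (K g) \<le> Max (K g)"
    using f_le(1)[OF f(2)] g_le(1)[OF g(2)] .
  with min max have eq: "Max (K f) = Min (K f)" "Max (K g) = Min (K g)"
    by linarith+
  have "K f \<subseteq> {Min (K f)}" "K g \<subseteq> {Min (K g)}"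
    using f_le g_le unfolding eq by (auto intro: antisym)
  then show ?thesis
    using min by (intro that only)
qed

subsection \<open>Primality of the variables\<close>

context trinomial
begin

text \<open>A common degree of all \<open>F i\<close> is what makes the three-term relations
  homogeneous.\<close>

definition compatible_weight :: "(trinomial_var \<Rightarrow> int) \<Rightarrow> int \<Rightarrow> bool" where
  "compatible_weight w \<mu> \<longleftrightarrow> (\<forall>i\<in>{q..r}. (\<Sum>j=1..n i. w (TVar i j) * int (l i j)) = \<mu>)"

lemma whom_F: "compatible_weight w \<mu> \<Longrightarrow> i \<in> {q..r} \<Longrightarrow> whom w \<mu> (F i)"
  unfolding compatible_weight_def trinomial_monom_def
  using whom_prod[of "{1..n i}" w "\<lambda>j. int (l i j) * w (TVar i j)" "\<lambda>j. T i j ^ l i j"]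
  by (simp add: whom_power mult.commute)

lemma graded_J:
  assumes "is_Type2 A" "compatible_weight w \<mu>"
  shows "graded_ideal w J"
proof (rule graded_ideal_generated[OF J.ring_ideal_axioms generators_subset J_minimal])
  fix g assume "g \<in> trinomial_relations r n l A \<union> mvar ` (- V)"
  then show "\<exists>k. whom w k g"
  proof
    assume g: "g \<in> trinomial_relations r n l A"
    obtain M where Type2: "A = Type2 M"
      using assms(1) by (cases A) auto
    with g obtain i where i: "i + 2 \<le> r" and g: "g = three_term i"
      using relations_type2 by auto
    have "whom w (0 + \<mu>) (mconst c * F (i + k))" if "k \<le> 2" for c k
      using that i by (intro whom_mult whom_mconst whom_F assms) (auto simp: type2_simps(2)[OF Type2])
    from this[of 0] this[of 1] this[of 2] have "whom w \<mu> g"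
      unfolding g three_term_def by (intro whom_add whom_diff) simp_all
    then show ?thesis ..
  next
    assume "g \<in> mvar ` (- V)"
    then obtain v where "g = mvar v" by blast
    then show ?thesis
      using whom_mvar[of w v] by metis
  qed
qed

lemma not_dvdm_if_point:
  assumes "point x" "mpoly_at x f = 0" "mpoly_at x g \<noteq> 0"
  shows "\<not> J.dvdm f g"
proof
  assume "J.dvdm f g"
  then obtain c where "g - f * c \<in> J"
    by (auto simp: J.dvdm_def J.eqm_def)
  with assms(1) have "mpoly_at x (g - f * c) = 0"
    by (auto simp: point_def)
  with assms(2,3) show False
    by (simp add: at.map_diff at.map_mult)
qed

text \<open>The parameters \<open>(\<beta> i, - \<alpha> i)\<close> are the zero of the
  \<open>i\<close>-th linear form, where the others take the values \<open>\<Delta> k i\<close>. The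
  zero of block \<open>i\<close> is put on the variable with index \<open>j\<close>.\<close>

lemma point_on_divisor:
  assumes "is_Type2 A" "i \<in> {q..r}" "j \<in> {1..n i}"
  obtains x where "point x" "\<And>v. v \<notin> V \<Longrightarrow> x v = 0" "x (TVar i j) = 0"
    "\<And>k. k \<in> {q..r} \<Longrightarrow> mpoly_at x (F k) = \<Delta> k i"
proof -
  have "\<not> is_Type1 A"
    using assms(1) by (cases A) auto
  obtain x where x: "point x" "\<And>v. v \<notin> V \<Longrightarrow> x v = 0"
    "\<And>k. k \<in> {q..r} \<Longrightarrow> mpoly_at x (F k) = \<alpha> k * \<beta> i + \<beta> k * (- \<alpha> i)"
    "\<And>i'. i' \<in> {q..r} \<Longrightarrow> x (TVar i' (if i' = i then j else 1)) = 0 \<longleftrightarrow> \<alpha> i' * \<beta> i + \<beta> i' * (- \<alpha> i) = 0"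
  proof (rule point_exists[of "\<beta> i" "\<lambda>i'. if i' = i then j else 1" "- \<alpha> i"])
    show "(if i' = i then j else 1) \<in> {1..n i'}" if "i' \<in> {q..r}" for i'
      using that assms(3) n_pos[of i'] by auto
  qed (use \<open>\<not> is_Type1 A\<close> in auto)
  have "x (TVar i j) = 0"
    using x(4)[OF assms(2)] by (simp add: mult.commute)
  with x show ?thesis
    by (intro that[of x]) (simp_all add: \<Delta>_def)
qed

text \<open>Modulo the square of the ideal of the origin, the relations do not involve the special variables.\<close>

lemma special_variable_primem:
  assumes factorial: "factorial_domain B" and type2: "is_Type2 A"
    and i: "i \<in> {q..r}" and special: "\<And>j. j \<in> {1..n i} \<Longrightarrow> l i j \<ge> 2" and j: "j \<in> {1..n i}"
  shows "J.primem (T i j)"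
proof -
  interpret factorial_domain B by fact
  have prime: "prime_ring_ideal J"
    by (rule prime_ideal_J) unfold_locales
  interpret J: prime_ring_ideal J by fact
  obtain M where Type2: "A = Type2 M"
    using type2 by (cases A) auto
  \<comment> \<open>Restriction to the coordinate axis of \<open>T i j\<close>. Since
    \<open>l i j \<ge> 2\<close>, the image of \<open>F i\<close> is divisible by the square of the
    coordinate; the other \<open>F k\<close> vanish on the axis.\<close>
  define \<psi> where "\<psi> = mpoly_eval (\<lambda>c::'k. [:c:]) (\<lambda>u. if u = TVar i j then [:0, 1:] else 0)"
  have const: "ring_map (\<lambda>c::'k. [:c:])"
    by unfold_locales auto
  interpret \<psi>: ring_map \<psi>
    unfolding \<psi>_def by (rule ring_map.ring_map_mpoly_eval[OF const])
  have \<psi>_mvar: "\<psi> (mvar u) = (if u = TVar i j then [:0, 1:] else 0)" for u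
    by (simp add: \<psi>_def ring_map.mpoly_eval_mvar[OF const])
  have \<psi>_F: "[:0, 1:] ^ 2 dvd \<psi> (F k)" if k: "k \<in> {q..r}" for k
  proof (cases "k = i")
    case True
    have "[:0, 1:] ^ 2 dvd ([:0, 1:] :: 'k poly) ^ l i j"
      using special[OF j] by (intro le_imp_power_dvd)
    also have "\<dots> = \<psi> (T i j ^ l i j)"
      by (simp add: \<psi>.map_power \<psi>_mvar)
    also have "\<dots> dvd \<psi> (F i)"
      unfolding trinomial_monom_def \<psi>.map_prod using j by (intro dvd_prodI) auto
    finally show ?thesis
      using True by simp
  next
    case False
    have 1: "1 \<in> {1..n k}"
      using n_pos[OF k] by auto
    have "\<psi> (T k 1 ^ l k 1) = 0"
      using False l_pos[OF k 1] by (simp add: \<psi>.map_power \<psi>_mvar power_0_left)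
    then have "\<psi> (F k) = 0"
      unfolding trinomial_monom_def \<psi>.map_prod using 1 by (intro prod_zero) auto
    then show ?thesis by simp
  qed
  have sub: "J \<subseteq> {f. [:0, 1:] ^ 2 dvd \<psi> f}"
  proof (rule J_minimal)
    show "ring_ideal {f. [:0, 1:] ^ 2 dvd \<psi> f}"
      by unfold_locales (auto simp: \<psi>.map_add \<psi>.map_mult)
    have "[:0, 1:] ^ 2 dvd \<psi> g" if "g \<in> trinomial_relations r n l A" for g
    proof -
      obtain k where k: "k + 2 \<le> r" and g: "g = three_term k"
        using \<open>g \<in> _\<close> relations_type2[OF Type2] by auto
      show ?thesis
        unfolding g three_term_def \<psi>.map_add \<psi>.map_diff \<psi>.map_mult
        using k by (intro dvd_add dvd_diff dvd_mult \<psi>_F) (auto simp: type2_simps(2)[OF Type2])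
    qed
    moreover have "\<psi> (mvar u) = 0" if "u \<notin> V" for u
      using that i j by (auto simp: \<psi>_mvar TVar_in_V)
    ultimately show "trinomial_relations r n l A \<union> mvar ` (- V) \<subseteq> {f. [:0, 1:] ^ 2 dvd \<psi> f}"
      by auto
  qed
  have not_dvd: "\<not> [:0, 1:] ^ 2 dvd ([:0, 1:] :: 'k poly)"
  proof
    assume "[:0, 1:] ^ 2 dvd ([:0, 1:] :: 'k poly)"
    then have "degree (([:0, 1:] :: 'k poly) ^ 2) \<le> degree ([:0, 1:] :: 'k poly)"
      by (rule dvd_imp_degree_le) simp
    then show False
      by (simp add: degree_power_eq)
  qed
  have T_notin: "T i j \<notin> J"
    using sub not_dvd \<psi>_mvar[of "TVar i j"] by auto
  have T_nonunit: "\<not> J.dvdm (T i j) 1"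
  proof -
    obtain x where "point x" "x (TVar i j) = 0"
      by (rule point_on_divisor[OF type2 i j])
    then show ?thesis
      by (intro not_dvdm_if_point[of x]) auto
  qed
  define N where "N = (\<Prod>i\<in>{q..r}. n i * (\<Prod>j=1..n i. l i j))"
  have N_dvd: "n k * l k j' dvd N" if "k \<in> {q..r}" "j' \<in> {1..n k}" for k j'
  proof -
    have "n k * l k j' dvd n k * (\<Prod>j=1..n k. l k j)"
      using that by (intro mult_dvd_mono dvd_refl dvd_prodI) auto
    also have "\<dots> dvd N"
      unfolding N_def using that by (intro dvd_prodI) auto
    finally show ?thesis .
  qed
  have N_pos: "N > 0"
    unfolding N_def using n_pos l_pos by (intro prod_pos) (auto intro!: prod_pos)
  \<comment> \<open>A grading with positive weights: the degree \<open>N\<close> of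
    \<open>F k\<close> is shared equally by the \<open>n k\<close> variables of its block, and
    \<open>1\<close> is used elsewhere. So degree zero contains only constants, and a factor of
    degree zero is a unit.\<close>
  define w where "w u = (if u \<in> V then case u of TVar k j' \<Rightarrow> int (N div (n k * l k j')) | SVar _ \<Rightarrow> 1 else 1)" for u
  have w_pos: "w u > 0" for u
  proof (cases "u \<in> V")
    case True
    then show ?thesis
    proof (cases rule: V_cases)
      case (TVar k j')
      then show ?thesis
        using True N_dvd[of k j'] N_pos by (auto simp: w_def elim!: dvdE)
    qed (simp add: w_def)
  qed (simp add: w_def)
  have "compatible_weight w (int N)"
    unfolding compatible_weight_def
  proof
    fix k assume k: "k \<in> {q..r}"
    have "w (TVar k j') * int (l k j') = int (N div n k)" if j': "j' \<in> {1..n k}" for j'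
    proof -
      obtain c where c: "N = n k * l k j' * c"
        using N_dvd[OF k j'] by (rule dvdE)
      have "N div (n k * l k j') = c" "N div n k = l k j' * c"
        using n_pos[OF k] l_pos[OF k j'] unfolding c by simp_all
      then show ?thesis
        using k j' by (simp add: w_def TVar_in_V)
    qed
    then have "(\<Sum>j'=1..n k. w (TVar k j') * int (l k j')) = int (n k * (N div n k))"
      by simp
    also have "n k * (N div n k) = N"
      using N_dvd[OF k, of 1] n_pos[OF k] by (metis atLeastAtMost_iff dvd_mult_div_cancel dvd_mult_left le_refl less_one not_less)
    finally show "(\<Sum>j'=1..n k. w (TVar k j') * int (l k j')) = int N" .
  qed
  then have graded: "graded_ideal w J"
    by (rule graded_J[OF type2])
  have wt_0: "e = 0" if "wt w e = 0" for e
  proof (rule ccontr)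
    assume "e \<noteq> 0"
    then have "wt w e > 0"
      unfolding wt_def using w_pos by (intro sum_pos) (auto simp: in_keys_iff)
    with that show False by simp
  qed
  have unit: "J.dvdm f 1" if f: "f \<notin> J" "f - wcomp w 0 f \<in> J" for f
  proof -
    have "wcomp w 0 f = mconst (Poly_Mapping.lookup f 0)"
      by (rule poly_mapping_eqI) (auto simp: lookup_wcomp mconst_def lookup_single when_def dest: wt_0)
    then have eq: "J.eqm f (mconst (Poly_Mapping.lookup f 0))"
      using f by (simp add: J.eqm_def)
    then have "Poly_Mapping.lookup f 0 \<noteq> 0"
      using f(1) J.eqm_mem_iff by force
    then have "J.eqm (f * mconst (inverse (Poly_Mapping.lookup f 0))) 1"
      using J.eqm_mult[OF eq J.eqm_refl, of "mconst (inverse (Poly_Mapping.lookup f 0))"]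
      by (simp flip: mconst.map_mult)
    then show ?thesis
      by (intro J.dvdmI[OF J.eqm_sym])
  qed
  have \<psi>_hom: "[:0, 1:] dvd \<psi> f" if f: "whom w a f" "a \<noteq> 0" for f a
  proof -
    have "[:0, 1:] dvd \<psi> (Poly_Mapping.single e (Poly_Mapping.lookup f e))" if e: "e \<in> Poly_Mapping.keys f" for e
    proof -
      have "e \<noteq> 0"
        using f e by (auto simp: whom_def)
      then obtain u where u: "u \<in> Poly_Mapping.keys e"
        by (metis ex_in_conv keys_eq_empty)
      have "[:0, 1:] dvd \<psi> (mvar u)"
        by (simp add: \<psi>_mvar)
      also have "e = (e - Poly_Mapping.single u 1) + Poly_Mapping.single u 1"
        by (rule poly_mapping_eqI)
           (use u in \<open>auto simp: lookup_add lookup_minus lookup_single when_def in_keys_iff\<close>)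
      then have "Poly_Mapping.single e (Poly_Mapping.lookup f e) =
          mconst (Poly_Mapping.lookup f e) * (mmonom (e - Poly_Mapping.single u 1) * mvar u)"
        by (metis mmonom_add mvar_def single_eq_mconst_mult)
      then have "\<psi> (mvar u) dvd \<psi> (Poly_Mapping.single e (Poly_Mapping.lookup f e))"
        by (simp add: \<psi>.map_mult)
      finally show ?thesis .
    qed
    then have "[:0, 1:] dvd \<psi> (\<Sum>e\<in>Poly_Mapping.keys f. Poly_Mapping.single e (Poly_Mapping.lookup f e))"
      unfolding \<psi>.map_sum by (intro dvd_sum)
    then show ?thesis
      by (simp flip: mpoly_monom_expansion)
  qed
  show ?thesis
  proof (rule irreducible_imp_primem[OF factorial T_notin T_nonunit])
    fix f g assume "J.eqm (T i j) (f * g)"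
    then have fg: "T i j - f * g \<in> J"
      by (simp add: J.eqm_def)
    obtain a b where ab: "a + b = w (TVar i j)" "f - wcomp w a f \<in> J" "g - wcomp w b g \<in> J"
      by (rule homogeneous_factors[OF prime graded whom_mvar T_notin fg])
    have "f * g \<notin> J"
      using J.add_mem[OF fg, of "f * g"] T_notin by auto
    then have notin: "f \<notin> J" "g \<notin> J"
      using J.mult_mem_iff by auto
    have "a = 0 \<or> b = 0"
    proof (rule ccontr)
      \<comment> \<open>Two factors of nonzero degree would both vanish at the origin of the axis,
        and the square of the coordinate would divide the coordinate.\<close>
      assume "\<not> ?thesis"
      then have "[:0, 1:] * [:0, 1:] dvd \<psi> (wcomp w a f) * \<psi> (wcomp w b g)"
        by (intro mult_dvd_mono \<psi>_hom[OF whom_wcomp]) auto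
      then have 1: "[:0, 1:] ^ 2 dvd \<psi> (wcomp w a f * wcomp w b g)"
        by (simp add: power2_eq_square \<psi>.map_mult)
      have "J.eqm (T i j) (wcomp w a f * wcomp w b g)"
        using fg ab(2,3) J.eqm_mult J.eqm_trans unfolding J.eqm_def[symmetric] by blast
      then have "[:0, 1:] ^ 2 dvd \<psi> (T i j) - \<psi> (wcomp w a f * wcomp w b g)"
        using sub by (auto simp: J.eqm_def \<psi>.map_diff)
      then have "[:0, 1:] ^ 2 dvd \<psi> (T i j)"
        using 1 by (metis dvd_add diff_add_cancel)
      with not_dvd show False
        by (simp add: \<psi>_mvar)
    qed
    then show "J.dvdm f 1 \<or> J.dvdm g 1"
      using unit ab(2,3) notin by blast
  qed
qed

lemma variable_not_dvdm_F:
  assumes "is_Type2 A" "i \<in> {q..r}" "j \<in> {1..n i}" "k \<in> {q..r}" "k \<noteq> i"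
  shows "\<not> J.dvdm (T i j) (F k)"
proof -
  obtain x where "point x" "x (TVar i j) = 0" "\<And>k. k \<in> {q..r} \<Longrightarrow> mpoly_at x (F k) = \<Delta> k i"
    using point_on_divisor[OF assms(1-3)] by metis
  then show ?thesis
    using assms \<Delta>_nz by (intro not_dvdm_if_point[of x]) auto
qed

lemma F_notin_J: "i \<in> {q..r} \<Longrightarrow> F i \<notin> J"
proof
  assume i: "i \<in> {q..r}" and "F i \<in> J"
  obtain x where "point x" "\<And>v. v \<in> V \<Longrightarrow> x v \<noteq> 0"
    using generic_point by blast
  then have "mpoly_at x (F i) \<noteq> 0"
    using i by (auto simp: at_F TVar_in_V)
  with \<open>F i \<in> J\<close> \<open>point x\<close> show False
    by (auto simp: point_def)
qed

end

subsection \<open>Coprimality of the exponents\<close>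

context trinomial
begin

text \<open>If \<open>p\<close> divides the exponents of two blocks, a combination of the two monomials that is
  proportional to \<open>F s\<close> splits like \<open>U\<^sup>p - W\<^sup>p\<close>, but the prime \<open>T s j\<close> divides no factor.\<close>

lemma exponents_coprime:
  assumes type2: "is_Type2 A" and s: "s \<in> {q..r}" "j \<in> {1..n s}" and prime: "J.primem (T s j)"
    and ik: "i \<in> {q..r}" "k \<in> {q..r}" "i \<noteq> k" "i \<noteq> s" "k \<noteq> s"
    and p: "\<And>j. j \<in> {1..n i} \<Longrightarrow> p dvd l i j" "\<And>j. j \<in> {1..n k} \<Longrightarrow> p dvd l k j"
  shows "p = 1"
proof (rule ccontr)
  assume "p \<noteq> 1"
  have 1: "1 \<in> {1..n i}"
    using n_pos[OF ik(1)] by auto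
  have "p \<noteq> 0"
    using p(1)[OF 1] l_pos[OF ik(1) 1] by (auto intro: ccontr)
  with \<open>p \<noteq> 1\<close> have p2: "p \<ge> 2" by simp
  have pdvd: "p * (l i' j div p) = l i' j" if "i' = i \<or> i' = k" "j \<in> {1..n i'}" for i' j
    using that p by auto
  define H where "H i' = (\<Prod>j=1..n i'. T i' j ^ (l i' j div p))" for i'
  have H_pow: "H i' ^ p = F i'" if "i' = i \<or> i' = k" for i'
    unfolding H_def trinomial_monom_def prod_power_distrib
    by (rule prod.cong) (use pdvd that in \<open>auto simp: mult.commute simp flip: power_mult\<close>)
  \<comment> \<open>These roots make \<open>U ^ p - W ^ p\<close> equal to
    \<open>\<Delta> s k * F i - \<Delta> s i * F k\<close>, the combination for which columns
    \<open>i\<close> and \<open>k\<close> add up to a multiple of column \<open>s\<close>.\<close>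
  obtain u where u: "u ^ p = \<Delta> s k"
    using nth_root_exists[of p] p2 by (metis \<open>p \<noteq> 0\<close> gr0I)
  obtain v where v: "v ^ p = \<Delta> s i"
    using nth_root_exists[of p] p2 by (metis \<open>p \<noteq> 0\<close> gr0I)
  have uv: "u \<noteq> 0" "v \<noteq> 0"
    using u v \<Delta>_nz[OF s(1) ik(1)] \<Delta>_nz[OF s(1) ik(2)] ik p2 by (auto simp: power_0_left)
  define U where "U = mconst u * H i"
  define W where "W = mconst v * H k"
  define S where "S = (\<Sum>a<p. W ^ (p - Suc a) * U ^ a)"
  obtain X1 X2 where X: "\<And>i. i \<in> {q..r} \<Longrightarrow> F i \<approx> mconst (\<alpha> i) * X1 + mconst (\<beta> i) * X2"
    using F_linear by metis
  have "U ^ p - W ^ p = mconst (\<Delta> s k) * F i - mconst (\<Delta> s i) * F k"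
    by (simp add: U_def W_def power_mult_distrib H_pow u v flip: mconst.map_power)
  also have "\<dots> \<approx> mconst (\<Delta> s k) * (mconst (\<alpha> i) * X1 + mconst (\<beta> i) * X2)
      - mconst (\<Delta> s i) * (mconst (\<alpha> k) * X1 + mconst (\<beta> k) * X2)"
    by (intro J.eqm_diff J.eqm_mult J.eqm_refl X ik)
  also have "\<dots> = mconst (\<Delta> i k) * (mconst (\<alpha> s) * X1 + mconst (\<beta> s) * X2)"
    by (simp add: \<Delta>_def mconst.map_diff mconst.map_mult algebra_simps)
  also have "\<dots> \<approx> mconst (\<Delta> i k) * F s"
    by (intro J.eqm_mult J.eqm_refl J.eqm_sym[OF X] s)
  finally have UW: "U ^ p - W ^ p \<approx> mconst (\<Delta> i k) * F s" .
  have "J.dvdm (T s j) (U ^ p - W ^ p)"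
  proof (rule J.dvdm_eqm[OF _ J.eqm_sym[OF UW]])
    have "T s j dvd T s j ^ l s j"
      using l_pos[OF s] by (intro dvd_power) auto
    also have "\<dots> dvd F s"
      unfolding trinomial_monom_def using s(2) by (intro dvd_prodI) auto
    finally obtain c where "F s = T s j * c" ..
    then show "J.dvdm (T s j) (mconst (\<Delta> i k) * F s)"
      by (intro J.dvdmI[of _ _ "mconst (\<Delta> i k) * c"]) (simp add: mult_ac)
  qed
  moreover have "U ^ p - W ^ p = (U - W) * S"
    unfolding S_def by (rule power_diff_sumr2)
  ultimately have dvd: "J.dvdm (T s j) (U - W) \<or> J.dvdm (T s j) S"
    using prime by (simp add: J.primem_def)
  obtain x where x: "point x" "\<And>v. v \<notin> V \<Longrightarrow> x v = 0" "x (TVar s j) = 0"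
    "\<And>k. k \<in> {q..r} \<Longrightarrow> mpoly_at x (F k) = \<Delta> k s"
    by (rule point_on_divisor[OF type2 s]) (rule that, assumption, simp_all)
  have Ux: "mpoly_at x U ^ p = mpoly_at x W ^ p" "mpoly_at x W \<noteq> 0"
  proof -
    have "mpoly_at x (H i' ^ p) = \<Delta> i' s" if "i' = i \<or> i' = k" for i'
      using that x(4) ik H_pow by auto
    then have "mpoly_at x (H i) ^ p = \<Delta> i s" and k: "mpoly_at x (H k) ^ p = \<Delta> k s"
      by (simp_all add: at.map_power)
    then show "mpoly_at x U ^ p = mpoly_at x W ^ p"
      by (simp add: U_def W_def at.map_mult power_mult_distrib u v) (simp add: \<Delta>_def algebra_simps)
    have "mpoly_at x (H k) \<noteq> 0"
      using k \<Delta>_nz[OF ik(2) s(1)] ik p2 by (auto simp: power_0_left)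
    then show "mpoly_at x W \<noteq> 0"
      using uv by (simp add: W_def at.map_mult)
  qed
  \<comment> \<open>At \<open>x\<close> the quotient \<open>U / W\<close> is a \<open>p\<close>-th
    root of unity. Multiplying the coordinate \<open>TVar i 1\<close> by \<xi> preserves all
    \<open>F i'\<close> and turns the quotient into the prescribed \<open>z\<close>.\<close>
  have rotate: "\<exists>y. point y \<and> y (TVar s j) = 0 \<and> mpoly_at y U = z * mpoly_at y W \<and> mpoly_at y W \<noteq> 0"
    if z: "z ^ p = 1" for z
  proof -
    define \<eta> where "\<eta> = mpoly_at x U / mpoly_at x W"
    have \<eta>: "\<eta> ^ p = 1"
      using Ux by (simp add: \<eta>_def power_divide)
    then have "\<eta> \<noteq> 0"
      using p2 by (auto simp: power_0_left)
    have "l i 1 div p > 0"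
      using pdvd[of i 1] 1 l_pos[OF ik(1) 1] by (metis gr0I mult_0_right less_irrefl)
    then obtain \<xi> where \<xi>: "\<xi> ^ (l i 1 div p) = z / \<eta>"
      using nth_root_exists by blast
    have \<xi>_l: "\<xi> ^ l i 1 = 1"
    proof -
      have "\<xi> ^ l i 1 = (\<xi> ^ (l i 1 div p)) ^ p"
        using pdvd[of i 1] 1 by (metis power_mult mult.commute)
      also have "\<dots> = 1"
        unfolding \<xi> using z \<eta> by (simp add: power_divide)
      finally show ?thesis .
    qed
    define y where "y v = x v * (if v = TVar i 1 then \<xi> else 1)" for v
    have block: "(\<Prod>j=1..n i'. y (TVar i' j) ^ e j) = (\<Prod>j=1..n i'. x (TVar i' j) ^ e j) * (if i' = i then \<xi> ^ e 1 else 1)"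
      for i' e
    proof -
      have "(\<Prod>j=1..n i'. (if TVar i' j = TVar i 1 then \<xi> else 1) ^ e j) =
          (\<Prod>j=1..n i'. if j = 1 then (if i' = i then \<xi> ^ e 1 else 1) else 1)"
        by (rule prod.cong) auto
      also have "\<dots> = (if i' = i then \<xi> ^ e 1 else 1)"
        using 1 by (auto simp: prod.delta)
      finally show ?thesis
        by (simp add: y_def power_mult_distrib prod.distrib)
    qed
    have "mpoly_at y (F i') = mpoly_at x (F i')" for i'
      unfolding at_F block using \<xi>_l by simp
    then have "point y"
      using x(2,4) type2 by (intro pointI[of y "\<beta> s" "- \<alpha> s"]) (auto simp: y_def \<Delta>_def)
    moreover have "y (TVar s j) = 0"
      using x(3) by (simp add: y_def)
    moreover have H: "mpoly_at y (H i') = mpoly_at x (H i') * (if i' = i then z / \<eta> else 1)" for i'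
      using block[of i' "\<lambda>j. l i' j div p"] \<xi> by (auto simp: H_def at.map_prod at.map_power)
    moreover have W: "mpoly_at y W = mpoly_at x W"
      using ik by (simp add: W_def at.map_mult H)
    moreover have "mpoly_at y U = z * mpoly_at y W"
      using \<open>\<eta> \<noteq> 0\<close> Ux unfolding W by (simp add: U_def at.map_mult H \<eta>_def field_simps)
    ultimately show ?thesis
      using Ux by metis
  qed
  \<comment> \<open>For \<open>z \<noteq> 1\<close> the factor \<open>U - W\<close> is nonzero at
    the rotated point; for \<open>z = 1\<close> the other factor has the value
    \<open>p * W ^ (p - 1)\<close> there.\<close>
  from dvd show False
  proof
    assume "J.dvdm (T s j) (U - W)"
    moreover obtain z :: 'k where z: "z ^ p = 1" "z \<noteq> 1"
      using nontrivial_root_of_unity[OF p2] by blast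
    from rotate[OF z(1)] obtain y where "point y" "y (TVar s j) = 0" "mpoly_at y U = z * mpoly_at y W" "mpoly_at y W \<noteq> 0"
      by blast
    with z(2) have "\<not> J.dvdm (T s j) (U - W)"
      by (intro not_dvdm_if_point[of y]) (auto simp: at.map_diff)
    ultimately show False by simp
  next
    assume "J.dvdm (T s j) S"
    moreover obtain y where y: "point y" "y (TVar s j) = 0" "mpoly_at y U = 1 * mpoly_at y W" "mpoly_at y W \<noteq> 0"
      using rotate[of 1] by auto
    have "mpoly_at y S = of_nat p * mpoly_at y W ^ (p - 1)"
      using y(3) by (simp add: S_def at.map_sum at.map_mult at.map_power flip: power_add)
    then have "\<not> J.dvdm (T s j) S"
      using y p2 by (intro not_dvdm_if_point[of y]) auto
    ultimately show False by simp
  qed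
qed

end

subsection \<open>Sums of fractions with coprime denominators\<close>

lemma gcd_mult_integral:
  fixes c :: rat
  assumes "of_nat a * c \<in> \<int>" "of_nat b * c \<in> \<int>"
  shows "of_nat (gcd a b) * c \<in> \<int>"
proof -
  obtain u v where uv: "u * int a + v * int b = int (gcd a b)"
    using bezout_int[of "int a" "int b"] by auto
  have "of_nat (gcd a b) * c = of_int (int (gcd a b)) * c"
    by simp
  also have "\<dots> = of_int u * (of_nat a * c) + of_int v * (of_nat b * c)"
    unfolding uv[symmetric] by (simp add: algebra_simps)
  also have "\<dots> \<in> \<int>"
    by (intro Ints_add Ints_mult[OF Ints_of_int] assms)
  finally show ?thesis .
qed

lemma Gcd_mult_integral:
  fixes c :: rat
  assumes "finite S" "\<And>a. a \<in> S \<Longrightarrow> of_nat a * c \<in> \<int>"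
  shows "of_nat (Gcd S) * c \<in> \<int>"
  using assms by (induction S rule: finite_induct) (auto intro: gcd_mult_integral)

text \<open>As \<open>c i\<close> is minus the sum of the others, its denominator divides both
  \<open>b i\<close> and the product of the other \<open>b k\<close>, which are coprime.\<close>

lemma integral_if_sum_zero:
  fixes c :: "'i \<Rightarrow> rat"
  assumes "finite I" and b: "\<And>i. i \<in> I \<Longrightarrow> of_nat (b i) * c i \<in> \<int>"
    and coprime: "\<And>i k. i \<in> I \<Longrightarrow> k \<in> I \<Longrightarrow> i \<noteq> k \<Longrightarrow> coprime (b i) (b k)"
    and zero: "(\<Sum>i\<in>I. c i) = 0" and i: "i \<in> I"
  shows "c i \<in> \<int>"
proof -
  define N where "N = (\<Prod>k\<in>I - {i}. b k)"
  have "c i = - (\<Sum>k\<in>I - {i}. c k)"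
    using zero assms(1) i by (simp add: sum.remove[of I i] eq_neg_iff_add_eq_0)
  then have "of_nat N * c i = - (\<Sum>k\<in>I - {i}. of_nat N * c k)"
    by (simp add: sum_distrib_left)
  also have "\<dots> \<in> \<int>"
  proof (intro Ints_minus Ints_sum)
    fix k assume k: "k \<in> I - {i}"
    then have "N = (\<Prod>k'\<in>I - {i} - {k}. b k') * b k"
      unfolding N_def using assms(1) by (subst prod.remove[of _ k]) auto
    then have "of_nat N * c k = of_nat (\<Prod>k'\<in>I - {i} - {k}. b k') * (of_nat (b k) * c k)"
      by (simp only: of_nat_mult mult.assoc)
    also have "\<dots> \<in> \<int>"
      using k by (intro Ints_mult[OF Ints_of_nat] b) auto
    finally show "of_nat N * c k \<in> \<int>" .
  qed
  finally have "of_nat (gcd (b i) N) * c i \<in> \<int>"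
    using b i by (intro gcd_mult_integral)
  moreover have "coprime (b i) N"
    unfolding N_def using coprime i by (intro prod_coprime_right) auto
  ultimately show ?thesis
    by simp
qed

subsection \<open>Binary forms\<close>

text \<open>The homogenization of \<open>p\<close> in degree \<open>k\<close>, evaluated at
  \<open>(x, y)\<close>. It is meant for \<open>degree p \<le> k\<close>; a smaller degree shows up
  as factors \<open>y\<close>.\<close>

definition binary_form :: "'a::comm_ring_1 \<Rightarrow> 'a \<Rightarrow> ('k \<Rightarrow> 'a) \<Rightarrow> nat \<Rightarrow> 'k::comm_ring_1 poly \<Rightarrow> 'a" where
  "binary_form x y \<kappa> k p = (\<Sum>a\<le>k. \<kappa> (coeff p a) * x ^ a * y ^ (k - a))"

context ring_map
begin

lemma binary_form_add: "binary_form x y \<kappa> k (p + p') = binary_form x y \<kappa> k p + binary_form x y \<kappa> k p'"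
  by (simp add: binary_form_def map_add algebra_simps sum.distrib)

lemma binary_form_smult: "binary_form x y \<kappa> k (Polynomial.smult c p) = \<kappa> c * binary_form x y \<kappa> k p"
  by (simp add: binary_form_def map_mult sum_distrib_left mult.assoc)

lemma binary_form_linear_mult:
  assumes "degree p \<le> k"
  shows "binary_form x y \<kappa> (Suc k) ([:b, a:] * p) = (\<kappa> a * x + \<kappa> b * y) * binary_form x y \<kappa> k p"
proof -
  have p: "coeff p (Suc k) = 0"
    using assms by (simp add: coeff_eq_0)
  have "binary_form x y \<kappa> (Suc k) (pCons 0 p) = x * binary_form x y \<kappa> k p"
    unfolding binary_form_def by (subst sum.atMost_Suc_shift) (simp add: sum_distrib_left mult_ac)
  moreover have "binary_form x y \<kappa> (Suc k) p = y * binary_form x y \<kappa> k p"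
    unfolding binary_form_def using p
    by (simp add: sum_distrib_left mult_ac Suc_diff_le)
  moreover have "[:b, a:] * p = Polynomial.smult a (pCons 0 p) + Polynomial.smult b p"
    by simp
  ultimately show ?thesis
    by (simp only: binary_form_add binary_form_smult) (simp add: algebra_simps)
qed

end

text \<open>If the degree of \<open>p\<close> drops below \<open>Suc k\<close>, the zero is at
  infinity and the factor is \<open>y\<close>; otherwise a root \<open>z\<close> of \<open>p\<close>
  gives the factor \<open>x - \<kappa> z * y\<close>.\<close>

lemma binary_form_linear_factor:
  fixes p :: "'k::alg_closed_field poly"
  assumes "degree p \<le> Suc k" "ring_map \<kappa>"
  shows "\<exists>a b p'. degree p' \<le> k \<and> binary_form x y \<kappa> (Suc k) p = (\<kappa> a * x + \<kappa> b * y) * binary_form x y \<kappa> k p'"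
proof -
  interpret ring_map \<kappa> by fact
  show ?thesis
  proof (cases "degree p \<le> k")
    case True
    then show ?thesis
      using binary_form_linear_mult[of p k x y 1 0] by (intro exI[of _ 0] exI[of _ 1] exI[of _ p]) simp
  next
    case False
    then have deg: "degree p = Suc k"
      using assms by simp
    then obtain z where "poly p z = 0"
      using alg_closed_imp_poly_has_root[of p] by auto
    then obtain p' where p': "p = [:- z, 1:] * p'"
      by (auto simp: poly_eq_0_iff_dvd elim!: dvdE)
    with deg have "p' \<noteq> 0" by auto
    with deg p' have "degree p' = k"
      by (simp add: degree_mult_eq del: mult_pCons_left)
    then show ?thesis
      using binary_form_linear_mult[of p' k x y "- z" 1] unfolding p' by blast
  qed
qed

context ring_map
begin

lemma binary_form_linear_power:
  assumes "degree p \<le> k"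
  shows "degree ([:b, a:] ^ j * p) \<le> j + k \<and>
    binary_form x y \<kappa> (j + k) ([:b, a:] ^ j * p) = (\<kappa> a * x + \<kappa> b * y) ^ j * binary_form x y \<kappa> k p"
proof (induction j)
  case (Suc j)
  let ?p = "[:b, a:] ^ j * p"
  have "degree ([:b, a:] * ?p) \<le> degree [:b, a:] + degree ?p"
    by (rule degree_mult_le)
  also have "degree [:b, a:] \<le> 1"
    by simp
  then have "degree [:b, a:] + degree ?p \<le> Suc (j + k)"
    using Suc by linarith
  finally have "degree ([:b, a:] * ?p) \<le> Suc (j + k)" .
  moreover have "binary_form x y \<kappa> (Suc (j + k)) ([:b, a:] * ?p) = (\<kappa> a * x + \<kappa> b * y) * binary_form x y \<kappa> (j + k) ?p"
    using Suc by (intro binary_form_linear_mult) simp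
  ultimately show ?case
    using Suc by (simp only: power_Suc mult.assoc add_Suc)
qed (use assms in simp)

lemma binary_form_linear_prod:
  assumes "finite S"
  shows "degree (\<Prod>i\<in>S. [:b i, a i:] ^ k i) \<le> sum k S \<and>
    binary_form x y \<kappa> (sum k S) (\<Prod>i\<in>S. [:b i, a i:] ^ k i) = (\<Prod>i\<in>S. (\<kappa> (a i) * x + \<kappa> (b i) * y) ^ k i)"
  using assms
proof (induction S rule: finite_induct)
  case empty
  show ?case by (simp add: binary_form_def)
next
  case (insert i S)
  then show ?case
    using binary_form_linear_power[of "\<Prod>i\<in>S. [:b i, a i:] ^ k i" "sum k S" "b i" "a i" "k i" x y] by simp
qed

lemma binary_form_sum: "binary_form x y \<kappa> k (\<Sum>i\<in>S. p i) = (\<Sum>i\<in>S. binary_form x y \<kappa> k (p i))"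
  by (induction S rule: infinite_finite_induct)
     (auto simp: binary_form_add, auto simp: binary_form_def)

end

text \<open>Restriction merely deletes monomials, so it preserves homogeneity for every weight at
  once.\<close>

lemma keys_mpoly_restrict: "Poly_Mapping.keys (mpoly_restrict V f) \<subseteq> Poly_Mapping.keys f"
proof -
  let ?s = "\<lambda>v. if v \<in> V then mvar v else 0 :: ('a, 'b) mpoly"
  have single: "Poly_Mapping.keys (mconst c * monom_eval ?s e) \<subseteq> {e}" for c e
  proof (cases "Poly_Mapping.keys e \<subseteq> V")
    case True
    have "monom_eval ?s e = monom_eval mvar e"
      unfolding monom_eval_def by (rule prod.cong) (use True in auto)
    then show ?thesis
      by (simp add: monom_eval_mvar flip: single_eq_mconst_mult)
  next
    case False
    then obtain v where "v \<in> Poly_Mapping.keys e" "v \<notin> V" by blast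
    then have "monom_eval ?s e = 0"
      unfolding monom_eval_def by (intro prod_zero) (auto simp: in_keys_iff zero_power intro!: bexI[of _ v])
    then show ?thesis by simp
  qed
  have "mpoly_restrict V f = (\<Sum>e\<in>Poly_Mapping.keys f. mconst (Poly_Mapping.lookup f e) * monom_eval ?s e)"
    by (simp add: mpoly_restrict_def mpoly_eval_def mpoly_lin_def)
  also have "Poly_Mapping.keys \<dots> \<subseteq> (\<Union>e\<in>Poly_Mapping.keys f. Poly_Mapping.keys (mconst (Poly_Mapping.lookup f e) * monom_eval ?s e))"
    by (rule Poly_Mapping.keys_sum)
  also have "\<dots> \<subseteq> Poly_Mapping.keys f"
    using single by blast
  finally show ?thesis .
qed

subsection \<open>Gradings by choices of one variable per block\<close>

context trinomial
begin

definition exponent_prod :: nat where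
  "exponent_prod = (\<Prod>i\<in>{q..r}. \<Prod>j=1..n i. l i j)"

definition exponents_coprime_blocks :: bool where
  "exponents_coprime_blocks \<longleftrightarrow> (\<forall>i\<in>{q..r}. \<forall>k\<in>{q..r}. i \<noteq> k \<longrightarrow>
     (\<forall>p. (\<forall>j\<in>{1..n i}. p dvd l i j) \<longrightarrow> (\<forall>j\<in>{1..n k}. p dvd l k j) \<longrightarrow> p = 1))"

definition choices :: "(nat \<Rightarrow> nat) set" where
  "choices = PiE {q..r} (\<lambda>i. {1..n i})"

text \<open>The degree of each \<open>F i\<close> rests on the chosen variable alone. It is
  \<open>exponent_prod\<close>, a common multiple of all exponents, so that the weights are
  integers.\<close>

definition choice_weight :: "(nat \<Rightarrow> nat) \<Rightarrow> trinomial_var \<Rightarrow> int" where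
  "choice_weight c v = (case v of
     TVar i j \<Rightarrow> if i \<in> {q..r} \<and> j = c i then int (exponent_prod div l i j) else 0
   | SVar _ \<Rightarrow> 0)"

lemma exponent_prod_dvd: "i \<in> {q..r} \<Longrightarrow> j \<in> {1..n i} \<Longrightarrow> l i j dvd exponent_prod"
proof -
  assume ij: "i \<in> {q..r}" "j \<in> {1..n i}"
  then have "l i j dvd (\<Prod>j=1..n i. l i j)"
    by (intro dvd_prodI) auto
  also have "\<dots> dvd exponent_prod"
    unfolding exponent_prod_def using ij by (intro dvd_prodI) auto
  finally show ?thesis .
qed

lemma exponent_prod_pos: "exponent_prod > 0"
  unfolding exponent_prod_def using l_pos by (intro prod_pos) (auto intro!: prod_pos)

lemma choicesD: "c \<in> choices \<Longrightarrow> i \<in> {q..r} \<Longrightarrow> c i \<in> {1..n i}"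
  by (auto simp: choices_def)

lemma finite_choices: "finite choices"
  by (simp add: choices_def finite_PiE)

lemma choice_weight_compatible:
  assumes "c \<in> choices"
  shows "compatible_weight (choice_weight c) (int exponent_prod)"
  unfolding compatible_weight_def
proof
  fix i assume i: "i \<in> {q..r}"
  have "(\<Sum>j=1..n i. choice_weight c (TVar i j) * int (l i j)) =
      (\<Sum>j=1..n i. if j = c i then int exponent_prod else 0)"
    using i exponent_prod_dvd[OF i]
    by (intro sum.cong refl) (auto simp: choice_weight_def simp flip: of_nat_mult)
  also have "\<dots> = int exponent_prod"
    using choicesD[OF assms i] by simp
  finally show "(\<Sum>j=1..n i. choice_weight c (TVar i j) * int (l i j)) = int exponent_prod" .
qed

lemma wt_choice_weight:
  "wt (choice_weight c) e = (\<Sum>i\<in>{q..r}. int (exponent_prod div l i (c i)) * int (Poly_Mapping.lookup e (TVar i (c i))))"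
proof -
  let ?g = "\<lambda>i. TVar i (c i)"
  have "wt (choice_weight c) e = (\<Sum>v\<in>Poly_Mapping.keys e \<union> ?g ` {q..r}. choice_weight c v * int (Poly_Mapping.lookup e v))"
    by (rule wt_superset) auto
  also have "\<dots> = (\<Sum>v\<in>?g ` {q..r}. choice_weight c v * int (Poly_Mapping.lookup e v))"
    by (rule sum.mono_neutral_right) (auto simp: choice_weight_def split: trinomial_var.splits)
  also have "\<dots> = (\<Sum>i\<in>{q..r}. choice_weight c (?g i) * int (Poly_Mapping.lookup e (?g i)))"
    by (subst sum.reindex) (auto simp: inj_on_def)
  finally show ?thesis
    by (simp add: choice_weight_def)
qed

lemma wt_choice_weight_nonneg: "wt (choice_weight c) e \<ge> 0"
  unfolding wt_choice_weight by (intro sum_nonneg) auto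

text \<open>Divided by the exponents, the differences become rationals \<open>y i j\<close> that add
  up to zero along every choice. Altering the choice in one block shows that \<open>y i j\<close>
  does not depend on \<open>j\<close>; coprimality of the blocks makes the common values
  integers.\<close>

lemma block_multiples:
  assumes coprime: "exponents_coprime_blocks"
    and wt: "\<And>c. c \<in> choices \<Longrightarrow> wt (choice_weight c) e = wt (choice_weight c) e'"
  shows "\<exists>\<kappa>. (\<forall>i\<in>{q..r}. \<forall>j\<in>{1..n i}. int (Poly_Mapping.lookup e (TVar i j)) - int (Poly_Mapping.lookup e' (TVar i j)) =
      \<kappa> i * int (l i j)) \<and> (\<Sum>i\<in>{q..r}. \<kappa> i) = 0"
proof -
  define z where "z i j = int (Poly_Mapping.lookup e (TVar i j)) - int (Poly_Mapping.lookup e' (TVar i j))" for i j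
  define y :: "nat \<Rightarrow> nat \<Rightarrow> rat" where "y i j = of_int (z i j) / of_nat (l i j)" for i j
  have sum_y: "(\<Sum>i\<in>{q..r}. y i (c i)) = 0" if c: "c \<in> choices" for c
  proof -
    have "(\<Sum>i\<in>{q..r}. int (exponent_prod div l i (c i)) * z i (c i)) = 0"
      using wt[OF c] unfolding wt_choice_weight by (simp add: z_def algebra_simps sum_subtractf)
    then have "(\<Sum>i\<in>{q..r}. of_int (int (exponent_prod div l i (c i)) * z i (c i))) = (0 :: rat)"
      by (metis of_int_0 of_int_sum)
    also have "(\<Sum>i\<in>{q..r}. of_int (int (exponent_prod div l i (c i)) * z i (c i))) =
        (\<Sum>i\<in>{q..r}. of_nat exponent_prod * y i (c i))"
    proof (rule sum.cong[OF refl])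
      fix i assume i: "i \<in> {q..r}"
      have "(of_nat (exponent_prod div l i (c i)) :: rat) = of_nat exponent_prod / of_nat (l i (c i))"
        using exponent_prod_dvd[OF i choicesD[OF c i]] l_pos[OF i choicesD[OF c i]]
        by (elim dvdE) simp
      then show "of_int (int (exponent_prod div l i (c i)) * z i (c i)) = of_nat exponent_prod * y i (c i)"
        by (simp add: y_def)
    qed
    finally show ?thesis
      using exponent_prod_pos by (simp flip: sum_distrib_left)
  qed
  have y_const: "y i j = y i 1" if ij: "i \<in> {q..r}" "j \<in> {1..n i}" for i j
  proof -
    define c where "c = (\<lambda>i\<in>{q..r}. 1::nat)"
    have c: "c \<in> choices" "c(i := j) \<in> choices"
      using ij n_pos by (auto simp: choices_def c_def PiE_iff extensional_def Suc_le_eq)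
    have "y i j + (\<Sum>i'\<in>{q..r} - {i}. y i' ((c(i := j)) i')) = 0"
      using sum_y[OF c(2)] ij(1) by (simp add: sum.remove[of "{q..r}" i])
    moreover have "y i (c i) + (\<Sum>i'\<in>{q..r} - {i}. y i' (c i')) = 0"
      using sum_y[OF c(1)] ij(1) by (simp add: sum.remove[of "{q..r}" i])
    moreover have "(\<Sum>i'\<in>{q..r} - {i}. y i' ((c(i := j)) i')) = (\<Sum>i'\<in>{q..r} - {i}. y i' (c i'))"
      by (rule sum.cong) auto
    ultimately show ?thesis
      using ij(1) by (simp add: c_def)
  qed
  have one: "1 \<in> {1..n i}" if "i \<in> {q..r}" for i
    using n_pos[OF that] by auto
  have "y i 1 \<in> \<int>" if i: "i \<in> {q..r}" for i
  proof (rule integral_if_sum_zero[where I = "{q..r}" and b = "\<lambda>i. Gcd (l i ` {1..n i})" and c = "\<lambda>i. y i 1"])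
    show "of_nat (Gcd (l i ` {1..n i})) * y i 1 \<in> \<int>" if i: "i \<in> {q..r}" for i
    proof (rule Gcd_mult_integral)
      fix a assume "a \<in> l i ` {1..n i}"
      then obtain j where j: "j \<in> {1..n i}" "a = l i j" by blast
      have "of_nat a * y i 1 = of_int (z i j)"
        using l_pos[OF i j(1)] unfolding y_const[OF i j(1), symmetric] j(2) by (simp add: y_def)
      then show "of_nat a * y i 1 \<in> \<int>"
        by simp
    qed simp
    show "coprime (Gcd (l i ` {1..n i})) (Gcd (l k ` {1..n k}))"
      if ik: "i \<in> {q..r}" "k \<in> {q..r}" "i \<noteq> k" for i k
    proof -
      let ?p = "gcd (Gcd (l i ` {1..n i})) (Gcd (l k ` {1..n k}))"
      have "\<forall>j\<in>{1..n i}. ?p dvd l i j" "\<forall>j\<in>{1..n k}. ?p dvd l k j"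
        by (meson Gcd_dvd dvd_trans gcd_dvd1 gcd_dvd2 imageI)+
      then have "?p = 1"
        using coprime ik unfolding exponents_coprime_blocks_def by blast
      then show ?thesis
        by (simp add: coprime_iff_gcd_eq_1)
    qed
    have "(\<lambda>i\<in>{q..r}. 1) \<in> choices"
      using one by (auto simp: choices_def)
    from sum_y[OF this] show "(\<Sum>i\<in>{q..r}. y i 1) = 0"
      by simp
  qed (use i in auto)
  then have "\<forall>i\<in>{q..r}. \<exists>k. y i 1 = of_int k"
    unfolding Ints_def by blast
  then obtain \<kappa> where \<kappa>: "\<And>i. i \<in> {q..r} \<Longrightarrow> y i 1 = of_int (\<kappa> i)"
    by metis
  have "z i j = \<kappa> i * int (l i j)" if ij: "i \<in> {q..r}" "j \<in> {1..n i}" for i j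
  proof -
    have "(of_int (z i j) :: rat) = of_int (\<kappa> i) * of_nat (l i j)"
    proof -
      have "(of_int (z i j) :: rat) = y i j * of_nat (l i j)"
        using l_pos[OF ij] by (simp add: y_def)
      then show ?thesis
        unfolding y_const[OF ij] \<kappa>[OF ij(1)] .
    qed
    then have "(of_int (z i j) :: rat) = of_int (\<kappa> i * int (l i j))"
      by simp
    then show ?thesis
      by (simp only: of_int_eq_iff)
  qed
  moreover have "(\<Sum>i\<in>{q..r}. \<kappa> i) = 0"
  proof -
    have "(\<lambda>i\<in>{q..r}. 1) \<in> choices"
      using one by (auto simp: choices_def)
    from sum_y[OF this] have "(\<Sum>i\<in>{q..r}. of_int (\<kappa> i)) = (0 :: rat)"
      using \<kappa> by simp
    then have "of_int (\<Sum>i\<in>{q..r}. \<kappa> i) = (0 :: rat)"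
      by simp
    then show ?thesis
      by (simp only: of_int_eq_0_iff)
  qed
  ultimately show ?thesis
    unfolding z_def by blast
qed

definition block_sum :: "(nat \<Rightarrow> nat) \<Rightarrow> trinomial_var \<Rightarrow>\<^sub>0 nat" where
  "block_sum k = (\<Sum>i\<in>{q..r}. \<Sum>_\<in>{..<k i}. block i)"

lemma lookup_block_sum:
  "Poly_Mapping.lookup (block_sum k) (TVar i j) = (if i \<in> {q..r} \<and> j \<in> {1..n i} then k i * l i j else 0)"
proof -
  have "Poly_Mapping.lookup (block_sum k) (TVar i j) =
      (\<Sum>i'\<in>{q..r}. if i' = i then (if j \<in> {1..n i} then k i * l i j else 0) else 0)"
    unfolding block_sum_def lookup_sum by (rule sum.cong) (auto simp: lookup_block)
  then show ?thesis by auto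
qed

lemma lookup_block_sum_SVar: "Poly_Mapping.lookup (block_sum k) (SVar s) = 0"
  by (simp add: block_sum_def lookup_sum lookup_block)

lemma mmonom_block_sum: "mmonom (block_sum k) = (\<Prod>i\<in>{q..r}. F i ^ k i)"
  by (simp add: block_sum_def mmonom_sum mmonom_block)

text \<open>Elements that are homogeneous for all choices are, modulo \<open>J\<close>, a monomial times a binary form,
  and the latter splits into linear factors.\<close>

lemma homogeneous_kernel:
  assumes m: "m = 0" and d: "lnd_mod_prime d J"
    and coprime: "exponents_coprime_blocks"
    and lin: "\<And>i. i \<in> {q..r} \<Longrightarrow> F i \<approx> mconst (\<alpha> i) * X1 + mconst (\<beta> i) * X2"
    and nolin: "\<And>a b. mconst a * X1 + mconst b * X2 \<notin> J \<Longrightarrow> d (mconst a * X1 + mconst b * X2) \<notin> J"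
    and c: "\<And>i. i \<in> {q..r} \<Longrightarrow> d (T i (c i)) \<notin> J"
    and f: "\<And>c'. c' \<in> choices \<Longrightarrow> \<exists>k. whom (choice_weight c') k f" "f \<notin> J" "d f \<in> J"
    and K: "whom (choice_weight c) K f"
  shows "K = 0"
proof -
  interpret d: lnd_mod_prime d J by fact
  define f' where "f' = mpoly_restrict V f"
  have "mpoly_restrict V (f - f') = 0"
    by (simp add: f'_def restrict.map_diff mpoly_restrict_ident mpoly_vars_restrict)
  then have f': "f \<approx> f'"
    using J_restrict[of "f - f'"] by (simp add: J.eqm_def)
  have keys_f': "Poly_Mapping.keys f' \<subseteq> Poly_Mapping.keys f"
    unfolding f'_def by (rule keys_mpoly_restrict)
  have keys_V: "Poly_Mapping.keys e \<subseteq> V" if "e \<in> Poly_Mapping.keys f'" for e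
    using that mpoly_vars_restrict[of V f] by (auto simp: f'_def mpoly_vars_def)
  have "f' \<notin> J"
    using f(2) J.eqm_mem_iff[OF f'] by simp
  then have "f' \<noteq> 0" by auto
  then obtain e1 where e1: "e1 \<in> Poly_Mapping.keys f'"
    by (metis ex_in_conv keys_eq_empty)
  \<comment> \<open>How often block \<open>i\<close> divides the monomial \<open>e1\<close>. With
    these blocks removed, \<open>e0\<close> is a part common to all monomials of
    \<open>f'\<close>.\<close>
  define k0 where "k0 i = Min ((\<lambda>j. Poly_Mapping.lookup e1 (TVar i j) div l i j) ` {1..n i})" for i
  have k0_le: "k0 i * l i j \<le> Poly_Mapping.lookup e1 (TVar i j)" if "i \<in> {q..r}" "j \<in> {1..n i}" for i j
  proof -
    have "k0 i \<le> Poly_Mapping.lookup e1 (TVar i j) div l i j"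
      unfolding k0_def using that by (intro Min_le) auto
    then have "k0 i * l i j \<le> (Poly_Mapping.lookup e1 (TVar i j) div l i j) * l i j"
      by (rule mult_le_mono1)
    also have "\<dots> \<le> Poly_Mapping.lookup e1 (TVar i j)"
      by (rule div_times_less_eq_dividend)
    finally show ?thesis .
  qed
  define e0 where "e0 = e1 - block_sum k0"
  define k where "k = (\<Sum>i\<in>{q..r}. k0 i)"
  have decomp: "\<exists>ke. e = e0 + block_sum ke \<and> (\<Sum>i\<in>{q..r}. ke i) = k" if e: "e \<in> Poly_Mapping.keys f'" for e
  proof -
    have "wt (choice_weight c') e = wt (choice_weight c') e1" if c': "c' \<in> choices" for c'
    proof -
      obtain k' where "whom (choice_weight c') k' f"
        using f(1)[OF c'] by blast
      then show ?thesis
        using keys_f'[THEN subsetD, OF e] keys_f'[THEN subsetD, OF e1] by (simp add: whom_def)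
    qed
    from block_multiples[OF coprime this] obtain \<kappa> where
      \<kappa>: "\<And>i j. i \<in> {q..r} \<Longrightarrow> j \<in> {1..n i} \<Longrightarrow> int (Poly_Mapping.lookup e (TVar i j)) - int (Poly_Mapping.lookup e1 (TVar i j)) = \<kappa> i * int (l i j)"
      and sum_\<kappa>: "(\<Sum>i\<in>{q..r}. \<kappa> i) = 0"
      by metis
    \<comment> \<open>At the index where the minimum is attained no further block fits into
      \<open>e1\<close>, while the exponent of \<open>e\<close> is nonnegative.\<close>
    have nonneg: "int (k0 i) + \<kappa> i \<ge> 0" if i: "i \<in> {q..r}" for i
    proof -
      have "k0 i \<in> (\<lambda>j. Poly_Mapping.lookup e1 (TVar i j) div l i j) ` {1..n i}"
        unfolding k0_def using n_pos[OF i] by (intro Min_in) auto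
      then obtain j where j: "j \<in> {1..n i}" "k0 i = Poly_Mapping.lookup e1 (TVar i j) div l i j"
        by blast
      have "Poly_Mapping.lookup e1 (TVar i j) < (k0 i + 1) * l i j"
        using l_pos[OF i j(1)] dividend_less_times_div[of "l i j" "Poly_Mapping.lookup e1 (TVar i j)"]
        unfolding j(2) by (simp add: algebra_simps)
      then have "int (Poly_Mapping.lookup e1 (TVar i j)) < (int (k0 i) + 1) * int (l i j)"
        by (metis of_nat_1 of_nat_add of_nat_less_iff of_nat_mult)
      then have "0 < (int (k0 i) + 1 + \<kappa> i) * int (l i j)"
        using \<kappa>[OF i j(1)] by (simp add: algebra_simps)
      then show ?thesis
        by (simp add: zero_less_mult_iff)
    qed
    define ke where "ke i = nat (int (k0 i) + \<kappa> i)" for i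
    have ke: "int (ke i) = int (k0 i) + \<kappa> i" if "i \<in> {q..r}" for i
      using nonneg[OF that] by (simp add: ke_def)
    have "e = e0 + block_sum ke"
    proof (rule poly_mapping_eqI)
      fix v
      show "Poly_Mapping.lookup e v = Poly_Mapping.lookup (e0 + block_sum ke) v"
      proof (cases "v \<in> V")
        case True
        then obtain i j where ij: "v = TVar i j" "i \<in> {q..r}" "j \<in> {1..n i}"
          using m by (auto simp: trinomial_vars_def)
        have "int (Poly_Mapping.lookup e v) = int (Poly_Mapping.lookup e1 v - k0 i * l i j) + int (ke i * l i j)"
          using \<kappa>[OF ij(2,3)] k0_le[OF ij(2,3)] ke[OF ij(2)] by (simp add: ij(1) of_nat_diff algebra_simps)
        then have "Poly_Mapping.lookup e v = Poly_Mapping.lookup e1 v - k0 i * l i j + ke i * l i j"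
          by (simp only: of_nat_add[symmetric] of_nat_eq_iff)
        then show ?thesis
          using ij by (simp add: lookup_add e0_def lookup_minus lookup_block_sum)
      next
        case False
        then have "Poly_Mapping.lookup e v = 0" "Poly_Mapping.lookup e1 v = 0"
          using keys_V[OF e] keys_V[OF e1] by (auto simp: in_keys_iff)
        with False show ?thesis
          by (cases v) (auto simp: lookup_add e0_def lookup_minus lookup_block_sum lookup_block_sum_SVar TVar_in_V)
      qed
    qed
    moreover have "int (\<Sum>i\<in>{q..r}. ke i) = int k"
      using sum_\<kappa> by (simp add: ke sum.distrib k_def)
    then have "(\<Sum>i\<in>{q..r}. ke i) = k"
      by (simp only: of_nat_eq_iff)
    ultimately show ?thesis by blast
  qed
  then obtain ke where ke: "\<And>e. e \<in> Poly_Mapping.keys f' \<Longrightarrow> e = e0 + block_sum (ke e)"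
    "\<And>e. e \<in> Poly_Mapping.keys f' \<Longrightarrow> (\<Sum>i\<in>{q..r}. ke e i) = k"
    by metis
  let ?coeff = "Poly_Mapping.lookup f'"
  let ?bf = "binary_form X1 X2 mconst"
  \<comment> \<open>The dehomogenized product of the linear forms that replace the blocks of
    \<open>e\<close>; their combination \<open>p\<close> describes all of \<open>f'\<close> at
    once.\<close>
  define pe where "pe e = (\<Prod>i\<in>{q..r}. [:\<beta> i, \<alpha> i:] ^ ke e i)" for e
  have pe: "degree (pe e) \<le> k" "?bf k (pe e) = (\<Prod>i\<in>{q..r}. (mconst (\<alpha> i) * X1 + mconst (\<beta> i) * X2) ^ ke e i)"
    if "e \<in> Poly_Mapping.keys f'" for e
    using mconst.binary_form_linear_prod[of "{q..r}" \<beta> \<alpha> "ke e" X1 X2] ke(2)[OF that] by (simp_all add: pe_def)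
  define p where "p = (\<Sum>e\<in>Poly_Mapping.keys f'. Polynomial.smult (?coeff e) (pe e))"
  have deg_p: "degree p \<le> k"
    unfolding p_def using pe(1) by (intro degree_sum_le) (auto intro: order.trans[OF degree_smult_le])
  have "f' = (\<Sum>e\<in>Poly_Mapping.keys f'. mconst (?coeff e) * (mmonom e0 * (\<Prod>i\<in>{q..r}. F i ^ ke e i)))"
  proof -
    have "f' = (\<Sum>e\<in>Poly_Mapping.keys f'. Poly_Mapping.single e (?coeff e))"
      by (rule mpoly_monom_expansion)
    also have "\<dots> = (\<Sum>e\<in>Poly_Mapping.keys f'. mconst (?coeff e) * (mmonom e0 * (\<Prod>i\<in>{q..r}. F i ^ ke e i)))"
    proof (rule sum.cong[OF refl])
      fix e assume "e \<in> Poly_Mapping.keys f'"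
      then have "mmonom e = mmonom e0 * (\<Prod>i\<in>{q..r}. F i ^ ke e i)"
        using ke(1) mmonom_add mmonom_block_sum by metis
      then show "Poly_Mapping.single e (?coeff e) = mconst (?coeff e) * (mmonom e0 * (\<Prod>i\<in>{q..r}. F i ^ ke e i))"
        by (simp only: single_eq_mconst_mult[of e "?coeff e"])
    qed
    finally show ?thesis .
  qed
  also have "\<dots> \<approx> (\<Sum>e\<in>Poly_Mapping.keys f'. mconst (?coeff e) * (mmonom e0 * ?bf k (pe e)))"
    by (intro J.eqm_sum J.eqm_mult J.eqm_refl) (simp only: pe(2), intro J.eqm_prod J.eqm_power lin)
  also have "\<dots> = mmonom e0 * ?bf k p"
    unfolding p_def mconst.binary_form_sum mconst.binary_form_smult
    by (simp add: sum_distrib_left mult_ac)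
  finally have eq: "f \<approx> mmonom e0 * ?bf k p"
    using f' J.eqm_trans by blast
  then have notin: "mmonom e0 * ?bf k p \<notin> J" and ker: "d (mmonom e0 * ?bf k p) \<in> J"
    using f J.eqm_mem_iff[OF eq] J.eqm_mem_iff[OF d.d_eqm[OF eq]] by auto
  have d_e0: "d (mmonom e0) \<in> J"
    by (rule d.kernel_factorially_closed[OF notin ker])
  have d_bf: "d (?bf k p) \<in> J"
    by (rule d.kernel_factorially_closed[of _ "mmonom e0"]) (use notin ker in \<open>simp_all add: mult.commute\<close>)
  have notin': "mmonom e0 \<notin> J" "?bf k p \<notin> J"
    using notin d.mult_mem_iff by auto
  \<comment> \<open>A form of positive degree has a linear factor, which lies in the kernel along
    with the form; this is what \<open>nolin\<close> excludes.\<close>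
  have "k = 0"
  proof (rule ccontr)
    assume "k \<noteq> 0"
    then obtain k' where k': "k = Suc k'"
      by (cases k) auto
    then obtain a b p' where "?bf k p = (mconst a * X1 + mconst b * X2) * ?bf k' p'"
      using binary_form_linear_factor[OF deg_p[unfolded k'] ring_map_mconst] by metis
    with d_bf notin'(2) have "(mconst a * X1 + mconst b * X2) * ?bf k' p' \<notin> J"
      "d ((mconst a * X1 + mconst b * X2) * ?bf k' p') \<in> J"
      by simp_all
    then show False
      using nolin d.kernel_factorially_closed d.mult_mem_iff by blast
  qed
  have e0_c: "Poly_Mapping.lookup e0 (TVar i (c i)) = 0" if i: "i \<in> {q..r}" for i
  proof (rule ccontr)
    assume nz: "Poly_Mapping.lookup e0 (TVar i (c i)) \<noteq> 0"
    have "e0 = Poly_Mapping.single (TVar i (c i)) 1 + (e0 - Poly_Mapping.single (TVar i (c i)) 1)"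
      by (rule poly_mapping_eqI)
         (use nz in \<open>auto simp: lookup_add lookup_minus lookup_single when_def\<close>)
    then have "mmonom e0 = T i (c i) * mmonom (e0 - Poly_Mapping.single (TVar i (c i)) 1)"
      by (metis mmonom_add mvar_def)
    then have "d (T i (c i)) \<in> J"
      using d.kernel_factorially_closed notin'(1) d_e0 by metis
    with c[OF i] show False by simp
  qed
  have "\<forall>i\<in>{q..r}. ke e1 i = 0"
    using ke(2)[OF e1] \<open>k = 0\<close> by simp
  then have "Poly_Mapping.lookup e1 (TVar i (c i)) = 0" if "i \<in> {q..r}" for i
    using ke(1)[OF e1] e0_c[OF that] that by (metis add.right_neutral lookup_add lookup_block_sum mult_zero_left)
  then have "wt (choice_weight c) e1 = 0"
    unfolding wt_choice_weight by simp
  then show ?thesis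
    using K e1 keys_f' by (auto simp: whom_def)
qed

end

subsection \<open>Rigidity in Type 2\<close>

context trinomial
begin

text \<open>A linear form is proportional to at most one \<open>F i\<close>, so two of the three
  blocks, \<open>k0\<close> and \<open>k1\<close>, are not proportional to it. Up to the form their
  monomials are proportional, so the degree argument applies; \<open>F k0\<close> and the form then
  span all linear forms.\<close>

lemma linear_form_in_kernel_imp_zero:
  assumes d: "lnd_mod_prime d J"
    and lin: "\<And>i. i \<in> {q..r} \<Longrightarrow> F i \<approx> mconst (\<alpha> i) * X1 + mconst (\<beta> i) * X2"
    and S: "i0 \<in> {q..r}" "i1 \<in> {q..r}" "i2 \<in> {q..r}" "i0 \<noteq> i1" "i0 \<noteq> i2" "i1 \<noteq> i2"
    and special: "\<And>i j. i \<in> {i0, i1, i2} \<Longrightarrow> j \<in> {1..n i} \<Longrightarrow> l i j \<ge> 2"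
    and prime: "\<And>i j. i \<in> {i0, i1, i2} \<Longrightarrow> j \<in> {1..n i} \<Longrightarrow> J.primem (T i j)"
    and ndvd: "\<And>i j k. i \<in> {i0, i1, i2} \<Longrightarrow> j \<in> {1..n i} \<Longrightarrow> k \<in> {q..r} \<Longrightarrow> k \<noteq> i \<Longrightarrow> \<not> J.dvdm (T i j) (F k)"
    and ab: "mconst a * X1 + mconst b * X2 \<notin> J" "d (mconst a * X1 + mconst b * X2) \<in> J"
    and ij: "i \<in> {q..r}" "j \<in> {1..n i}"
  shows "d (T i j) \<in> J"
proof -
  interpret d: lnd_mod_prime d J by fact
  define lam where "lam = mconst a * X1 + mconst b * X2"
  \<comment> \<open>The minor of column \<open>i\<close> against \<open>(a, b)\<close>, zero when
    \<open>F i\<close> and \<open>lam\<close> are proportional.\<close>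
  define \<delta> where "\<delta> i = \<alpha> i * b - \<beta> i * a" for i
  have ab0: "a \<noteq> 0 \<or> b \<noteq> 0"
    using ab(1) by auto
  have one_parallel: "\<delta> i \<noteq> 0 \<or> \<delta> k \<noteq> 0" if "i \<in> {q..r}" "k \<in> {q..r}" "i \<noteq> k" for i k
  proof (rule ccontr)
    assume "\<not> ?thesis"
    then have \<delta>: "\<alpha> i * b = \<beta> i * a" "\<alpha> k * b = \<beta> k * a"
      by (simp_all add: \<delta>_def)
    have "a * \<Delta> i k = \<alpha> i * (\<beta> k * a) - (\<beta> i * a) * \<alpha> k"
      by (simp add: \<Delta>_def algebra_simps)
    also have "\<dots> = 0"
      unfolding \<delta>[symmetric] by simp
    finally have "a * \<Delta> i k = 0" .
    moreover have "b * \<Delta> i k = (\<alpha> i * b) * \<beta> k - \<beta> i * (\<alpha> k * b)"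
      by (simp add: \<Delta>_def algebra_simps)
    then have "b * \<Delta> i k = 0"
      unfolding \<delta> by simp
    ultimately show False
      using ab0 \<Delta>_nz[OF that] by auto
  qed
  obtain k0 k1 where k: "k0 \<in> {i0, i1, i2}" "k1 \<in> {i0, i1, i2}" "k0 \<noteq> k1" "\<delta> k0 \<noteq> 0" "\<delta> k1 \<noteq> 0"
    using one_parallel[of i0 i1] one_parallel[of i0 i2] one_parallel[of i1 i2] S by blast
  have k_r: "k0 \<in> {q..r}" "k1 \<in> {q..r}"
    using k S by auto
  have lam_eq: "mconst (\<delta> k0) * F k1 - mconst (\<delta> k1) * F k0 \<approx> mconst (\<Delta> k0 k1) * lam"
  proof -
    have "mconst (\<delta> k0) * F k1 - mconst (\<delta> k1) * F k0 \<approx>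
        mconst (\<delta> k0) * (mconst (\<alpha> k1) * X1 + mconst (\<beta> k1) * X2) - mconst (\<delta> k1) * (mconst (\<alpha> k0) * X1 + mconst (\<beta> k0) * X2)"
      by (intro J.eqm_diff J.eqm_mult J.eqm_refl lin k_r)
    also have "\<dots> = mconst (\<Delta> k0 k1) * lam"
      by (simp add: lam_def \<delta>_def \<Delta>_def mconst.map_diff mconst.map_mult algebra_simps)
    finally show ?thesis .
  qed
  have d_lam: "d lam \<in> J"
    using ab(2) by (simp add: lam_def)
  have "mconst (\<delta> k0) * d (F k1) - mconst (\<delta> k1) * d (F k0) \<in> J"
    using d.d_eqm[OF lam_eq] J.mult_mem[OF d_lam, of "mconst (\<Delta> k0 k1)"] J.eqm_mem_iff
    by (simp add: d.d_diff d.d_mconst_mult)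
  from J.mult_mem[OF J.uminus_mem[OF this], of "mconst (inverse (\<delta> k1))"]
  have "(mconst (inverse (\<delta> k1)) * mconst (\<delta> k1)) * d (F k0) - (mconst (inverse (\<delta> k1)) * mconst (\<delta> k0)) * d (F k1) \<in> J"
    by (simp add: algebra_simps)
  then have dF: "d (F k0) \<approx> mconst (inverse (\<delta> k1) * \<delta> k0) * d (F k1)"
    using k(5) by (simp add: J.eqm_def flip: mconst.map_mult)
  let ?P = "\<lambda>i. \<Prod>j\<in>{1..n i}. T i j ^ (l i j - 1)"
  have F_dvd: "?P i dvd F i" for i
    unfolding trinomial_monom_def by (intro prod_dvd_prod le_imp_power_dvd) simp
  have "d (F k0) \<in> J"
    unfolding trinomial_monom_def
  proof (rule d.coprime_powers_in_kernel)
    show "inverse (\<delta> k1) * \<delta> k0 \<noteq> 0"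
      using k by simp
    show "d (\<Prod>j=1..n k0. T k0 j ^ l k0 j) \<approx> mconst (inverse (\<delta> k1) * \<delta> k0) * d (\<Prod>j=1..n k1. T k1 j ^ l k1 j)"
      using dF by (simp add: trinomial_monom_def)
    fix f g assume fg: "?P k0 * f \<approx> ?P k1 * g"
    show "\<exists>h. f \<approx> ?P k1 * h"
    proof (rule d.prime_factors_coprime)
      show "?P k1 * g \<approx> ?P k0 * f"
        using fg by (rule J.eqm_sym)
      fix j assume j: "j \<in> {1..n k1}"
      show "J.primem (T k1 j)"
        using prime[OF k(2) j] .
      show "\<not> J.dvdm (T k1 j) (?P k0)"
      proof
        assume "J.dvdm (T k1 j) (?P k0)"
        moreover obtain h where "F k0 = ?P k0 * h"
          using F_dvd[of k0] by (rule dvdE)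
        ultimately have "J.dvdm (T k1 j) (F k0)"
          by (simp only: J.dvdm_mult)
        then show False
          using ndvd[OF k(2) j k_r(1) k(3)] by simp
      qed
    qed simp
  qed (use special[OF k(1)] special[OF k(2)] F_notin_J[OF k_r(1)] F_notin_J[OF k_r(2)] in \<open>simp_all add: trinomial_monom_def\<close>)
  have X_J: "d X1 \<in> J" "d X2 \<in> J"
  proof -
    have "mconst b * F k0 - mconst (\<beta> k0) * lam \<approx> mconst b * (mconst (\<alpha> k0) * X1 + mconst (\<beta> k0) * X2) - mconst (\<beta> k0) * lam"
      by (intro J.eqm_diff J.eqm_mult J.eqm_refl lin k_r)
    also have "\<dots> = mconst (\<delta> k0) * X1"
      by (simp add: lam_def \<delta>_def mconst.map_diff mconst.map_mult algebra_simps)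
    finally have 1: "mconst b * F k0 - mconst (\<beta> k0) * lam \<approx> mconst (\<delta> k0) * X1" .
    have "mconst (\<alpha> k0) * lam - mconst a * F k0 \<approx> mconst (\<alpha> k0) * lam - mconst a * (mconst (\<alpha> k0) * X1 + mconst (\<beta> k0) * X2)"
      by (intro J.eqm_diff J.eqm_mult J.eqm_refl lin k_r)
    also have "\<dots> = mconst (\<delta> k0) * X2"
      by (simp add: lam_def \<delta>_def mconst.map_diff mconst.map_mult algebra_simps)
    finally have 2: "mconst (\<alpha> k0) * lam - mconst a * F k0 \<approx> mconst (\<delta> k0) * X2" .
    have "d (mconst b * F k0 - mconst (\<beta> k0) * lam) \<in> J" "d (mconst (\<alpha> k0) * lam - mconst a * F k0) \<in> J"
      using \<open>d (F k0) \<in> J\<close> d_lam by (auto simp: d.d_diff d.d_mconst_mult intro: J.diff_mem J.mult_mem)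
    then have "mconst (\<delta> k0) * d X1 \<in> J" "mconst (\<delta> k0) * d X2 \<in> J"
      using J.eqm_mem_iff[OF d.d_eqm[OF 1]] J.eqm_mem_iff[OF d.d_eqm[OF 2]] by (simp_all add: d.d_mconst_mult)
    then show "d X1 \<in> J" "d X2 \<in> J"
      using mconst_cancel[OF k(4)] by blast+
  qed
  have "d (F i) \<in> J"
    using X_J J.eqm_mem_iff[OF d.d_eqm[OF lin[OF ij(1)]]]
    by (simp add: d.d_add d.d_mconst_mult J.add_mem J.mult_mem)
  then show ?thesis
    using F_notin_J[OF ij(1)] l_pos[OF ij] ij(2) unfolding trinomial_monom_def
    by (intro d.kernel_prod_powers[of "{1..n i}" "T i" "l i"]) auto
qed

text \<open>If no linear form is in the kernel, then, for the grading by the variables \<open>T i (c i)\<close>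
  outside the kernel, the kernel sits in degree \<open>0\<close>. Then \<open>F i0\<close> and \<open>F i1\<close> have the same
  \<open>ddeg\<close> and are proportional over the kernel, which contradicts the primality of \<open>T i0 (c i0)\<close>.\<close>

lemma linear_form_in_kernel:
  assumes type2: "is_Type2 A" and m: "m = 0" and d: "lnd_mod_prime d J" and coprime: "exponents_coprime_blocks"
    and hom: "\<And>c. c \<in> choices \<Longrightarrow> \<exists>\<delta>. der_whom (choice_weight c) \<delta> d"
    and lin: "\<And>i. i \<in> {q..r} \<Longrightarrow> F i \<approx> mconst (\<alpha> i) * X1 + mconst (\<beta> i) * X2"
    and i: "i0 \<in> {q..r}" "i1 \<in> {q..r}" "i0 \<noteq> i1"
    and prime: "\<And>j. j \<in> {1..n i0} \<Longrightarrow> J.primem (T i0 j)"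
    and ndvd: "\<And>j. j \<in> {1..n i0} \<Longrightarrow> \<not> J.dvdm (T i0 j) (F i1)"
  shows "\<exists>a b. mconst a * X1 + mconst b * X2 \<notin> J \<and> d (mconst a * X1 + mconst b * X2) \<in> J"
proof (rule ccontr)
  assume "\<not> ?thesis"
  then have nolin: "mconst a * X1 + mconst b * X2 \<notin> J \<Longrightarrow> d (mconst a * X1 + mconst b * X2) \<notin> J" for a b
    by blast
  interpret d: lnd_mod_prime d J by fact
  have d_F: "d (F i) \<notin> J" if "i \<in> {q..r}" for i
    using nolin[of "\<alpha> i" "\<beta> i"] F_notin_J[OF that] J.eqm_mem_iff[OF lin[OF that]]
      J.eqm_mem_iff[OF d.d_eqm[OF lin[OF that]]] by simp
  have "\<exists>j\<in>{1..n i}. d (T i j) \<notin> J" if i: "i \<in> {q..r}" for i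
  proof (rule ccontr)
    assume "\<not> ?thesis"
    then have T_J: "d (T i j) \<in> J" if "j \<in> {1..n i}" for j
      using that by blast
    have "d (\<Prod>j\<in>K. T i j ^ l i j) \<in> J" if "K \<subseteq> {1..n i}" for K
      using that
    proof (induction K rule: infinite_finite_induct)
      case (insert j K)
      have "d (T i j) \<in> J" "d (\<Prod>j\<in>K. T i j ^ l i j) \<in> J"
        using insert T_J by auto
      then have "of_nat (l i j) * T i j ^ (l i j - 1) * d (T i j) * (\<Prod>j\<in>K. T i j ^ l i j)
          + T i j ^ l i j * d (\<Prod>j\<in>K. T i j ^ l i j) \<in> J"
        by (intro J.add_mem J.mult_mem'[OF J.mult_mem] J.mult_mem)
      then show ?case
        using insert.hyps by (simp add: d.d_mult d.d_power)
    qed auto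
    from this[of "{1..n i}"] d_F[OF i] show False
      by (simp add: trinomial_monom_def)
  qed
  then have "\<forall>i\<in>{q..r}. \<exists>j. j \<in> {1..n i} \<and> d (T i j) \<notin> J"
    by blast
  then obtain c' where c': "\<And>i. i \<in> {q..r} \<Longrightarrow> c' i \<in> {1..n i} \<and> d (T i (c' i)) \<notin> J"
    by metis
  define c where "c = restrict c' {q..r}"
  have c: "c \<in> choices" "\<And>i. i \<in> {q..r} \<Longrightarrow> d (T i (c i)) \<notin> J"
    using c' by (auto simp: c_def choices_def)
  let ?w = "choice_weight c"
  let ?L = "int exponent_prod"
  define hom_all where "hom_all f \<longleftrightarrow> (\<forall>c\<in>choices. \<exists>k. whom (choice_weight c) k f)" for f :: "(trinomial_var, 'k) mpoly"
  have kernel_degree: "K = 0" if "hom_all f" "f \<notin> J" "d f \<in> J" "whom ?w K f" for f K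
    using that by (intro homogeneous_kernel[OF m d coprime lin nolin c(2), of f K]) (auto simp: hom_all_def)
  obtain \<delta> where \<delta>: "der_whom ?w \<delta> d"
    using hom c(1) by blast
  have whom_F': "whom (choice_weight c) ?L (F i)" if "c \<in> choices" "i \<in> {q..r}" for c i
    by (rule whom_F[OF choice_weight_compatible]) (use that in auto)
  \<comment> \<open>The last iterated derivative of \<open>F i\<close> outside \<open>J\<close> is
    homogeneous and in the kernel, hence of degree zero. This makes \<open>ddeg (F i)\<close> the
    same for all \<open>i\<close>.\<close>
  have ddeg_eq: "?L + int (d.ddeg (F i)) * \<delta> = 0" if i: "i \<in> {q..r}" for i
  proof (rule kernel_degree)
    show "(d ^^ d.ddeg (F i)) (F i) \<notin> J"
      using d.funpow_mem_iff[OF F_notin_J[OF i]] by simp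
    have "(d ^^ Suc (d.ddeg (F i))) (F i) \<in> J"
      using d.funpow_mem_iff[OF F_notin_J[OF i]] by blast
    then show "d ((d ^^ d.ddeg (F i)) (F i)) \<in> J"
      by simp
    show "whom ?w (?L + int (d.ddeg (F i)) * \<delta>) ((d ^^ d.ddeg (F i)) (F i))"
      by (rule d.whom_funpow_d[OF \<delta> whom_F'[OF c(1) i]])
    show "hom_all ((d ^^ d.ddeg (F i)) (F i))"
      unfolding hom_all_def using hom d.whom_funpow_d whom_F' i by metis
  qed
  have "\<delta> \<noteq> 0"
    using ddeg_eq[OF i(1)] exponent_prod_pos by auto
  define k where "k = d.ddeg (F i0)"
  have k: "d.ddeg (F i1) = k" "?L + int k * \<delta> = 0"
  proof -
    have "int (d.ddeg (F i1)) * \<delta> = int k * \<delta>"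
      using ddeg_eq[OF i(1)] ddeg_eq[OF i(2)] unfolding k_def by linarith
    then show "d.ddeg (F i1) = k"
      using \<open>\<delta> \<noteq> 0\<close> by simp
    show "?L + int k * \<delta> = 0"
      using ddeg_eq[OF i(1)] by (simp add: k_def)
  qed
  define u0 where "u0 = (d ^^ k) (F i0)"
  define u1 where "u1 = (d ^^ k) (F i1)"
  have u: "u0 \<notin> J" "d u0 \<in> J" "d u1 \<in> J"
  proof -
    show "u0 \<notin> J"
      using d.funpow_mem_iff[OF F_notin_J[OF i(1)], of k] by (simp add: u0_def k_def)
    have "(d ^^ Suc k) (F i0) \<in> J" "(d ^^ Suc k) (F i1) \<in> J"
      using d.funpow_mem_iff[OF F_notin_J[OF i(1)], of "Suc k"] d.funpow_mem_iff[OF F_notin_J[OF i(2)], of "Suc k"] k(1)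
      by (simp_all add: k_def del: funpow.simps)
    then show "d u0 \<in> J" "d u1 \<in> J"
      by (simp_all add: u0_def u1_def)
  qed
  have whom_u: "whom (choice_weight c) (?L + int k * \<epsilon>) u0" "whom (choice_weight c) (?L + int k * \<epsilon>) u1"
    if "c \<in> choices" "der_whom (choice_weight c) \<epsilon> d" for c \<epsilon>
    unfolding u0_def u1_def by (rule d.whom_funpow_d[OF that(2) whom_F'[OF that(1)]], rule i)+
  \<comment> \<open>The \<open>k\<close>-th derivatives of the two terms agree modulo
    \<open>J\<close>, as \<open>u0\<close> and \<open>u1\<close> are in the kernel. But
    \<open>u0\<close> and \<open>u1\<close> have degree zero, so a nonzero \<open>g\<close> has the
    degree of \<open>F i0\<close> and needs exactly \<open>k\<close> steps to reach degree
    zero.\<close>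
  define g where "g = u1 * F i0 - u0 * F i1"
  have whom_g: "whom (choice_weight c) (?L + int k * \<epsilon> + ?L) g"
    if "c \<in> choices" "der_whom (choice_weight c) \<epsilon> d" for c \<epsilon>
    unfolding g_def by (intro whom_diff whom_mult whom_u whom_F' that i)
  have pull: "(d ^^ j) (v * f) \<approx> v * (d ^^ j) f" if "d v \<in> J" for v f j
  proof (induction j)
    case (Suc j)
    have "d ((d ^^ j) (v * f)) \<approx> d (v * (d ^^ j) f)"
      by (rule d.d_eqm[OF Suc])
    also have "\<dots> = d v * (d ^^ j) f + v * d ((d ^^ j) f)"
      by (rule d.d_mult)
    also have "\<dots> \<approx> 0 + v * d ((d ^^ j) f)"
      using that by (intro J.eqm_add J.eqm_refl) (simp add: J.eqm_0_iff J.mult_mem')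
    finally show ?case by simp
  qed simp
  have "(d ^^ k) g \<approx> u1 * u0 - u0 * u1"
  proof -
    have "(d ^^ k) g = (d ^^ k) (u1 * F i0) - (d ^^ k) (u0 * F i1)"
      using d.funpow_add[of k "g" "u0 * F i1"] by (simp add: g_def)
    also have "\<dots> \<approx> u1 * (d ^^ k) (F i0) - u0 * (d ^^ k) (F i1)"
      by (intro J.eqm_diff pull u)
    finally show ?thesis
      by (simp add: u0_def u1_def)
  qed
  then have dk_g: "(d ^^ k) g \<in> J"
    by (simp add: J.eqm_0_iff mult.commute)
  have "g \<in> J"
  proof (rule ccontr)
    assume g: "g \<notin> J"
    let ?k = "d.ddeg g"
    have "?L + int ?k * \<delta> = 0"
    proof (rule kernel_degree)
      show "(d ^^ ?k) g \<notin> J"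
        using d.funpow_mem_iff[OF g] by simp
      have "(d ^^ Suc ?k) g \<in> J"
        using d.funpow_mem_iff[OF g] by blast
      then show "d ((d ^^ ?k) g) \<in> J"
        by simp
      have "whom ?w (?L + int k * \<delta> + ?L + int ?k * \<delta>) ((d ^^ ?k) g)"
        by (rule d.whom_funpow_d[OF \<delta> whom_g[OF c(1) \<delta>]])
      then show "whom ?w (?L + int ?k * \<delta>) ((d ^^ ?k) g)"
        using k(2) by simp
      show "hom_all ((d ^^ ?k) g)"
        unfolding hom_all_def using hom d.whom_funpow_d whom_g by metis
    qed
    then have "?k = k"
      using k(2) \<open>\<delta> \<noteq> 0\<close> by (metis add_left_cancel mult_cancel_right of_nat_eq_iff)
    then show False
      using d.funpow_mem_iff[OF g, of k] dk_g by simp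
  qed
  then have eq: "u1 * F i0 \<approx> u0 * F i1"
    by (simp add: J.eqm_def g_def)
  let ?T = "T i0 (c i0)"
  have ci0: "c i0 \<in> {1..n i0}"
    using choicesD[OF c(1) i(1)] .
  have "?T dvd ?T ^ l i0 (c i0)"
    using l_pos[OF i(1) ci0] by (intro dvd_power) auto
  also have "\<dots> dvd F i0"
    unfolding trinomial_monom_def using ci0 by (intro dvd_prodI) auto
  finally obtain h where "F i0 = ?T * h" ..
  then have "J.dvdm ?T (u1 * F i0)"
    by (intro J.dvdmI[of _ _ "u1 * h"]) (simp add: mult_ac)
  then have "J.dvdm ?T (u0 * F i1)"
    by (rule J.dvdm_eqm[OF _ eq])
  then have "J.dvdm ?T u0"
    using prime[OF ci0] ndvd[OF ci0] by (auto simp: J.primem_def)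
  then obtain y where y: "u0 - ?T * y \<in> J"
    by (auto simp: J.dvdm_def J.eqm_def)
  have w_T: "?w (TVar i0 (c i0)) > 0"
  proof -
    obtain e where e: "exponent_prod = l i0 (c i0) * e"
      using exponent_prod_dvd[OF i(1) ci0] by (rule dvdE)
    then have "exponent_prod div l i0 (c i0) > 0"
      using exponent_prod_pos l_pos[OF i(1) ci0] by simp
    then show ?thesis
      using i(1) by (simp add: choice_weight_def)
  qed
  \<comment> \<open>All weights are nonnegative and that of \<open>?T\<close> is positive, so a
    multiple of \<open>?T\<close> has no component in degree zero, where \<open>u0\<close>
    lives.\<close>
  have "wcomp ?w 0 (?T * y) = ?T * wcomp ?w (- ?w (TVar i0 (c i0))) y"
    using wcomp_mult_whom[OF whom_mvar, of ?w "TVar i0 (c i0)" "- ?w (TVar i0 (c i0))" y] by simp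
  also have "wcomp ?w (- ?w (TVar i0 (c i0))) y = 0"
  proof (rule poly_mapping_eqI)
    fix e
    have "wt ?w e \<noteq> - ?w (TVar i0 (c i0))"
      using wt_choice_weight_nonneg[of c e] w_T by linarith
    then show "Poly_Mapping.lookup (wcomp ?w (- ?w (TVar i0 (c i0))) y) e = Poly_Mapping.lookup 0 e"
      by (simp add: lookup_wcomp)
  qed
  finally have "wcomp ?w 0 (?T * y) = 0"
    by simp
  moreover have "wcomp ?w 0 u0 = u0"
    using wcomp_whom[OF whom_u(1)[OF c(1) \<delta>]] k(2) by simp
  moreover have "graded_ideal ?w J"
    by (rule graded_J[OF type2 choice_weight_compatible[OF c(1)]])
  ultimately have "u0 \<in> J"
    using y by (metis diff_zero graded_ideal_def wcomp_diff)
  with u(1) show False by blast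
qed

text \<open>Nonrigidity only provides some nonzero derivation; it may be exchanged for one that is
  homogeneous under all choices, whose kernel can be controlled.\<close>

lemma rigid_type2:
  assumes type2: "is_Type2 A" and m: "m = 0" and factorial: "factorial_domain B"
    and i: "i0 \<in> {q..r}" "i1 \<in> {q..r}" "i2 \<in> {q..r}" "i0 \<noteq> i1" "i0 \<noteq> i2" "i1 \<noteq> i2"
    and special: "\<And>i j. i \<in> {i0, i1, i2} \<Longrightarrow> j \<in> {1..n i} \<Longrightarrow> l i j \<ge> 2"
  shows "rigid_algebra B \<iota>"
proof (rule ccontr)
  assume "\<not> rigid_algebra B \<iota>"
  then obtain d' where d': "lnd_mod_ideal d' J" "\<And>v. v \<notin> V \<Longrightarrow> d' (mvar v) = 0" "\<exists>v. d' (mvar v) \<notin> J"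
    by (rule not_rigidE) (rule that; simp)
  have "\<exists>d. lnd_mod_ideal d J \<and> (\<forall>w\<in>choice_weight ` choices. \<exists>\<delta>. der_whom w \<delta> d) \<and>
      (\<exists>v. d (mvar v) \<notin> J) \<and> (\<forall>v. v \<notin> V \<longrightarrow> d (mvar v) = 0)"
    by (rule homogenize_finite[OF d'(1) _ _ finite_V d'(2,3)])
       (auto simp: finite_choices intro: graded_J[OF type2 choice_weight_compatible])
  then obtain d where d: "lnd_mod_ideal d J" "\<forall>w\<in>choice_weight ` choices. \<exists>\<delta>. der_whom w \<delta> d"
    "\<exists>v. d (mvar v) \<notin> J" "\<forall>v. v \<notin> V \<longrightarrow> d (mvar v) = 0"
  proof (elim exE conjE)
    fix d v
    assume "lnd_mod_ideal d J" "\<forall>w\<in>choice_weight ` choices. \<exists>\<delta>. der_whom w \<delta> d"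
      "d (mvar v) \<notin> J" "\<forall>v. v \<notin> V \<longrightarrow> d (mvar v) = 0"
    with that[of d] show thesis by blast
  qed
  interpret d: lnd_mod_ideal d J by fact
  have "prime_ring_ideal J"
    using factorial by (intro prime_ideal_J) (simp add: factorial_domain_def)
  then interpret d: lnd_mod_prime d J
    by (intro lnd_mod_prime.intro d(1))
  have prime: "J.primem (T i j)" if "i \<in> {i0, i1, i2}" "j \<in> {1..n i}" for i j
    using that i special by (intro special_variable_primem[OF factorial type2]) auto
  have in_range: "k \<in> {q..r}" if "k \<in> {i0, i1, i2}" for k
    using that i by auto
  have coprime: exponents_coprime_blocks
    unfolding exponents_coprime_blocks_def
  proof (intro ballI impI allI)
    fix i k p assume ik: "i \<in> {q..r}" "k \<in> {q..r}" "i \<noteq> k"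
      and p: "\<forall>j\<in>{1..n i}. p dvd l i j" "\<forall>j\<in>{1..n k}. p dvd l k j"
    show "p = 1"
    proof (cases "\<exists>j. j \<in> {1..n i} \<and> l i j = 1 \<or> j \<in> {1..n k} \<and> l k j = 1")
      case True
      with p show ?thesis
        by (metis nat_dvd_1_iff_1)
    next
      case False
      \<comment> \<open>One of the three special blocks differs from both \<open>i\<close> and
        \<open>k\<close>; its variables are the primes used to compare the two.\<close>
      obtain s where s: "s \<in> {i0, i1, i2}" "s \<noteq> i" "s \<noteq> k"
        using i(4-6) by blast
      have 1: "1 \<in> {1..n s}"
        using n_pos[OF in_range[OF s(1)]] by auto
      show ?thesis
        by (rule exponents_coprime[OF type2 in_range[OF s(1)] 1 prime[OF s(1) 1] ik]) (use s p in auto)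
    qed
  qed
  obtain X1 X2 where lin: "\<And>i. i \<in> {q..r} \<Longrightarrow> F i \<approx> mconst (\<alpha> i) * X1 + mconst (\<beta> i) * X2"
    using F_linear by metis
  have "\<exists>a b. mconst a * X1 + mconst b * X2 \<notin> J \<and> d (mconst a * X1 + mconst b * X2) \<in> J"
  proof (rule linear_form_in_kernel[OF type2 m d.lnd_mod_prime_axioms coprime _ lin i(1,2,4)])
    show "\<exists>\<delta>. der_whom (choice_weight c) \<delta> d" if "c \<in> choices" for c
      using d(2) that by blast
    show "J.primem (T i0 j)" "\<not> J.dvdm (T i0 j) (F i1)" if "j \<in> {1..n i0}" for j
      using prime[of i0 j] variable_not_dvdm_F[OF type2 i(1) that i(2)] that i(4) by auto
  qed
  then obtain a b where ab: "mconst a * X1 + mconst b * X2 \<notin> J" "d (mconst a * X1 + mconst b * X2) \<in> J"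
    by (elim exE conjE) (rule that)
  have "d (T i j) \<in> J" if "i \<in> {q..r}" "j \<in> {1..n i}" for i j
  proof (rule linear_form_in_kernel_imp_zero[OF d.lnd_mod_prime_axioms lin i special prime _ ab that])
    show "\<not> J.dvdm (T i j) (F k)" if "i \<in> {i0, i1, i2}" "j \<in> {1..n i}" "k \<in> {q..r}" "k \<noteq> i" for i j k
      using variable_not_dvdm_F[OF type2 in_range[OF that(1)] that(2,3,4)] .
  qed
  note T_J = this
  have "d (mvar v) \<in> J" for v
  proof (cases "v \<in> V")
    case True
    then show ?thesis
    proof (cases rule: V_cases)
      case (TVar i j)
      then show ?thesis
        using T_J by blast
    next
      case (SVar k)
      with m show ?thesis by simp
    qed
  next
    case False
    then have "d (mvar v) = 0"
      using d(4) by blast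
    then show ?thesis by simp
  qed
  with d(3) show False by blast
qed

end

theorem theorem3:
  fixes r m :: nat
    and n :: "nat \<Rightarrow> nat"
    and l :: "nat \<Rightarrow> nat \<Rightarrow> nat"
    and A :: "'k::{alg_closed_field, field_char_0} trinomial_coeffs"
  assumes "trinomial_data r n l A"
    and "is_Type2 A \<Longrightarrow> factorial_domain (trinomial_algebra r m n l A)"
  shows "\<not> rigid_algebra (trinomial_algebra r m n l A) (trinomial_const r m n l A) \<longleftrightarrow>
      m \<noteq> 0 \<or>
      (is_Type1 A \<and> (\<exists>b\<in>{1..r}. \<forall>i\<in>{1..r} - {b}. \<exists>j\<in>{1..n i}. l i j = 1)) \<or>
      (is_Type2 A \<and> (\<exists>b\<in>{0..r}. \<exists>c\<in>{0..r}. \<forall>i\<in>{0..r} - {b, c}. \<exists>j\<in>{1..n i}. l i j = 1))"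
proof -
  let ?rigid = "rigid_algebra (trinomial_algebra r m n l A) (trinomial_const r m n l A)"
  let ?linear1 = "\<exists>b\<in>{1..r}. \<forall>i\<in>{1..r} - {b}. \<exists>j\<in>{1..n i}. l i j = 1"
  let ?linear2 = "\<exists>b\<in>{0..r}. \<exists>c\<in>{0..r}. \<forall>i\<in>{0..r} - {b, c}. \<exists>j\<in>{1..n i}. l i j = 1"
  interpret trinomial r m n l A
    by unfold_locales (rule assms(1))
  have special: "l i j \<ge> 2" if "i \<in> {q..r}" "\<not> (\<exists>j\<in>{1..n i}. l i j = 1)" "j \<in> {1..n i}" for i j
    using l_pos[OF that(1,3)] that(2,3) by (metis Suc_1 Suc_leI le_neq_implies_less One_nat_def)
  have type1: "?rigid" if "m = 0" "is_Type1 A" "\<not> ?linear1"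
  proof -
    have q: "q = 1"
      using that(2) by (simp add: q_cases)
    \<comment> \<open>A block without exponent \<open>1\<close>, once found, is used as the next
      \<open>b\<close> and thereby yields a second one.\<close>
    have ex: "\<exists>i\<in>{1..r} - {b}. \<not> (\<exists>j\<in>{1..n i}. l i j = 1)" if "b \<in> {1..r}" for b
      using \<open>\<not> ?linear1\<close> that by blast
    obtain i1 where i1: "i1 \<in> {1..r}" "\<not> (\<exists>j\<in>{1..n i1}. l i1 j = 1)"
    proof -
      have "1 \<in> {1..r}"
        using r_pos by auto
      from ex[OF this] that show ?thesis by blast
    qed
    obtain i2 where i2: "i2 \<in> {1..r} - {i1}" "\<not> (\<exists>j\<in>{1..n i2}. l i2 j = 1)"
      using ex[OF i1(1)] by blast
    show ?thesis
      unfolding is_quotient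
      by (rule rigid_type1[of i1 i2, OF that(2,1)]) (use i1 i2 special in \<open>auto simp: q\<close>)
  qed
  have type2: "?rigid" if "m = 0" "is_Type2 A" "\<not> ?linear2"
  proof -
    have q: "q = 0"
      using that(2) by (cases A) auto
    have ex: "\<exists>i\<in>{0..r} - {b, c}. \<not> (\<exists>j\<in>{1..n i}. l i j = 1)" if "b \<in> {0..r}" "c \<in> {0..r}" for b c
      using \<open>\<not> ?linear2\<close> that by blast
    \<comment> \<open>Three rounds, in which the blocks already found take the places of
      \<open>b\<close> and \<open>c\<close>.\<close>
    obtain i0 where i0: "i0 \<in> {0..r}" "\<not> (\<exists>j\<in>{1..n i0}. l i0 j = 1)"
      using ex[of 0 0] by force
    obtain i1 where i1: "i1 \<in> {0..r} - {i0}" "\<not> (\<exists>j\<in>{1..n i1}. l i1 j = 1)"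
      using ex[OF i0(1) i0(1)] by blast
    obtain i2 where i2: "i2 \<in> {0..r} - {i0, i1}" "\<not> (\<exists>j\<in>{1..n i2}. l i2 j = 1)"
      using ex[of i0 i1] i0(1) i1(1) by blast
    have "factorial_domain B"
      using assms(2)[OF that(2)] by (simp add: is_quotient)
    then show ?thesis
      unfolding is_quotient
      by (rule rigid_type2[of i0 i1 i2, OF that(2,1)]) (use i0 i1 i2 special in \<open>auto simp: q\<close>)
  qed
  show ?thesis
  proof
    assume nr: "\<not> ?rigid"
    have types: "is_Type1 A \<or> is_Type2 A"
      by (cases A) auto
    show "m \<noteq> 0 \<or> (is_Type1 A \<and> ?linear1) \<or> (is_Type2 A \<and> ?linear2)"
    proof (cases "m = 0")
      case True
      from types show ?thesis
      proof
        assume "is_Type1 A"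
        moreover have ?linear1
          by (rule ccontr) (rule notE[OF nr type1[OF True calculation]])
        ultimately show ?thesis by (intro disjI2 disjI1 conjI)
      next
        assume "is_Type2 A"
        moreover have ?linear2
          by (rule ccontr) (rule notE[OF nr type2[OF True calculation]])
        ultimately show ?thesis by (intro disjI2 conjI)
      qed
    qed simp
  next
    assume "m \<noteq> 0 \<or> (is_Type1 A \<and> ?linear1) \<or> (is_Type2 A \<and> ?linear2)"
    then show "\<not> ?rigid"
      unfolding is_quotient
    proof (elim disjE conjE bexE)
      show "\<not> rigid_algebra B \<iota>" if "m \<noteq> 0"
        by (rule not_rigid_if_S[OF that])
      show "\<not> rigid_algebra B \<iota>"
        if "is_Type1 A" "b \<in> {1..r}" "\<forall>i\<in>{1..r} - {b}. \<exists>j\<in>{1..n i}. l i j = 1" for b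
        by (rule not_rigid_type1[OF that])
      show "\<not> rigid_algebra B \<iota>"
        if "is_Type2 A" "b \<in> {0..r}" "c \<in> {0..r}" "\<forall>i\<in>{0..r} - {b, c}. \<exists>j\<in>{1..n i}. l i j = 1" for b c
        by (rule not_rigid_type2[OF that])
    qed
  qed
qed

end
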